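(* Let $\mathcal M$ be a smooth (at least $C^3$), closed, compact immersed surface in $\mathbb R^N$, $N\ge 3$ (not assumed oriented). Let $\mathbf c$ be a rectifiable curve in $\mathcal M$ with finite total intrinsic curvature, $\mathrm{TC}_{\mathcal M}(\mathbf c)<\infty$, parameterized by arc length $\mathbf c:[0,L]\to\mathcal M$, where $L$ is the length of $\mathbf c$, and set $I_L=(0,L)$. Let $\{P_h\}$ be a sequence of polygonals in $\mathcal M$ inscribed in $\mathbf c$, each starting at $\mathbf c(0)$ and ending at $\mathbf c(L)$, whose modulus goes to zero, $\mu_{\mathbf c}(P_h)\to 0$. For each $h$ let $P_h:[0,L]\to\mathcal M$ be parameterized with constant velocity, and let $X_h:[0,L]\to\mathbb R^N$ be the parallel transport along $P_h$ with initial condition $X_h(0)=\mathbf t(0)$. Then a subsequence of $\{X_h\}$ converges strongly in $W^{1,1}$ to some function $X\in W^{1,1}(I_L,\mathbb R^N)$ satisfying $$X(s)=\cos\Theta(s)\,\mathbf t(s)-\sin\Theta(s)\,\mathbf u(s)\qquad\text{for a.e. } s\in I_L,$$ for an angle function $\Theta:I_L\to\mathbb R$ which has bounded variation, $\Theta\in \mathrm{BV}(I_L)$.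
   Context: Polygonals and total intrinsic curvature. A polygonal in $\mathcal M$ is a finite concatenation of geodesic arcs of $\mathcal M$; its rotation $\mathbf k_{\mathcal M}(P)$ is the sum of the (non-negative) turning angles between consecutive geodesic arcs. $P$ is inscribed in a curve $\mathbf c:[a,b]\to\mathcal M$ if it is obtained by choosing $a\le t_0<t_1<\dots<t_n\le b$ and connecting the consecutive points $\mathbf c(t_i)$ by (length-minimizing) geodesic segments of $\mathcal M$; $\mathcal P_{\mathcal M}(\mathbf c)$ is the class of such polygonals. The modulus $\mu_{\mathbf c}(P)$ is the maximum of the geodesic diameters in $\mathcal M$ of the arcs of $\mathbf c$ determined by consecutive vertices of $P$. The total intrinsic curvature of $\mathbf c$ is $$\mathrm{TC}_{\mathcal M}(\mathbf c):=\lim_{\varepsilon\to0^+}\sup\{\mathbf k_{\mathcal M}(P)\mid P\in\mathcal P_{\mathcal M}(\mathbf c),\ \mu_{\mathbf c}(P)<\varepsilon\}.$$ Frame. $\mathbf t:=\dot{\mathbf c}$ is the tantrix (unit tangent vector), defined a.e.; $\mathbf t(0)$ is its (right) limit at $0$. $\mathbf u$ is the unit conormal: $\mathbf u(s)\in T_{\mathbf c(s)}\mathcal M$ is the unit vector orthogonal to $\mathbf t(s)$ obtained by a positive rotation (by $\pi/2$) of $\mathbf t(s)$ in $T_{\mathbf c(s)}\mathcal M$, with respect to an orientation of the tangent planes chosen continuously along $\mathbf c$ (if $N=3$, $\mathbf u=\mathbf n\times\mathbf t$ with $\mathbf n$ the unit normal to $\mathcal M$ along $\mathbf c$). Parallel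 transport. Along a piecewise smooth curve $P:[0,L]\to\mathcal M$, a parallel transport is a continuous, piecewise smooth $X:[0,L]\to\mathbb R^N$ with $X(s)\in T_{P(s)}\mathcal M$ for all $s$ and $\dot X(s)\perp T_{P(s)}\mathcal M$ away from the corner points. *)

theory Defs
  imports "HOL-Analysis.Analysis"
begin

subsection \<open>Immersed surfaces\<close>

text \<open>For an open set \<open>D\<close>: Frechet differentiable \<open>k\<close> times, with continuous \<open>k\<close>-th derivatives.\<close>

primrec Ck_on :: "nat \<Rightarrow> ('a::euclidean_space \<Rightarrow> 'b::euclidean_space) \<Rightarrow> 'a set \<Rightarrow> bool" where
  "Ck_on 0 f D \<longleftrightarrow> continuous_on D f"
| "Ck_on (Suc k) f D \<longleftrightarrow>
     (\<forall>x\<in>D. f differentiable (at x)) \<and>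
     (\<forall>v\<in>Basis. Ck_on k (\<lambda>x. frechet_derivative f (at x) v) D)"

text \<open>
  A surface is a set \<open>M\<close> in a Hausdorff space, together with a map \<open>\<iota>\<close> of \<open>M\<close> into a Euclidean
  space that need not be injective. The local parametrizations \<open>\<phi>\<close> are those for which \<open>\<iota> \<circ> \<phi>\<close> is a
  regular \<open>C\<^sup>3\<close> map. Their transition maps are automatically \<open>C\<^sup>3\<close>, because \<open>\<iota> \<circ> \<phi>\<close> is locally a
  \<open>C\<^sup>3\<close> embedding; so they form the atlas of the only \<open>C\<^sup>3\<close> structure on \<open>M\<close> that makes \<open>\<iota>\<close> a
  \<open>C\<^sup>3\<close> immersion. The domains \<open>D\<close> are open in the plane, so \<open>M\<close> has no boundary.
\<close>

definition local_param ::
  "'m::t2_space set \<Rightarrow> ('m \<Rightarrow> 'a::euclidean_space) \<Rightarrow> (real^2) set \<Rightarrow> (real^2 \<Rightarrow> 'm) \<Rightarrow> bool" where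
  "local_param M \<iota> D \<phi> \<longleftrightarrow>
     open D \<and> openin (top_of_set M) (\<phi> ` D) \<and> (\<exists>\<psi>. homeomorphism D (\<phi> ` D) \<phi> \<psi>) \<and>
     Ck_on 3 (\<iota> \<circ> \<phi>) D \<and> (\<forall>x\<in>D. inj (frechet_derivative (\<iota> \<circ> \<phi>) (at x)))"

definition immersed_surface :: "'m::t2_space set \<Rightarrow> ('m \<Rightarrow> 'a::euclidean_space) \<Rightarrow> bool" where
  "immersed_surface M \<iota> \<longleftrightarrow> (\<forall>p\<in>M. \<exists>D \<phi>. local_param M \<iota> D \<phi> \<and> p \<in> \<phi> ` D)"

definition tangent_plane ::
  "'m::t2_space set \<Rightarrow> ('m \<Rightarrow> 'a::euclidean_space) \<Rightarrow> 'm \<Rightarrow> 'a set" where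
  "tangent_plane M \<iota> p =
     {v. \<exists>D \<phi> x. local_param M \<iota> D \<phi> \<and> x \<in> D \<and> \<phi> x = p \<and>
                  v \<in> range (frechet_derivative (\<iota> \<circ> \<phi>) (at x))}"

subsection \<open>Length and geodesic distance\<close>

definition curve_length :: "(real \<Rightarrow> 'a::real_normed_vector) \<Rightarrow> real \<Rightarrow> real \<Rightarrow> ereal" where
  "curve_length f a b =
     (SUP xs\<in>{xs. sorted xs \<and> set xs \<subseteq> {a..b}}.
        ereal (\<Sum>i<length xs - 1. norm (f (xs ! Suc i) - f (xs ! i))))"

text \<open>The distance is \<open>\<infinity>\<close> between different components of \<open>M\<close>.\<close>

definition geodesic_dist ::
  "'m::t2_space set \<Rightarrow> ('m \<Rightarrow> 'a::euclidean_space) \<Rightarrow> 'm \<Rightarrow> 'm \<Rightarrow> ereal" where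
  "geodesic_dist M \<iota> p q =
     (INF \<gamma>\<in>{\<gamma>. path \<gamma> \<and> path_image \<gamma> \<subseteq> M \<and> pathstart \<gamma> = p \<and> pathfinish \<gamma> = q}.
        curve_length (\<iota> \<circ> \<gamma>) 0 1)"

definition geodesic_diam ::
  "'m::t2_space set \<Rightarrow> ('m \<Rightarrow> 'a::euclidean_space) \<Rightarrow> 'm set \<Rightarrow> ereal" where
  "geodesic_diam M \<iota> A = (SUP p\<in>A. SUP q\<in>A. geodesic_dist M \<iota> p q)"

subsection \<open>Polygonals and total intrinsic curvature\<close>

text \<open>A geodesic with constant speed \<open>v\<close>: the acceleration is normal to the surface.\<close>

definition geodesic_arc ::
  "'m::t2_space set \<Rightarrow> ('m \<Rightarrow> 'a::euclidean_space) \<Rightarrow> real \<Rightarrow> (real \<Rightarrow> 'm) \<Rightarrow> real \<Rightarrow> real \<Rightarrow> bool" where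
  "geodesic_arc M \<iota> v \<gamma> p q \<longleftrightarrow>
     continuous_on {p..q} \<gamma> \<and> \<gamma> ` {p..q} \<subseteq> M \<and>
     (\<exists>\<gamma>' \<gamma>''. \<forall>s\<in>{p..q}.
        ((\<iota> \<circ> \<gamma>) has_vector_derivative \<gamma>' s) (at s within {p..q}) \<and>
        (\<gamma>' has_vector_derivative \<gamma>'' s) (at s within {p..q}) \<and>
        norm (\<gamma>' s) = v \<and>
        (\<forall>w\<in>tangent_plane M \<iota> (\<gamma> s). \<gamma>'' s \<bullet> w = 0))"

text \<open>
  A polygonal is parameterized on \<open>[0,l]\<close> with constant positive speed; \<open>ss\<close> lists the parameters
  of its vertices. Two consecutive parameters in \<open>ss\<close> may be equal: this happens in an inscribed
  polygonal exactly when two consecutive vertices on the curve coincide (as they may on a curve that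
  retraces itself), and then there is no arc between them.
\<close>

definition polygonal ::
  "'m::t2_space set \<Rightarrow> ('m \<Rightarrow> 'a::euclidean_space) \<Rightarrow> real \<Rightarrow> real list \<Rightarrow> (real \<Rightarrow> 'm) \<Rightarrow> bool" where
  "polygonal M \<iota> l ss P \<longleftrightarrow>
     2 \<le> length ss \<and> sorted ss \<and> hd ss = 0 \<and> last ss = l \<and> 0 < l \<and>
     (\<exists>v>0. \<forall>i. Suc i < length ss \<longrightarrow> geodesic_arc M \<iota> v P (ss ! i) (ss ! Suc i))"

definition vec_angle :: "'a::real_inner \<Rightarrow> 'a \<Rightarrow> real" where
  "vec_angle u v = arccos ((u \<bullet> v) / (norm u * norm v))"

definition rotation ::
  "('m \<Rightarrow> 'a::euclidean_space) \<Rightarrow> real \<Rightarrow> real list \<Rightarrow> (real \<Rightarrow> 'm) \<Rightarrow> real" where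
  "rotation \<iota> l ss P =
     (\<Sum>s\<in>set ss \<inter> {0<..<l}.
        vec_angle (vector_derivative (\<iota> \<circ> P) (at_left s)) (vector_derivative (\<iota> \<circ> P) (at_right s)))"

text \<open>\<open>P\<close> joins the consecutive points of \<open>c\<close> with parameters \<open>ts\<close> by minimizing geodesics.\<close>

definition inscribed ::
  "'m::t2_space set \<Rightarrow> ('m \<Rightarrow> 'a::euclidean_space) \<Rightarrow> (real \<Rightarrow> 'm) \<Rightarrow> real \<Rightarrow> real \<Rightarrow>
   real \<Rightarrow> real list \<Rightarrow> real list \<Rightarrow> (real \<Rightarrow> 'm) \<Rightarrow> bool" where
  "inscribed M \<iota> c a b l ts ss P \<longleftrightarrow>
     sorted_wrt (<) ts \<and> set ts \<subseteq> {a..b} \<and> length ts = length ss \<and> polygonal M \<iota> l ss P \<and>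
     (\<forall>i<length ts. P (ss ! i) = c (ts ! i)) \<and>
     (\<forall>i. Suc i < length ts \<longrightarrow>
        curve_length (\<iota> \<circ> P) (ss ! i) (ss ! Suc i) = geodesic_dist M \<iota> (c (ts ! i)) (c (ts ! Suc i)))"

definition modulus ::
  "'m::t2_space set \<Rightarrow> ('m \<Rightarrow> 'a::euclidean_space) \<Rightarrow> (real \<Rightarrow> 'm) \<Rightarrow> real list \<Rightarrow> ereal" where
  "modulus M \<iota> c ts =
     Max ((\<lambda>i. geodesic_diam M \<iota> (c ` {ts ! i..ts ! Suc i})) ` {..<length ts - 1})"

text \<open>The rotation does not depend on the parameter interval of \<open>P\<close>, which is \<open>[0,1]\<close> here.\<close>

definition total_curvature ::
  "'m::t2_space set \<Rightarrow> ('m \<Rightarrow> 'a::euclidean_space) \<Rightarrow> (real \<Rightarrow> 'm) \<Rightarrow> real \<Rightarrow> real \<Rightarrow> ereal" where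
  "total_curvature M \<iota> c a b =
     Lim (at_right 0) (\<lambda>\<epsilon>::real.
       Sup {ereal (rotation \<iota> 1 ss P) | ts ss P.
              inscribed M \<iota> c a b 1 ts ss P \<and> modulus M \<iota> c ts < ereal \<epsilon>})"

subsection \<open>Curves parameterized by arc length and their frames\<close>

definition arc_length_curve ::
  "'m::t2_space set \<Rightarrow> ('m \<Rightarrow> 'a::euclidean_space) \<Rightarrow> (real \<Rightarrow> 'm) \<Rightarrow> real \<Rightarrow> bool" where
  "arc_length_curve M \<iota> c L \<longleftrightarrow>
     continuous_on {0..L} c \<and> c ` {0..L} \<subseteq> M \<and>
     (\<forall>s\<in>{0..L}. curve_length (\<iota> \<circ> c) 0 s = ereal s)"

definition tantrix :: "('m \<Rightarrow> 'a::euclidean_space) \<Rightarrow> (real \<Rightarrow> 'm) \<Rightarrow> real \<Rightarrow> 'a" where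
  "tantrix \<iota> c s = vector_derivative (\<iota> \<circ> c) (at s)"

text \<open>The right limit of the tantrix at \<open>0\<close>, taken along the points where the tantrix is defined.\<close>

definition initial_tangent :: "('m \<Rightarrow> 'a::euclidean_space) \<Rightarrow> (real \<Rightarrow> 'm) \<Rightarrow> real \<Rightarrow> 'a" where
  "initial_tangent \<iota> c L =
     Lim (at 0 within {s. 0 < s \<and> s < L \<and> (\<iota> \<circ> c) differentiable (at s)}) (tantrix \<iota> c)"

text \<open>
  A continuous choice of orientation of the tangent planes along \<open>c\<close>, represented by a continuous
  positively oriented orthonormal frame \<open>(e1, e2)\<close>. Such a frame exists for every continuous
  orientation, since the pullback of the tangent bundle to an interval is trivial.
\<close>

definition oriented_frame ::
  "'m::t2_space set \<Rightarrow> ('m \<Rightarrow> 'a::euclidean_space) \<Rightarrow> (real \<Rightarrow> 'm) \<Rightarrow> real \<Rightarrow>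
   (real \<Rightarrow> 'a) \<Rightarrow> (real \<Rightarrow> 'a) \<Rightarrow> bool" where
  "oriented_frame M \<iota> c L e1 e2 \<longleftrightarrow>
     continuous_on {0..L} e1 \<and> continuous_on {0..L} e2 \<and>
     (\<forall>s\<in>{0..L}. e1 s \<in> tangent_plane M \<iota> (c s) \<and> e2 s \<in> tangent_plane M \<iota> (c s) \<and>
        norm (e1 s) = 1 \<and> norm (e2 s) = 1 \<and> e1 s \<bullet> e2 s = 0)"

text \<open>Rotation of the tantrix by \<open>\<pi>/2\<close>, in the sense that takes \<open>e1\<close> to \<open>e2\<close> and \<open>e2\<close> to \<open>-e1\<close>.\<close>

definition conormal ::
  "('m \<Rightarrow> 'a::euclidean_space) \<Rightarrow> (real \<Rightarrow> 'm) \<Rightarrow> (real \<Rightarrow> 'a) \<Rightarrow> (real \<Rightarrow> 'a) \<Rightarrow> real \<Rightarrow> 'a" where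
  "conormal \<iota> c e1 e2 s =
     (tantrix \<iota> c s \<bullet> e1 s) *\<^sub>R e2 s - (tantrix \<iota> c s \<bullet> e2 s) *\<^sub>R e1 s"

definition parallel_transport ::
  "'m::t2_space set \<Rightarrow> ('m \<Rightarrow> 'a::euclidean_space) \<Rightarrow> real \<Rightarrow> real list \<Rightarrow> (real \<Rightarrow> 'm) \<Rightarrow>
   (real \<Rightarrow> 'a) \<Rightarrow> bool" where
  "parallel_transport M \<iota> l ss P X \<longleftrightarrow>
     continuous_on {0..l} X \<and> X C1_differentiable_on ({0..l} - set ss) \<and>
     (\<forall>s\<in>{0..l}. X s \<in> tangent_plane M \<iota> (P s)) \<and>
     (\<forall>s\<in>{0..l} - set ss. \<forall>w\<in>tangent_plane M \<iota> (P s). vector_derivative X (at s) \<bullet> w = 0)"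

subsection \<open>Sobolev functions \<open>W(1,1)\<close> and functions of bounded variation on an interval\<close>

definition test_fun :: "real \<Rightarrow> real \<Rightarrow> (real \<Rightarrow> real) \<Rightarrow> bool" where
  "test_fun a b \<eta> \<longleftrightarrow>
     \<eta> C1_differentiable_on UNIV \<and> (\<exists>K. compact K \<and> K \<subseteq> {a<..<b} \<and> (\<forall>s. s \<notin> K \<longrightarrow> \<eta> s = 0))"

definition has_weak_deriv ::
  "real \<Rightarrow> real \<Rightarrow> (real \<Rightarrow> 'a::euclidean_space) \<Rightarrow> (real \<Rightarrow> 'a) \<Rightarrow> bool" where
  "has_weak_deriv a b f g \<longleftrightarrow>
     integrable (lebesgue_on {a<..<b}) f \<and> integrable (lebesgue_on {a<..<b}) g \<and>
     (\<forall>\<eta>. test_fun a b \<eta> \<longrightarrow>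
        (LINT s|lebesgue_on {a<..<b}. deriv \<eta> s *\<^sub>R f s) =
        - (LINT s|lebesgue_on {a<..<b}. \<eta> s *\<^sub>R g s))"

definition W11 :: "real \<Rightarrow> real \<Rightarrow> (real \<Rightarrow> 'a::euclidean_space) set" where
  "W11 a b = {f. \<exists>g. has_weak_deriv a b f g}"

definition W11_norm :: "real \<Rightarrow> real \<Rightarrow> (real \<Rightarrow> 'a::euclidean_space) \<Rightarrow> real" where
  "W11_norm a b f =
     (LINT s|lebesgue_on {a<..<b}. norm (f s)) +
     (LINT s|lebesgue_on {a<..<b}. norm ((SOME g. has_weak_deriv a b f g) s))"

definition BV :: "real \<Rightarrow> real \<Rightarrow> (real \<Rightarrow> real) set" where
  "BV a b = {f. integrable (lebesgue_on {a<..<b}) f \<and>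
     bdd_above {LINT s|lebesgue_on {a<..<b}. f s * deriv \<eta> s | \<eta>.
                  test_fun a b \<eta> \<and> (\<forall>s. \<bar>\<eta> s\<bar> \<le> 1)}}"

end

theory Submission
  imports Defs "HOL-Probability.Helly_Selection" "HOL-Complex_Analysis.Great_Picard"
begin

text \<open>
  On each geodesic arc the velocity \<open>t\<^sub>h\<close> of \<open>P\<^sub>h\<close> and the field \<open>X\<^sub>h\<close> are both parallel, so their
  derivatives are values of the second fundamental form at \<open>(t\<^sub>h, t\<^sub>h)\<close> and \<open>(t\<^sub>h, X\<^sub>h)\<close> and are bounded
  near the curve. Since the rotation of \<open>P\<^sub>h\<close> is bounded by the total curvature, the velocities have
  bounded variation, and by Helly's theorem a subsequence converges off a countable set to a
  right-continuous \<open>T\<close> of bounded variation. The lengths of the \<open>P\<^sub>h\<close> converge to \<open>L\<close>, so \<open>P\<^sub>h(s)\<close>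
  converges to \<open>c(s)\<close>, \<open>T\<close> is the tantrix, and \<open>T(0)\<close> is its right limit at \<open>0\<close>. The \<open>X\<^sub>h\<close> are
  equi-Lipschitz, a subsequence converges uniformly to some \<open>Y\<close>, and by continuity of the second
  fundamental form their derivatives converge almost everywhere, hence in \<open>L\<^sup>1\<close>. Finally \<open>Y\<close> and its
  rotation by \<open>\<pi>/2\<close> are Lipschitz unit tangent fields, so the components of \<open>T\<close> along them are a
  curve of bounded variation on the unit circle, which lifts to an angle of bounded variation.
\<close>

subsection \<open>Charts and tangent planes\<close>

text \<open>Since \<open>\<iota>\<close> need not be injective, nearness in the Euclidean space does
  not give nearness in \<open>M\<close>. A curve in \<open>M\<close> whose image under
  \<open>\<iota>\<close> moves little is therefore shown to stay inside a chart neighbourhood, and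
  \<open>P h s\<close> is compared with \<open>c\<close> through a nearby vertex. The second
  fundamental form is not constructed: \<open>parallel_at\<close> collects the values that arise as
  derivatives of parallel fields, and only their local boundedness and their convergence along
  converging arguments are proved. The jumps of \<open>T\<close> also rule out lifting the angle by
  continuity: the branch is chosen anew on each class, and the variation function pays for every
  change of branch. The angle is that of \<open>T\<close> in the frame formed by \<open>Y\<close>
  and its quarter turn; since the quarter turn is skew-symmetric, solving for \<open>Y\<close>
  produces the minus sign in front of the conormal.\<close>

lemma frechet_derivative_basis_sum:
  fixes f :: "'a::euclidean_space \<Rightarrow> 'b::real_normed_vector"
  assumes "f differentiable (at x)"
  shows "frechet_derivative f (at x) a = (\<Sum>i\<in>Basis. (a \<bullet> i) *\<^sub>R frechet_derivative f (at x) i)"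
proof -
  have lin: "linear (frechet_derivative f (at x))"
    by (simp add: assms linear_frechet_derivative)
  have "frechet_derivative f (at x) a = frechet_derivative f (at x) (\<Sum>i\<in>Basis. (a \<bullet> i) *\<^sub>R i)"
    by (simp add: euclidean_representation)
  also have "\<dots> = (\<Sum>i\<in>Basis. (a \<bullet> i) *\<^sub>R frechet_derivative f (at x) i)"
    using lin by (simp add: linear_sum linear_scale)
  finally show ?thesis .
qed

text \<open>Difference quotients within an arbitrary set cover one-sided derivatives as well; this
  is the form in which velocities are carried into chart coordinates below.\<close>

lemma has_vector_derivative_quotient:
  "(f has_vector_derivative d) (at s within S) \<longleftrightarrow>
    ((\<lambda>t. (1 / (t - s)) *\<^sub>R (f t - f s)) \<longlongrightarrow> d) (at s within S)" (is "?L \<longleftrightarrow> (?q \<longlongrightarrow> d) ?F")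
proof -
  have eq: "\<forall>\<^sub>F t in ?F. norm ((1 / norm (t - s)) *\<^sub>R (f t - (f s + (t - s) *\<^sub>R d))) = norm (?q t - d)"
    unfolding eventually_at_filter
  proof (intro always_eventually allI impI)
    fix t assume "t \<noteq> s"
    then have *: "(1 / (t - s)) *\<^sub>R (f t - f s - (t - s) *\<^sub>R d) = ?q t - d"
      by (simp add: scaleR_diff_right[of _ _ "(t - s) *\<^sub>R d"])
    show "norm ((1 / norm (t - s)) *\<^sub>R (f t - (f s + (t - s) *\<^sub>R d))) = norm (?q t - d)"
      unfolding *[symmetric] by (simp add: diff_diff_eq)
  qed
  have "?L \<longleftrightarrow> ((\<lambda>t. norm ((1 / norm (t - s)) *\<^sub>R (f t - (f s + (t - s) *\<^sub>R d)))) \<longlongrightarrow> 0) ?F"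
    unfolding has_vector_derivative_def has_derivative_within tendsto_norm_zero_iff
    by (simp add: bounded_linear_scaleR_left)
  also have "\<dots> \<longleftrightarrow> ((\<lambda>t. norm (?q t - d)) \<longlongrightarrow> 0) ?F"
    by (rule tendsto_cong[OF eq])
  also have "\<dots> \<longleftrightarrow> (?q \<longlongrightarrow> d) ?F"
    unfolding tendsto_norm_zero_iff by (rule LIM_zero_iff)
  finally show ?thesis .
qed

locale surface_chart =
  fixes M :: "'m::t2_space set" and \<iota> :: "'m \<Rightarrow> 'a::euclidean_space"
    and D :: "(real^2) set" and \<phi> :: "real^2 \<Rightarrow> 'm" and \<psi> :: "'m \<Rightarrow> real^2"
  assumes open_domain: "open D"
    and open_image: "openin (top_of_set M) (\<phi> ` D)"
    and homeo: "homeomorphism D (\<phi> ` D) \<phi> \<psi>"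
    and C3: "Ck_on 3 (\<iota> \<circ> \<phi>) D"
    and inj_derivative: "\<And>x. x \<in> D \<Longrightarrow> inj (frechet_derivative (\<iota> \<circ> \<phi>) (at x))"
begin

definition df :: "real^2 \<Rightarrow> real^2 \<Rightarrow> 'a" where
  "df x = frechet_derivative (\<iota> \<circ> \<phi>) (at x)"

text \<open>The second derivative of \<open>\<iota> \<circ> \<phi>\<close>, extended linearly in
  \<open>a\<close> from the basis vectors because \<open>Ck_on\<close> speaks only of derivatives
  along these.\<close>

definition d2f :: "real^2 \<Rightarrow> real^2 \<Rightarrow> real^2 \<Rightarrow> 'a" where
  "d2f x a b = (\<Sum>i\<in>Basis. (a \<bullet> i) *\<^sub>R frechet_derivative (\<lambda>y. df y i) (at x) b)"

lemma local_param: "local_param M \<iota> D \<phi>"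
  unfolding local_param_def using open_domain open_image homeo C3 inj_derivative by blast

lemma chart_in_M: "x \<in> D \<Longrightarrow> \<phi> x \<in> M"
  using open_image openin_subset by fastforce

lemma psi_phi [simp]: "x \<in> D \<Longrightarrow> \<psi> (\<phi> x) = x"
  using homeo by (simp add: homeomorphism_def)

lemma phi_psi [simp]: "q \<in> \<phi> ` D \<Longrightarrow> \<phi> (\<psi> q) = q"
  using homeo by (rule homeomorphism_apply2)

lemma psi_in_domain: "q \<in> \<phi> ` D \<Longrightarrow> \<psi> q \<in> D"
  using homeo by (metis homeomorphism_def image_eqI)

lemma continuous_on_phi: "continuous_on D \<phi>"
  using homeo by (simp add: homeomorphism_def)

lemma continuous_on_psi: "continuous_on (\<phi> ` D) \<psi>"
  using homeo by (simp add: homeomorphism_def)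

text \<open>Continuity of the second partial derivatives is read off from their differentiability,
  the next clause of \<open>Ck_on\<close>.\<close>

lemma C3_simps:
  assumes "x \<in> D"
  shows "(\<iota> \<circ> \<phi>) differentiable (at x)"
    and "i \<in> Basis \<Longrightarrow> (\<lambda>y. df y i) differentiable (at x)"
    and "i \<in> Basis \<Longrightarrow> j \<in> Basis \<Longrightarrow> isCont (\<lambda>y. frechet_derivative (\<lambda>y. df y i) (at y) j) x"
  using C3 assms unfolding df_def
  by (auto simp: numeral_3_eq_3 intro: differentiable_imp_continuous_within)

lemma has_derivative_chart: "x \<in> D \<Longrightarrow> ((\<iota> \<circ> \<phi>) has_derivative df x) (at x)"
  unfolding df_def using C3_simps(1) frechet_derivative_works by blast

lemma linear_df: "x \<in> D \<Longrightarrow> linear (df x)"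
  using has_derivative_chart has_derivative_linear by blast

lemma inj_df: "x \<in> D \<Longrightarrow> inj (df x)"
  unfolding df_def by (rule inj_derivative)

lemma df_basis_sum: "x \<in> D \<Longrightarrow> df x a = (\<Sum>i\<in>Basis. (a \<bullet> i) *\<^sub>R df x i)"
  unfolding df_def using C3_simps(1) by (rule frechet_derivative_basis_sum)

lemma d2f_basis: "i \<in> Basis \<Longrightarrow> d2f x i b = frechet_derivative (\<lambda>y. df y i) (at x) b"
  unfolding d2f_def by (subst sum.remove[of _ i]) (auto simp: inner_Basis intro!: sum.neutral split: if_splits)

lemma d2f_basis_sum: "d2f x a b = (\<Sum>i\<in>Basis. (a \<bullet> i) *\<^sub>R d2f x i b)"
  by (subst d2f_def) (auto simp: d2f_basis)

lemma d2f_basis_sum2: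
  assumes "x \<in> D"
  shows "d2f x a b = (\<Sum>i\<in>Basis. \<Sum>j\<in>Basis. (a \<bullet> i) *\<^sub>R (b \<bullet> j) *\<^sub>R d2f x i j)"
proof -
  have "d2f x i b = (\<Sum>j\<in>Basis. (b \<bullet> j) *\<^sub>R d2f x i j)" if "i \<in> Basis" for i
    using frechet_derivative_basis_sum[OF C3_simps(2)[OF assms that], of b] that by (simp add: d2f_basis)
  then show ?thesis
    by (subst d2f_basis_sum) (simp add: scaleR_sum_right)
qed

lemma df_has_derivative:
  assumes "x \<in> D"
  shows "((\<lambda>y. df y a) has_derivative d2f x a) (at x)"
proof -
  have "((\<lambda>y. \<Sum>i\<in>Basis. (a \<bullet> i) *\<^sub>R df y i) has_derivative
      (\<lambda>b. \<Sum>i\<in>Basis. (a \<bullet> i) *\<^sub>R frechet_derivative (\<lambda>y. df y i) (at x) b)) (at x)"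
    by (intro has_derivative_sum has_derivative_scaleR_right)
       (use C3_simps(2)[OF assms] frechet_derivative_works in blast)
  then have "((\<lambda>y. \<Sum>i\<in>Basis. (a \<bullet> i) *\<^sub>R df y i) has_derivative d2f x a) (at x)"
    by (simp add: d2f_def[abs_def])
  then show ?thesis
    by (rule has_derivative_transform_within_open[OF _ open_domain assms]) (simp add: df_basis_sum[symmetric])
qed

text \<open>Convergence is joint in the base point and the vector; expanding the vector in the basis
  reduces it to the continuity of finitely many partial derivatives.\<close>

lemma tendsto_df:
  assumes "(x \<longlongrightarrow> x0) F" "x0 \<in> D" "(a \<longlongrightarrow> a0) F"
  shows "((\<lambda>h. df (x h) (a h)) \<longlongrightarrow> df x0 a0) F"
proof -
  have "\<forall>\<^sub>F h in F. x h \<in> D"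
    using assms open_domain topological_tendstoD by blast
  then have *: "\<forall>\<^sub>F h in F. df (x h) (a h) = (\<Sum>i\<in>Basis. (a h \<bullet> i) *\<^sub>R df (x h) i)"
    by eventually_elim (rule df_basis_sum)
  have "((\<lambda>h. df (x h) i) \<longlongrightarrow> df x0 i) F" for i
    using df_has_derivative[OF assms(2), of i] assms(1) has_derivative_continuous isCont_tendsto_compose by blast
  then have "((\<lambda>h. \<Sum>i\<in>Basis. (a h \<bullet> i) *\<^sub>R df (x h) i) \<longlongrightarrow> (\<Sum>i\<in>Basis. (a0 \<bullet> i) *\<^sub>R df x0 i)) F"
    by (intro tendsto_intros assms)
  then show ?thesis
    unfolding tendsto_cong[OF *] df_basis_sum[OF assms(2), of a0] .
qed

lemma tendsto_d2f:
  assumes "(x \<longlongrightarrow> x0) F" "x0 \<in> D" "(a \<longlongrightarrow> a0) F" "(b \<longlongrightarrow> b0) F"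
  shows "((\<lambda>h. d2f (x h) (a h) (b h)) \<longlongrightarrow> d2f x0 a0 b0) F"
proof -
  have "\<forall>\<^sub>F h in F. x h \<in> D"
    using assms open_domain topological_tendstoD by blast
  then have *: "\<forall>\<^sub>F h in F. d2f (x h) (a h) (b h) =
      (\<Sum>i\<in>Basis. \<Sum>j\<in>Basis. (a h \<bullet> i) *\<^sub>R (b h \<bullet> j) *\<^sub>R d2f (x h) i j)"
    by eventually_elim (rule d2f_basis_sum2)
  have "((\<lambda>h. d2f (x h) i j) \<longlongrightarrow> d2f x0 i j) F" if "i \<in> Basis" "j \<in> Basis" for i j
    using isCont_tendsto_compose[OF C3_simps(3)[OF assms(2) that] assms(1)] that by (simp add: d2f_basis)
  then have "((\<lambda>h. \<Sum>i\<in>Basis. \<Sum>j\<in>Basis. (a h \<bullet> i) *\<^sub>R (b h \<bullet> j) *\<^sub>R d2f (x h) i j) \<longlongrightarrow>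
      (\<Sum>i\<in>Basis. \<Sum>j\<in>Basis. (a0 \<bullet> i) *\<^sub>R (b0 \<bullet> j) *\<^sub>R d2f x0 i j)) F"
    by (intro tendsto_intros assms) auto
  then show ?thesis
    unfolding tendsto_cong[OF *] d2f_basis_sum2[OF assms(2), of a0 b0] .
qed

text \<open>Quantitative inverse function data on a ball: \<open>m\<close> bounds the chart and its
  differential from below, \<open>C\<close> bounds the second derivative and the variation of the
  differential. The local estimates below are expressed through these constants.\<close>

definition controlled :: "real^2 \<Rightarrow> real \<Rightarrow> real \<Rightarrow> real \<Rightarrow> bool" where
  "controlled x0 r m C \<longleftrightarrow> 0 < r \<and> 0 < m \<and> 0 \<le> C \<and> cball x0 r \<subseteq> D \<and>
     (\<forall>x\<in>cball x0 r. \<forall>y\<in>cball x0 r. m * norm (x - y) \<le> norm (\<iota> (\<phi> x) - \<iota> (\<phi> y))) \<and>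
     (\<forall>x\<in>cball x0 r. \<forall>a. m * norm a \<le> norm (df x a)) \<and>
     (\<forall>x\<in>cball x0 r. \<forall>y\<in>cball x0 r. \<forall>a. norm (df x a - df y a) \<le> C * norm (x - y) * norm a) \<and>
     (\<forall>x\<in>cball x0 r. \<forall>a b. norm (d2f x a b) \<le> C * norm a * norm b)"

text \<open>Injectivity of \<open>df x0\<close> yields a lower bound \<open>B\<close> at
  \<open>x0\<close>. On a small ball the differential moves by at most \<open>B / 2\<close>, which
  leaves the bound \<open>B / 2\<close> for the differential and, by the mean value inequality, for
  the chart itself. The bound \<open>C\<close> comes from continuity of the second derivatives on
  the compact ball.\<close>

lemma ex_controlled:
  assumes "x0 \<in> D"
  obtains r m C where "controlled x0 r m C"
proof -
  obtain B where "0 < B" and B: "\<And>v. B * norm v \<le> norm (df x0 v)"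
    using linear_inj_bounded_below_pos[OF linear_df[OF assms] inj_df[OF assms]] by blast
  \<comment> \<open>Dividing by the dimension lets the errors of the basis directions add up to at
    most \<open>B / 2\<close>.\<close>
  define e where "e = B / 2 / real (DIM(real^2))"
  have "0 < e"
    using \<open>0 < B\<close> by (simp add: e_def)
  have "\<forall>\<^sub>F x in nhds x0. norm (df x i - df x0 i) < e" for i
  proof -
    have "((\<lambda>x. df x i) \<longlongrightarrow> df x0 i) (nhds x0)"
      by (intro tendsto_df assms tendsto_const) (simp add: filterlim_ident)
    then show ?thesis
      using \<open>0 < e\<close> by (auto simp: tendsto_iff dist_norm)
  qed
  then have "\<forall>\<^sub>F x in nhds x0. (\<forall>i\<in>Basis. norm (df x i - df x0 i) < e) \<and> x \<in> D"
    using assms open_domain by (intro eventually_conj eventually_ball_finite) (auto intro: eventually_nhds_in_open)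
  then obtain r0 where "0 < r0" and r0: "\<And>x. dist x x0 < r0 \<Longrightarrow> (\<forall>i\<in>Basis. norm (df x i - df x0 i) < e) \<and> x \<in> D"
    unfolding eventually_nhds_metric by blast
  define r where "r = r0 / 2"
  have "0 < r"
    using \<open>0 < r0\<close> by (simp add: r_def)
  have r: "norm (df x i - df x0 i) < e" "x \<in> D" if "x \<in> cball x0 r" "i \<in> Basis" for x i
    using r0[of x] that \<open>0 < r0\<close> by (auto simp: r_def dist_commute)
  have cD: "cball x0 r \<subseteq> D"
    using r0 \<open>0 < r0\<close> by (force simp: r_def dist_commute)
  have near: "norm (df x v - df x0 v) \<le> B / 2 * norm v" if "x \<in> cball x0 r" for x v
  proof -
    have "df x v - df x0 v = (\<Sum>i\<in>Basis. (v \<bullet> i) *\<^sub>R (df x i - df x0 i))"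
      using that cD assms by (subst (1 2) df_basis_sum) (auto simp: sum_subtractf algebra_simps)
    also have "norm \<dots> \<le> (\<Sum>i\<in>(Basis::(real^2) set). norm v * e)"
    proof (rule sum_norm_le)
      fix i :: "real^2" assume "i \<in> Basis"
      then show "norm ((v \<bullet> i) *\<^sub>R (df x i - df x0 i)) \<le> norm v * e"
        using r(1)[OF that] by (auto intro!: mult_mono simp: Basis_le_norm less_imp_le)
    qed
    also have "\<dots> = B / 2 * norm v"
      by (simp add: e_def)
    finally show ?thesis .
  qed
  have lower: "B / 2 * norm v \<le> norm (df x v)" if "x \<in> cball x0 r" for x v
    using near[OF that, of v] B[of v] norm_triangle_ineq2[of "df x0 v" "df x v"]
    by (simp add: norm_minus_commute)
  have bilip: "B / 2 * norm (x - y) \<le> norm (\<iota> (\<phi> x) - \<iota> (\<phi> y))" if "x \<in> cball x0 r" "y \<in> cball x0 r" for x y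
  proof -
    \<comment> \<open>The mean value inequality is applied to the chart minus its linear part at
      \<open>x0\<close>, whose differential has norm at most \<open>B / 2\<close> on the
      ball.\<close>
    have "norm (((\<iota> \<circ> \<phi>) x - df x0 x) - ((\<iota> \<circ> \<phi>) y - df x0 y)) \<le> B / 2 * norm (x - y)"
    proof (rule differentiable_bound[OF convex_cball _ _ that])
      fix z assume z: "z \<in> cball x0 r"
      show "((\<lambda>x. (\<iota> \<circ> \<phi>) x - df x0 x) has_derivative (\<lambda>v. df z v - df x0 v)) (at z within cball x0 r)"
        using z cD assms
        by (intro has_derivative_diff has_derivative_at_withinI[OF has_derivative_chart]
              has_derivative_at_withinI[OF bounded_linear_imp_has_derivative])
           (auto simp: linear_df linear_conv_bounded_linear[symmetric])
      show "onorm (\<lambda>v. df z v - df x0 v) \<le> B / 2"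
        using near[OF z] by (intro onorm_le)
    qed
    moreover have "((\<iota> \<circ> \<phi>) x - df x0 x) - ((\<iota> \<circ> \<phi>) y - df x0 y) = (\<iota> (\<phi> x) - \<iota> (\<phi> y)) - df x0 (x - y)"
      using linear_df[OF assms] by (simp add: linear_diff)
    ultimately have "norm (df x0 (x - y) - (\<iota> (\<phi> x) - \<iota> (\<phi> y))) \<le> B / 2 * norm (x - y)"
      by (metis norm_minus_commute)
    then show ?thesis
      using B[of "x - y"] norm_triangle_ineq2[of "df x0 (x - y)" "\<iota> (\<phi> x) - \<iota> (\<phi> y)"]
      by linarith
  qed
  have "continuous_on (cball x0 r) (\<lambda>x. \<Sum>i\<in>Basis. \<Sum>j\<in>Basis. norm (d2f x i j))"
  proof (intro continuous_intros)
    fix i j :: "real^2"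
    show "continuous_on (cball x0 r) (\<lambda>x. d2f x i j)"
      unfolding continuous_on_def using cD by (auto intro!: tendsto_d2f tendsto_const)
  qed
  then have "bounded ((\<lambda>x. \<Sum>i\<in>Basis. \<Sum>j\<in>Basis. norm (d2f x i j)) ` cball x0 r)"
    using compact_cball compact_continuous_image compact_imp_bounded by blast
  then obtain C where C: "\<And>x. x \<in> cball x0 r \<Longrightarrow> (\<Sum>i\<in>Basis. \<Sum>j\<in>Basis. norm (d2f x i j)) \<le> C"
    unfolding bounded_iff by (force simp: abs_le_iff)
  have "0 \<le> C"
    using C[of x0] \<open>0 < r\<close> by (smt (verit, best) centre_in_cball norm_ge_zero sum_nonneg)
  have d2: "norm (d2f x a b) \<le> C * norm a * norm b" if "x \<in> cball x0 r" for x a b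
  proof -
    have "norm (d2f x a b) \<le> (\<Sum>i\<in>Basis. \<Sum>j\<in>Basis. norm a * (norm b * norm (d2f x i j)))"
      unfolding d2f_basis_sum2[OF subsetD[OF cD that], of a b]
    proof (intro sum_norm_le)
      fix i j :: "real^2" assume "i \<in> Basis" "j \<in> Basis"
      then have "\<bar>a \<bullet> i\<bar> * (\<bar>b \<bullet> j\<bar> * norm (d2f x i j)) \<le> norm a * (norm b * norm (d2f x i j))"
        by (intro mult_mono mult_right_mono) (auto simp: Basis_le_norm)
      then show "norm ((a \<bullet> i) *\<^sub>R (b \<bullet> j) *\<^sub>R d2f x i j) \<le> norm a * (norm b * norm (d2f x i j))"
        by (simp add: abs_mult mult.assoc)
    qed
    also have "\<dots> = (\<Sum>i\<in>Basis. \<Sum>j\<in>Basis. norm (d2f x i j)) * norm a * norm b"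
      by (simp add: sum_distrib_left sum_distrib_right mult_ac)
    also have "\<dots> \<le> C * norm a * norm b"
      using C[OF that] by (intro mult_right_mono) auto
    finally show ?thesis .
  qed
  have lip: "norm (df x a - df y a) \<le> C * norm (x - y) * norm a" if "x \<in> cball x0 r" "y \<in> cball x0 r" for x y a
  proof -
    have "norm (df x a - df y a) \<le> (C * norm a) * norm (x - y)"
    proof (rule differentiable_bound[OF convex_cball _ _ that])
      fix z assume z: "z \<in> cball x0 r"
      show "((\<lambda>x. df x a) has_derivative d2f z a) (at z within cball x0 r)"
        using z cD by (intro has_derivative_at_withinI[OF df_has_derivative]) auto
      show "onorm (d2f z a) \<le> C * norm a"
        using d2[OF z] by (intro onorm_le)
    qed
    then show ?thesis
      by (simp add: mult_ac)
  qed
  have "controlled x0 r (B / 2) C"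
    unfolding controlled_def using \<open>0 < r\<close> \<open>0 < B\<close> \<open>0 \<le> C\<close> cD bilip lower lip d2 by auto
  then show ?thesis ..
qed

text \<open>Differentiability is known for \<open>\<iota> \<circ> \<gamma>\<close> but not for the
  coordinate curve. The lower bound \<open>m\<close> keeps the difference quotients of the
  coordinates bounded, and a left inverse \<open>B\<close> of \<open>df x0\<close> then forces them
  to converge to \<open>B u\<close>.\<close>

lemma curve_in_chart:
  assumes cont: "continuous (at s within S) \<gamma>" and "s \<in> S" and "\<gamma> ` S \<subseteq> M"
    and "\<gamma> s = \<phi> x0" and "x0 \<in> D" and nontrivial: "at s within S \<noteq> bot"
    and deriv: "((\<iota> \<circ> \<gamma>) has_vector_derivative u) (at s within S)"
  obtains b where "u = df x0 b" and "((\<lambda>t. \<psi> (\<gamma> t)) has_vector_derivative b) (at s within S)"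
    and "\<forall>\<^sub>F t in at s within S. \<gamma> t \<in> \<phi> ` D" and "((\<lambda>t. \<psi> (\<gamma> t)) \<longlongrightarrow> x0) (at s within S)"
proof -
  let ?F = "at s within S"
  define y where "y t = \<psi> (\<gamma> t)" for t
  obtain U where "open U" and U: "\<phi> ` D = M \<inter> U"
    using open_image openin_open by blast
  have lim: "(\<gamma> \<longlongrightarrow> \<gamma> s) ?F"
    using cont continuous_within by blast
  have "\<gamma> s \<in> U"
    using U assms by auto
  then have "\<forall>\<^sub>F t in ?F. \<gamma> t \<in> U"
    using lim \<open>open U\<close> topological_tendstoD by blast
  moreover have "\<forall>\<^sub>F t in ?F. t \<in> S"
    by (simp add: eventually_at_filter)
  ultimately have in_chart: "\<forall>\<^sub>F t in ?F. \<gamma> t \<in> \<phi> ` D"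
    by eventually_elim (use U assms in blast)
  have ylim: "(y \<longlongrightarrow> x0) ?F"
    unfolding y_def using continuous_on_tendsto_compose[OF continuous_on_psi lim _ in_chart] assms by auto
  obtain r m C where ctrl: "controlled x0 r m C"
    using ex_controlled[OF \<open>x0 \<in> D\<close>] .
  obtain B where "linear B" and B: "B \<circ> df x0 = id"
    using linear_injective_left_inverse[OF linear_df inj_df] \<open>x0 \<in> D\<close> by metis
  have BL: "bounded_linear B"
    using \<open>linear B\<close> by (simp add: linear_conv_bounded_linear)
  \<comment> \<open>The relative remainder of the first-order expansion of the chart; division by
    zero gives it the value 0 at \<open>x0\<close>, so that it is continuous there.\<close>
  define e where "e x = (1 / norm (x - x0)) *\<^sub>R ((\<iota> \<circ> \<phi>) x - ((\<iota> \<circ> \<phi>) x0 + df x0 (x - x0)))" for x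
  have "(e \<longlongrightarrow> 0) (at x0)"
    using has_derivative_chart[OF \<open>x0 \<in> D\<close>] unfolding has_derivative_within e_def by blast
  then have "isCont e x0"
    by (simp add: isCont_def e_def)
  then have elim: "((\<lambda>t. e (y t)) \<longlongrightarrow> 0) ?F"
    using isCont_tendsto_compose[OF _ ylim] by (fastforce simp: e_def)
  define q where "q t = (1 / (t - s)) *\<^sub>R (\<iota> (\<gamma> t) - \<iota> (\<gamma> s))" for t
  have qlim: "(q \<longlongrightarrow> u) ?F"
    using deriv unfolding has_vector_derivative_quotient q_def by simp
  \<comment> \<open>\<open>p\<close> and \<open>q\<close> are the difference quotients of the
    coordinate curve and of \<open>\<iota> \<circ> \<gamma>\<close>. Applying \<open>B\<close> to
    the expansion at \<open>x0\<close> shows that \<open>p\<close> and \<open>B q\<close> differ by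
    at most \<open>norm (p t)\<close> times a vanishing remainder, up to the constant of
    \<open>B\<close>.\<close>
  define p where "p t = (1 / (t - s)) *\<^sub>R (y t - x0)" for t
  have ball: "\<forall>\<^sub>F t in ?F. y t \<in> ball x0 r"
    using ylim ctrl unfolding controlled_def by (intro topological_tendstoD) auto
  have "\<forall>\<^sub>F t in ?F. norm (p t - B (q t)) \<le> norm (B ((norm (p t)) *\<^sub>R e (y t)))"
    using in_chart
  proof eventually_elim
    case (elim t)
    have y: "y t \<in> D" "\<phi> (y t) = \<gamma> t"
      using elim psi_in_domain by (auto simp: y_def)
    show ?case
    proof (cases "t = s")
      case True
      then show ?thesis
        using assms by (simp add: p_def q_def linear_0[OF \<open>linear B\<close>])
    next
      case False
      have "norm (y t - x0) *\<^sub>R e (y t) = \<iota> (\<gamma> t) - \<iota> (\<gamma> s) - df x0 (y t - x0)"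
        using y assms by (cases "y t = x0") (auto simp: e_def linear_0[OF linear_df] algebra_simps)
      then have "B (norm (y t - x0) *\<^sub>R e (y t)) = B (\<iota> (\<gamma> t) - \<iota> (\<gamma> s)) - (y t - x0)"
        using B by (simp add: linear_diff[OF \<open>linear B\<close>] pointfree_idE)
      then have "(1 / (t - s)) *\<^sub>R B (norm (y t - x0) *\<^sub>R e (y t)) = B (q t) - p t"
        unfolding q_def p_def linear_scale[OF \<open>linear B\<close>] by (metis scaleR_diff_right)
      then have "norm (p t - B (q t)) = norm ((1 / (t - s)) *\<^sub>R B (norm (y t - x0) *\<^sub>R e (y t)))"
        by (metis norm_minus_commute)
      also have "\<dots> = norm (B ((norm (p t)) *\<^sub>R e (y t)))"
        by (simp add: p_def linear_scale[OF \<open>linear B\<close>])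
      finally show ?thesis by simp
    qed
  qed
  moreover have "((\<lambda>t. B (norm (p t) *\<^sub>R e (y t))) \<longlongrightarrow> 0) ?F"
  proof -
    have "\<forall>\<^sub>F t in ?F. norm (norm (p t) *\<^sub>R e (y t)) \<le> norm (q t) / m * norm (e (y t))"
      using in_chart ball
    proof eventually_elim
      case (elim t)
      have y: "\<phi> (y t) = \<gamma> t"
        using elim by (auto simp: y_def)
      have "m * norm (y t - x0) \<le> norm (\<iota> (\<gamma> t) - \<iota> (\<gamma> s))"
        using ctrl elim y assms unfolding controlled_def by (metis ball_subset_cball centre_in_cball less_imp_le subsetD)
      then have "m * norm (p t) \<le> norm (q t)"
        by (simp add: p_def q_def divide_simps mult.commute)
      then have "norm (p t) \<le> norm (q t) / m"
        using ctrl by (simp add: controlled_def field_simps)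
      then have "norm (p t) * norm (e (y t)) \<le> norm (q t) / m * norm (e (y t))"
        by (rule mult_right_mono) simp
      then show ?case
        by simp
    qed
    moreover have "((\<lambda>t. norm (q t) / m * norm (e (y t))) \<longlongrightarrow> 0) ?F"
      using tendsto_mult[OF tendsto_divide[OF tendsto_norm[OF qlim] tendsto_const[of m]] tendsto_norm[OF elim]]
        ctrl by (simp add: controlled_def)
    ultimately have "((\<lambda>t. norm (p t) *\<^sub>R e (y t)) \<longlongrightarrow> 0) ?F"
      by (rule Lim_null_comparison)
    then have "((\<lambda>t. B (norm (p t) *\<^sub>R e (y t))) \<longlongrightarrow> B 0) ?F"
      by (rule bounded_linear.tendsto[OF BL])
    then show ?thesis
      by (simp add: linear_0[OF \<open>linear B\<close>])
  qed
  ultimately have "((\<lambda>t. p t - B (q t)) \<longlongrightarrow> 0) ?F"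
    by (rule Lim_null_comparison[OF _ tendsto_norm_zero])
  then have plim: "(p \<longlongrightarrow> B u) ?F"
    using tendsto_add[OF _ bounded_linear.tendsto[OF BL qlim]] by fastforce
  have dy: "(y has_vector_derivative B u) ?F"
    unfolding has_vector_derivative_quotient using plim assms by (simp add: p_def[abs_def] y_def)
  have "((\<iota> \<circ> \<phi>) \<circ> y has_vector_derivative df x0 (B u)) ?F"
    using vector_derivative_diff_chain_within[of y "B u" s S "\<iota> \<circ> \<phi>" "df x0"] dy
      has_derivative_chart[OF \<open>x0 \<in> D\<close>] assms by (auto simp: y_def intro: has_derivative_at_withinI)
  then have "((\<iota> \<circ> \<gamma>) has_vector_derivative df x0 (B u)) ?F"
    unfolding has_vector_derivative_quotient
    by (rule Lim_transform_eventually)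
       (use in_chart assms in \<open>auto elim!: eventually_mono simp: y_def\<close>)
  then have "u = df x0 (B u)"
    using vector_derivative_unique_within[OF nontrivial] deriv by blast
  then show ?thesis
    using that dy in_chart ylim unfolding y_def[abs_def] by blast
qed

text \<open>The definition ranges over all local parametrizations. A tangent vector supplied by
  another one is the velocity of a straight line of its domain carried into \<open>M\<close>, and
  \<open>curve_in_chart\<close> places this velocity in the range of \<open>df x\<close>; no
  transition map has to be differentiated.\<close>

lemma tangent_plane_chart:
  assumes "x \<in> D"
  shows "tangent_plane M \<iota> (\<phi> x) = range (df x)"
proof
  show "range (df x) \<subseteq> tangent_plane M \<iota> (\<phi> x)"
    using local_param assms unfolding tangent_plane_def df_def by blast
next
  show "tangent_plane M \<iota> (\<phi> x) \<subseteq> range (df x)"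
  proof
    fix v assume "v \<in> tangent_plane M \<iota> (\<phi> x)"
    then obtain D2 \<phi>2 y w where lp: "local_param M \<iota> D2 \<phi>2" and y: "y \<in> D2" "\<phi>2 y = \<phi> x"
      and v: "v = frechet_derivative (\<iota> \<circ> \<phi>2) (at y) w"
      unfolding tangent_plane_def by blast
    from lp obtain \<psi>2 where "surface_chart M \<iota> D2 \<phi>2 \<psi>2"
      unfolding local_param_def surface_chart_def by blast
    then interpret c2: surface_chart M \<iota> D2 \<phi>2 \<psi>2 .
    define l where "l t = y + t *\<^sub>R w" for t
    define S where "S = l -` D2"
    have cl: "isCont l t" for t
      unfolding l_def by (intro continuous_intros)
    then have "open S"
      unfolding S_def by (intro open_vimage c2.open_domain) (simp add: continuous_on_eq_continuous_at)
    have "0 \<in> S"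
      using y by (simp add: S_def l_def)
    have atS: "at 0 within S = at 0"
      using \<open>open S\<close> \<open>0 \<in> S\<close> at_within_open by blast
    have "(l has_vector_derivative w) (at 0)"
      unfolding l_def by (auto intro!: derivative_eq_intros)
    then have "((\<iota> \<circ> \<phi>2) \<circ> l has_vector_derivative c2.df y w) (at 0)"
      using vector_derivative_diff_chain_within[of l w 0 UNIV "\<iota> \<circ> \<phi>2" "c2.df y"]
        c2.has_derivative_chart[OF y(1)] by (auto simp: l_def intro: has_derivative_at_withinI)
    moreover have "isCont \<phi>2 (l 0)"
      using c2.continuous_on_phi c2.open_domain y(1) continuous_on_eq_continuous_at by (fastforce simp: l_def)
    then have "isCont (\<phi>2 \<circ> l) 0"
      by (rule continuous_at_compose[OF cl])
    moreover have "(\<phi>2 \<circ> l) ` S \<subseteq> M"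
      using c2.chart_in_M by (auto simp: S_def)
    ultimately obtain b where "c2.df y w = df x b"
      using curve_in_chart[of 0 S "\<phi>2 \<circ> l" x "c2.df y w"] \<open>0 \<in> S\<close> y assms atS
      by (auto simp: comp_assoc l_def)
    then show "v \<in> range (df x)"
      using v by (simp add: c2.df_def)
  qed
qed

lemma controlledD:
  assumes "controlled x0 r m C"
  shows "0 < r" "0 < m" "m \<noteq> 0" "0 \<le> C" "cball x0 r \<subseteq> D" "x \<in> cball x0 r \<Longrightarrow> x \<in> D" "x0 \<in> D"
  using assms centre_in_cball[of x0 r] unfolding controlled_def by auto

lemma controlled_bilip:
  "controlled x0 r m C \<Longrightarrow> x \<in> cball x0 r \<Longrightarrow> y \<in> cball x0 r \<Longrightarrow>
    m * norm (x - y) \<le> norm (\<iota> (\<phi> x) - \<iota> (\<phi> y))"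
  unfolding controlled_def by blast

lemma controlled_lower: "controlled x0 r m C \<Longrightarrow> x \<in> cball x0 r \<Longrightarrow> m * norm a \<le> norm (df x a)"
  unfolding controlled_def by blast

lemma controlled_lip:
  "controlled x0 r m C \<Longrightarrow> x \<in> cball x0 r \<Longrightarrow> y \<in> cball x0 r \<Longrightarrow>
    norm (df x a - df y a) \<le> C * norm (x - y) * norm a"
  unfolding controlled_def by blast

lemma controlled_d2f: "controlled x0 r m C \<Longrightarrow> x \<in> cball x0 r \<Longrightarrow> norm (d2f x a b) \<le> C * norm a * norm b"
  unfolding controlled_def by blast

lemma eventually_controlled:
  assumes "controlled x0 r m C" "(x \<longlongrightarrow> x0) F"
  shows "\<forall>\<^sub>F h in F. x h \<in> cball x0 r"
proof -
  have "\<forall>\<^sub>F h in F. x h \<in> ball x0 r"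
    using assms(2) controlledD(1)[OF assms(1)] by (intro topological_tendstoD) auto
  then show ?thesis
    by eventually_elim auto
qed

text \<open>The difference \<open>a h - a0\<close> is at most \<open>1 / m\<close> times its image
  under \<open>df (x h)\<close>, and \<open>df (x h) (a h)\<close> and \<open>df (x h) a0\<close>
  have the same limit.\<close>

lemma tendsto_coords:
  assumes x: "(x \<longlongrightarrow> x0) F" and "x0 \<in> D" and lim: "((\<lambda>h. df (x h) (a h)) \<longlongrightarrow> df x0 a0) F"
  shows "(a \<longlongrightarrow> a0) F"
proof -
  obtain r m C where ctrl: "controlled x0 r m C"
    using ex_controlled[OF \<open>x0 \<in> D\<close>] .
  have "\<forall>\<^sub>F h in F. x h \<in> cball x0 r"
    by (rule eventually_controlled[OF ctrl x])
  then have "\<forall>\<^sub>F h in F. norm (a h - a0) \<le> norm (df (x h) (a h) - df (x h) a0) / m"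
  proof eventually_elim
    case (elim h)
    have "m * norm (a h - a0) \<le> norm (df (x h) (a h) - df (x h) a0)"
      using controlled_lower[OF ctrl elim, of "a h - a0"]
      by (simp add: linear_diff[OF linear_df[OF controlledD(6)[OF ctrl elim]]])
    then show ?case
      using controlledD(2)[OF ctrl] by (simp add: field_simps)
  qed
  moreover have "((\<lambda>h. norm (df (x h) (a h) - df (x h) a0) / m) \<longlongrightarrow> norm (df x0 a0 - df x0 a0) / m) F"
    by (rule tendsto_divide[OF tendsto_norm[OF tendsto_diff[OF lim tendsto_df[OF x \<open>x0 \<in> D\<close> tendsto_const]]]
          tendsto_const controlledD(3)[OF ctrl]])
  ultimately have "((\<lambda>h. a h - a0) \<longlongrightarrow> 0) F"
    by (intro Lim_null_comparison[where g="\<lambda>h. norm (df (x h) (a h) - df (x h) a0) / m" and f="\<lambda>h. a h - a0"]) simp_all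
  then show ?thesis
    by (rule LIM_zero_cancel)
qed

lemma subspace_range_df: "x \<in> D \<Longrightarrow> subspace (range (df x))"
  using linear_df linear_subspace_image subspace_UNIV by blast

lemma range_df_decomp:
  assumes "x \<in> D"
  obtains e \<nu> where "v = df x e + \<nu>" and "\<And>a. \<nu> \<bullet> df x a = 0"
proof -
  have span: "span (range (df x)) = range (df x)"
    using subspace_range_df[OF assms] by (simp add: span_eq_iff)
  obtain y \<nu> where y: "y \<in> span (range (df x))" and \<nu>: "\<And>w. w \<in> span (range (df x)) \<Longrightarrow> orthogonal \<nu> w" and "v = y + \<nu>"
    using orthogonal_subspace_decomp_exists[of "range (df x)" v] by blast
  moreover obtain e where "y = df x e"
    using y unfolding span by blast
  moreover have "\<nu> \<bullet> df x a = 0" for a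
    using \<nu>[of "df x a"] unfolding span orthogonal_def by simp
  ultimately show ?thesis
    using that by blast
qed

text \<open>Here \<open>z h\<close> is the component of \<open>Q h\<close> normal to the surface at
  a moving point: the normal projection depends continuously on the point. No formula for the
  projection is needed, since the squared distance to the limit splits into three inner products
  that vanish.\<close>

lemma tendsto_normal_part:
  assumes x: "x \<longlonglongrightarrow> x0" and "x0 \<in> D"
    and Q: "Q \<longlonglongrightarrow> Q0" and z: "\<And>h e. z h \<bullet> df (x h) e = 0"
    and zQ: "\<And>h. \<exists>e. Q h = z h + df (x h) e"
  shows "convergent z"
proof -
  obtain e where e: "\<And>h. Q h = z h + df (x h) (e h)"
    using zQ by metis
  obtain r m C where ctrl: "controlled x0 r m C"
    using ex_controlled[OF \<open>x0 \<in> D\<close>] .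
  obtain e0 z0 where z0: "Q0 = df x0 e0 + z0" "\<And>a. z0 \<bullet> df x0 a = 0"
    using range_df_decomp[OF \<open>x0 \<in> D\<close>, of Q0] by metis
  have bound: "\<forall>\<^sub>F h in sequentially. norm (df (x h) (e h)) \<le> norm (Q h) \<and> norm (z h) \<le> norm (Q h) \<and> m * norm (e h) \<le> norm (Q h)"
  proof -
    have "\<forall>\<^sub>F h in sequentially. x h \<in> cball x0 r"
      by (rule eventually_controlled[OF ctrl x])
    then show ?thesis
    proof eventually_elim
      case (elim h)
      have pyth: "(norm (Q h))\<^sup>2 = (norm (z h))\<^sup>2 + (norm (df (x h) (e h)))\<^sup>2"
        unfolding e power2_norm_eq_inner inner_add_left inner_add_right
        using z[of h "e h"] inner_commute[of "z h" "df (x h) (e h)"] by simp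
      have "(norm (df (x h) (e h)))\<^sup>2 \<le> (norm (Q h))\<^sup>2" "(norm (z h))\<^sup>2 \<le> (norm (Q h))\<^sup>2"
        unfolding pyth by simp_all
      then have "norm (df (x h) (e h)) \<le> norm (Q h)" "norm (z h) \<le> norm (Q h)"
        by (blast intro: power2_le_imp_le[OF _ norm_ge_zero])+
      moreover have "m * norm (e h) \<le> norm (df (x h) (e h))"
        by (rule controlled_lower[OF ctrl elim])
      ultimately show ?case by linarith
    qed
  qed
  have "Bseq Q"
    using Q convergent_imp_Bseq convergentI by blast
  then obtain K where K: "\<And>h. norm (Q h) \<le> K"
    by (auto simp: Bseq_def)
  have lz: "(\<lambda>h. z h \<bullet> (df (x h) e0 - df x0 e0)) \<longlonglongrightarrow> 0"
  proof (rule Lim_null_comparison)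
    show "\<forall>\<^sub>F h in sequentially. norm (z h \<bullet> (df (x h) e0 - df x0 e0)) \<le> K * norm (df (x h) e0 - df x0 e0)"
      using bound
    proof eventually_elim
      case (elim h)
      have "norm (z h) \<le> K"
        using elim K[of h] by linarith
      then show ?case
        by (auto intro!: order_trans[OF Cauchy_Schwarz_ineq2] mult_right_mono)
    qed
    have "(\<lambda>h. K * norm (df (x h) e0 - df x0 e0)) \<longlonglongrightarrow> K * norm (df x0 e0 - df x0 e0)"
      by (rule tendsto_mult[OF tendsto_const tendsto_norm[OF
            tendsto_diff[OF tendsto_df[OF x \<open>x0 \<in> D\<close> tendsto_const] tendsto_const]]])
    then show "(\<lambda>h. K * norm (df (x h) e0 - df x0 e0)) \<longlonglongrightarrow> 0" by simp
  qed
  have le: "(\<lambda>h. z0 \<bullet> df (x h) (e h)) \<longlonglongrightarrow> 0"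
  proof (rule Lim_null_comparison)
    have "\<forall>\<^sub>F h in sequentially. x h \<in> cball x0 r"
      by (rule eventually_controlled[OF ctrl x])
    with bound show "\<forall>\<^sub>F h in sequentially. norm (z0 \<bullet> df (x h) (e h)) \<le> norm z0 * (C * norm (x h - x0) * (K / m))"
    proof eventually_elim
      case (elim h)
      have "norm (z0 \<bullet> df (x h) (e h)) = norm (z0 \<bullet> (df (x h) (e h) - df x0 (e h)))"
        using z0(2) by (simp add: inner_diff_right)
      also have "\<dots> \<le> norm z0 * norm (df (x h) (e h) - df x0 (e h))"
        using Cauchy_Schwarz_ineq2 by simp
      also have "\<dots> \<le> norm z0 * (C * norm (x h - x0) * norm (e h))"
        using controlled_lip[OF ctrl elim(2)] controlledD(1)[OF ctrl] by (intro mult_left_mono) auto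
      also have "\<dots> \<le> norm z0 * (C * norm (x h - x0) * (K / m))"
        using controlledD(2,4)[OF ctrl] elim(1) K[of h] by (intro mult_left_mono) (auto simp: field_simps)
      finally show ?case .
    qed
    have "(\<lambda>h. norm z0 * (C * norm (x h - x0) * (K / m))) \<longlonglongrightarrow> norm z0 * (C * norm (x0 - x0) * (K / m))"
      by (intro tendsto_mult tendsto_norm tendsto_diff tendsto_const x)
    then show "(\<lambda>h. norm z0 * (C * norm (x h - x0) * (K / m))) \<longlonglongrightarrow> 0" by simp
  qed
  have lQ: "(\<lambda>h. (z h - z0) \<bullet> (Q h - Q0)) \<longlonglongrightarrow> 0"
  proof (rule Lim_null_comparison)
    show "\<forall>\<^sub>F h in sequentially. norm ((z h - z0) \<bullet> (Q h - Q0)) \<le> (K + norm z0) * norm (Q h - Q0)"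
      using bound
    proof eventually_elim
      case (elim h)
      have "norm (z h - z0) \<le> K + norm z0"
        using elim K[of h] norm_triangle_ineq4[of "z h" z0] by linarith
      then show ?case
        by (auto intro!: order_trans[OF Cauchy_Schwarz_ineq2] mult_right_mono)
    qed
    have "(\<lambda>h. (K + norm z0) * norm (Q h - Q0)) \<longlonglongrightarrow> (K + norm z0) * norm (Q0 - Q0)"
      by (intro tendsto_mult tendsto_norm tendsto_diff tendsto_const Q)
    then show "(\<lambda>h. (K + norm z0) * norm (Q h - Q0)) \<longlonglongrightarrow> 0" by simp
  qed
  \<comment> \<open>Each normal vector annihilates the tangent vectors at its own point, so what
    remains besides the product with \<open>Q h - Q0\<close> measures how far \<open>z h\<close> and
    \<open>z0\<close> are from being normal at the other point.\<close>
  have "(norm (z h - z0))\<^sup>2 = (z h - z0) \<bullet> (Q h - Q0) - z h \<bullet> (df (x h) e0 - df x0 e0) + z0 \<bullet> df (x h) (e h)" for h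
    using z[of h] z0 unfolding e z0(1) power2_norm_eq_inner
    by (simp add: inner_diff_left inner_diff_right inner_add_left inner_add_right)
  moreover have "(\<lambda>h. (z h - z0) \<bullet> (Q h - Q0) - z h \<bullet> (df (x h) e0 - df x0 e0) + z0 \<bullet> df (x h) (e h)) \<longlonglongrightarrow> 0 - 0 + 0"
    by (intro tendsto_add tendsto_diff lQ lz le)
  ultimately have "(\<lambda>h. (norm (z h - z0))\<^sup>2) \<longlonglongrightarrow> 0"
    by simp
  then have "(\<lambda>h. norm (z h - z0)) \<longlonglongrightarrow> 0"
    by simp
  then show ?thesis
    by (rule convergentI[OF LIM_zero_cancel[OF tendsto_norm_zero_cancel]])
qed

lemma eventually_in_chart:
  assumes lim: "(q \<longlongrightarrow> \<phi> x0) F" and "x0 \<in> D" and "\<forall>\<^sub>F h in F. q h \<in> M"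
  shows "\<forall>\<^sub>F h in F. q h \<in> \<phi> ` D" and "((\<lambda>h. \<psi> (q h)) \<longlongrightarrow> x0) F"
proof -
  obtain U where "open U" and U: "\<phi> ` D = M \<inter> U"
    using open_image openin_open by blast
  have "\<forall>\<^sub>F h in F. q h \<in> U"
    using lim \<open>open U\<close> U \<open>x0 \<in> D\<close> by (intro topological_tendstoD) auto
  with assms(3) show ev: "\<forall>\<^sub>F h in F. q h \<in> \<phi> ` D"
    by eventually_elim (use U in blast)
  show "((\<lambda>h. \<psi> (q h)) \<longlongrightarrow> x0) F"
    using continuous_on_tendsto_compose[OF continuous_on_psi lim _ ev] \<open>x0 \<in> D\<close> by simp
qed

end

text \<open>Such a \<open>z\<close> is the value of the second fundamental form of the surface at \<open>(u, w)\<close>.\<close>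

definition parallel_at ::
  "'m::t2_space set \<Rightarrow> ('m \<Rightarrow> 'a::euclidean_space) \<Rightarrow> 'm \<Rightarrow> 'a \<Rightarrow> 'a \<Rightarrow> 'a \<Rightarrow> bool" where
  "parallel_at M \<iota> p u w z \<longleftrightarrow>
     (\<exists>\<gamma> X s S. open S \<and> s \<in> S \<and> isCont \<gamma> s \<and> \<gamma> ` S \<subseteq> M \<and> \<gamma> s = p \<and>
        ((\<iota> \<circ> \<gamma>) has_vector_derivative u) (at s) \<and> (\<forall>t\<in>S. X t \<in> tangent_plane M \<iota> (\<gamma> t)) \<and>
        X s = w \<and> (X has_vector_derivative z) (at s) \<and> (\<forall>v\<in>tangent_plane M \<iota> p. z \<bullet> v = 0))"

section \<open>Bounds and convergence for the second fundamental form in a chart\<close>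

context surface_chart begin

text \<open>With \<open>X t = df (y t) (A t)\<close>, testing the difference quotient of
  \<open>X\<close> against a vector \<open>\<nu>\<close> normal at \<open>x0\<close> allows every
  \<open>df x0 i\<close> to be subtracted at no cost. What is left is the quotient of
  \<open>df (y t) i\<close> weighted by \<open>A t\<close>, so continuity of the coordinates
  \<open>A\<close> suffices.\<close>

lemma parallel_at_chart:
  assumes "x0 \<in> D" and "parallel_at M \<iota> (\<phi> x0) u w z"
  obtains a b where "w = df x0 a" "u = df x0 b" "\<And>e. z \<bullet> df x0 e = 0"
    "\<And>\<nu>. (\<And>e. \<nu> \<bullet> df x0 e = 0) \<Longrightarrow> z \<bullet> \<nu> = d2f x0 a b \<bullet> \<nu>"
proof -
  obtain \<gamma> X s S where S: "open S" "s \<in> S" and cont: "isCont \<gamma> s" and M: "\<gamma> ` S \<subseteq> M" and \<gamma>s: "\<gamma> s = \<phi> x0"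
    and du: "((\<iota> \<circ> \<gamma>) has_vector_derivative u) (at s)" and X: "\<And>t. t \<in> S \<Longrightarrow> X t \<in> tangent_plane M \<iota> (\<gamma> t)"
    and Xs: "X s = w" and dX: "(X has_vector_derivative z) (at s)"
    and z: "\<And>v. v \<in> tangent_plane M \<iota> (\<phi> x0) \<Longrightarrow> z \<bullet> v = 0"
    using assms(2) unfolding parallel_at_def by blast
  have atS: "at s within S = at s"
    using S at_within_open by blast
  define y where "y t = \<psi> (\<gamma> t)" for t
  have ys: "y s = x0"
    using \<gamma>s \<open>x0 \<in> D\<close> by (simp add: y_def)
  obtain b where b: "u = df x0 b" and dy: "(y has_vector_derivative b) (at s)"
    and ev: "\<forall>\<^sub>F t in at s. \<gamma> t \<in> \<phi> ` D" and ylim: "(y \<longlongrightarrow> x0) (at s)"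
    using curve_in_chart[of s S \<gamma> x0 u] S cont M \<gamma>s \<open>x0 \<in> D\<close> du unfolding atS y_def[abs_def] by auto
  obtain a where a: "w = df x0 a"
    using X[OF \<open>s \<in> S\<close>] \<gamma>s Xs tangent_plane_chart[OF \<open>x0 \<in> D\<close>] by auto
  define A where "A t = (SOME a. X t = df (y t) a)" for t
  have "\<forall>\<^sub>F t in at s. t \<in> S"
    using S by (simp add: eventually_at_in_open')
  with ev have A: "\<forall>\<^sub>F t in at s. y t \<in> D \<and> X t = df (y t) (A t)"
  proof eventually_elim
    case (elim t)
    then have "y t \<in> D" "\<phi> (y t) = \<gamma> t"
      using psi_in_domain by (auto simp: y_def)
    then have "X t \<in> range (df (y t))"
      using X[OF \<open>t \<in> S\<close>] tangent_plane_chart by metis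
    then show ?case
      unfolding A_def using \<open>y t \<in> D\<close> by (metis (mono_tags, lifting) imageE someI_ex)
  qed
  have "(X \<longlongrightarrow> df x0 a) (at s)"
    using has_vector_derivative_continuous[OF dX] Xs a by (simp add: isCont_def)
  then have "((\<lambda>t. df (y t) (A t)) \<longlongrightarrow> df x0 a) (at s)"
    by (rule Lim_transform_eventually) (use A in \<open>auto elim: eventually_mono\<close>)
  then have Alim: "(A \<longlongrightarrow> a) (at s)"
    by (rule tendsto_coords[OF ylim \<open>x0 \<in> D\<close>])
  have "z \<bullet> \<nu> = d2f x0 a b \<bullet> \<nu>" if \<nu>: "\<And>e. \<nu> \<bullet> df x0 e = 0" for \<nu>
  proof -
    have \<nu>': "df x0 e \<bullet> \<nu> = 0" for e
      using \<nu>[of e] by (simp add: inner_commute)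
    have dk: "((\<lambda>t. (1 / (t - s)) *\<^sub>R (df (y t) i - df x0 i)) \<longlongrightarrow> d2f x0 i b) (at s)" for i
    proof -
      have "((\<lambda>x. df x i) \<circ> y has_vector_derivative d2f x0 i b) (at s)"
        using vector_derivative_diff_chain_within[of y b s UNIV "\<lambda>x. df x i" "d2f x0 i"] dy ys
          df_has_derivative[OF \<open>x0 \<in> D\<close>, of i] by (auto intro: has_derivative_at_withinI)
      then show ?thesis
        unfolding has_vector_derivative_quotient by (simp add: ys)
    qed
    have "((\<lambda>t. ((1 / (t - s)) *\<^sub>R (X t - X s)) \<bullet> \<nu>) \<longlongrightarrow> z \<bullet> \<nu>) (at s)"
      using dX unfolding has_vector_derivative_quotient by (rule tendsto_inner) (rule tendsto_const)
    moreover have "\<forall>\<^sub>F t in at s. ((1 / (t - s)) *\<^sub>R (X t - X s)) \<bullet> \<nu> =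
        (\<Sum>i\<in>Basis. (A t \<bullet> i) * (((1 / (t - s)) *\<^sub>R (df (y t) i - df x0 i)) \<bullet> \<nu>))"
      using A
    proof eventually_elim
      case (elim t)
      have "X s \<bullet> \<nu> = 0"
        using \<nu>[of a] Xs a by (simp add: inner_commute)
      then have "((1 / (t - s)) *\<^sub>R (X t - X s)) \<bullet> \<nu> = (1 / (t - s)) * (df (y t) (A t) \<bullet> \<nu>)"
        using elim by (simp add: inner_diff_left)
      also have "df (y t) (A t) \<bullet> \<nu> = (\<Sum>i\<in>Basis. (A t \<bullet> i) * ((df (y t) i - df x0 i) \<bullet> \<nu>))"
        using elim \<nu>' by (subst df_basis_sum) (simp_all add: inner_sum_left inner_diff_left)
      finally show ?case
        by (simp add: sum_distrib_left mult_ac)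
    qed
    ultimately have "((\<lambda>t. \<Sum>i\<in>Basis. (A t \<bullet> i) * (((1 / (t - s)) *\<^sub>R (df (y t) i - df x0 i)) \<bullet> \<nu>)) \<longlongrightarrow> z \<bullet> \<nu>) (at s)"
      by (rule Lim_transform_eventually)
    moreover have "((\<lambda>t. \<Sum>i\<in>Basis. (A t \<bullet> i) * (((1 / (t - s)) *\<^sub>R (df (y t) i - df x0 i)) \<bullet> \<nu>)) \<longlongrightarrow>
        (\<Sum>i\<in>Basis. (a \<bullet> i) * (d2f x0 i b \<bullet> \<nu>))) (at s)"
      by (rule tendsto_sum, rule tendsto_mult[OF tendsto_inner[OF Alim tendsto_const] tendsto_inner[OF dk tendsto_const]])
    moreover have "(\<Sum>i\<in>Basis. (a \<bullet> i) * (d2f x0 i b \<bullet> \<nu>)) = d2f x0 a b \<bullet> \<nu>"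
      by (subst d2f_basis_sum) (simp add: inner_sum_left)
    ultimately show ?thesis
      using tendsto_unique[OF at_neq_bot] by fastforce
  qed
  moreover have "z \<bullet> df x0 e = 0" for e
    using z tangent_plane_chart[OF \<open>x0 \<in> D\<close>] by auto
  ultimately show ?thesis
    using that a b by blast
qed

lemma controlled_coords_le:
  assumes "controlled x0 r m C" "x \<in> cball x0 r"
  shows "norm a \<le> norm (df x a) / m"
  using controlled_lower[OF assms, of a] controlledD(2)[OF assms(1)] by (simp add: field_simps)

text \<open>As \<open>z\<close> is itself normal, it may be taken for \<open>\<nu>\<close> in
  \<open>parallel_at_chart\<close>; then the square of its norm is the product of \<open>z\<close>
  with the second derivative.\<close>

lemma parallel_at_bound:
  assumes ctrl: "controlled x0 r m C" and x: "x \<in> cball x0 r" and "parallel_at M \<iota> (\<phi> x) u w z"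
  shows "norm z \<le> C / (m * m) * norm u * norm w"
proof -
  obtain a b where ab: "w = df x a" "u = df x b" and "\<And>e. z \<bullet> df x e = 0"
    and "\<And>\<nu>. (\<And>e. \<nu> \<bullet> df x e = 0) \<Longrightarrow> z \<bullet> \<nu> = d2f x a b \<bullet> \<nu>"
    using parallel_at_chart[OF controlledD(6)[OF ctrl x] assms(3)] by metis
  then have "norm z * norm z = d2f x a b \<bullet> z"
    by (metis dot_square_norm power2_eq_square)
  also have "\<dots> \<le> norm (d2f x a b) * norm z"
    by (rule norm_cauchy_schwarz)
  finally have "norm z \<le> norm (d2f x a b)"
    by (cases "z = 0") auto
  also have "\<dots> \<le> C * norm a * norm b"
    by (rule controlled_d2f[OF ctrl x])
  also have "\<dots> \<le> C * (norm w / m) * (norm u / m)"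
    unfolding ab using controlledD(1,2,4)[OF ctrl] controlled_coords_le[OF ctrl x]
    by (intro mult_mono mult_left_mono) auto
  finally show ?thesis
    by (simp add: field_simps)
qed

text \<open>The tangent vector with the same coordinates at the other point is orthogonal to
  \<open>\<nu>\<close>, and the two differ by the Lipschitz bound for \<open>df\<close>. One factor
  \<open>1 / m\<close> converts the distance of the points, the other the length of the coordinate
  vector.\<close>

lemma tangent_tilt:
  assumes ctrl: "controlled x0 r m C" and x: "x \<in> cball x0 r" "x' \<in> cball x0 r"
    and y: "y \<in> tangent_plane M \<iota> (\<phi> x)" and \<nu>: "\<And>v. v \<in> tangent_plane M \<iota> (\<phi> x') \<Longrightarrow> \<nu> \<bullet> v = 0"
  shows "\<bar>y \<bullet> \<nu>\<bar> \<le> C / (m * m) * norm (\<iota> (\<phi> x) - \<iota> (\<phi> x')) * norm y * norm \<nu>"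
proof -
  obtain a where a: "y = df x a"
    using y tangent_plane_chart[OF controlledD(6)[OF ctrl x(1)]] by auto
  have "\<nu> \<bullet> df x' a = 0"
    using \<nu> tangent_plane_chart[OF controlledD(6)[OF ctrl x(2)]] by auto
  then have "y \<bullet> \<nu> = (df x a - df x' a) \<bullet> \<nu>"
    by (simp add: a inner_diff_left inner_diff_right inner_commute)
  then have "\<bar>y \<bullet> \<nu>\<bar> \<le> norm (df x a - df x' a) * norm \<nu>"
    by (simp add: Cauchy_Schwarz_ineq2)
  also have "\<dots> \<le> (C * norm (x - x') * norm a) * norm \<nu>"
    by (intro mult_right_mono controlled_lip[OF ctrl x]) simp
  also have "\<dots> \<le> (C * (norm (\<iota> (\<phi> x) - \<iota> (\<phi> x')) / m) * (norm y / m)) * norm \<nu>"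
    using controlledD(2,4)[OF ctrl] controlled_coords_le[OF ctrl x(1), of a] controlled_bilip[OF ctrl x]
    by (intro mult_right_mono mult_mono mult_left_mono) (auto simp: a field_simps)
  finally show ?thesis
    by (simp add: field_simps)
qed

text \<open>The value \<open>z h\<close> is the normal part of the second derivative at
  \<open>x h\<close> in the coordinates of \<open>w h\<close> and \<open>u h\<close>. These
  coordinates converge, and normal parts depend continuously on the point; the limit itself is not
  identified.\<close>

lemma parallel_at_convergent:
  assumes q: "q \<longlonglongrightarrow> \<phi> x0" and "x0 \<in> D" and qM: "\<forall>\<^sub>F h in sequentially. q h \<in> M"
    and u: "u \<longlonglongrightarrow> u0" and w: "w \<longlonglongrightarrow> w0" and "u0 \<in> tangent_plane M \<iota> (\<phi> x0)" "w0 \<in> tangent_plane M \<iota> (\<phi> x0)"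
    and par: "\<forall>\<^sub>F h in sequentially. parallel_at M \<iota> (q h) (u h) (w h) (z h)"
  shows "convergent z"
proof -
  define x where "x h = \<psi> (q h)" for h
  obtain a0 b0 where ab0: "w0 = df x0 a0" "u0 = df x0 b0"
    using assms tangent_plane_chart by auto
  have "\<forall>\<^sub>F h in sequentially. q h \<in> \<phi> ` D"
    using eventually_in_chart(1)[OF q \<open>x0 \<in> D\<close> qM] .
  with par have "\<forall>\<^sub>F h in sequentially. q h \<in> \<phi> ` D \<and> parallel_at M \<iota> (q h) (u h) (w h) (z h)"
    by eventually_elim simp
  then obtain N where N: "\<And>h. h \<ge> N \<Longrightarrow> q h \<in> \<phi> ` D \<and> parallel_at M \<iota> (q h) (u h) (w h) (z h)"
    unfolding eventually_sequentially by blast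
  have xD: "x (h + N) \<in> D" and px: "parallel_at M \<iota> (\<phi> (x (h + N))) (u (h + N)) (w (h + N)) (z (h + N))" for h
    using N[of "h + N"] psi_in_domain by (auto simp: x_def)
  have "\<exists>a b. w (h + N) = df (x (h + N)) a \<and> u (h + N) = df (x (h + N)) b \<and> (\<forall>e. z (h + N) \<bullet> df (x (h + N)) e = 0) \<and>
      (\<forall>\<nu>. (\<forall>e. \<nu> \<bullet> df (x (h + N)) e = 0) \<longrightarrow> z (h + N) \<bullet> \<nu> = d2f (x (h + N)) a b \<bullet> \<nu>)" for h
    using parallel_at_chart[OF xD px] by metis
  then obtain a b where ab: "\<And>h. w (h + N) = df (x (h + N)) (a h)" "\<And>h. u (h + N) = df (x (h + N)) (b h)"
    and z: "\<And>h e. z (h + N) \<bullet> df (x (h + N)) e = 0"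
    and z2: "\<And>h \<nu>. (\<And>e. \<nu> \<bullet> df (x (h + N)) e = 0) \<Longrightarrow> z (h + N) \<bullet> \<nu> = d2f (x (h + N)) (a h) (b h) \<bullet> \<nu>"
    by metis
  have xlim: "(\<lambda>h. x (h + N)) \<longlonglongrightarrow> x0"
    unfolding x_def by (rule LIMSEQ_ignore_initial_segment[OF eventually_in_chart(2)[OF q \<open>x0 \<in> D\<close> qM]])
  have alim: "a \<longlonglongrightarrow> a0"
    by (rule tendsto_coords[OF xlim \<open>x0 \<in> D\<close>])
       (use LIMSEQ_ignore_initial_segment[OF w, of N] in \<open>simp add: ab ab0\<close>)
  have blim: "b \<longlonglongrightarrow> b0"
    by (rule tendsto_coords[OF xlim \<open>x0 \<in> D\<close>])
       (use LIMSEQ_ignore_initial_segment[OF u, of N] in \<open>simp add: ab ab0\<close>)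
  \<comment> \<open>The normal part of the second derivative has the same products with normal
    vectors as \<open>z\<close>, and both are normal, hence their difference is orthogonal to
    itself.\<close>
  have "\<exists>e. d2f (x (h + N)) (a h) (b h) = z (h + N) + df (x (h + N)) e" for h
  proof -
    let ?Q = "d2f (x (h + N)) (a h) (b h)"
    obtain e \<nu> where e: "?Q = df (x (h + N)) e + \<nu>" and \<nu>: "\<And>a. \<nu> \<bullet> df (x (h + N)) a = 0"
      using range_df_decomp[OF xD[of h], of ?Q] by blast
    have "\<nu> \<bullet> (z (h + N) - \<nu>) = 0"
      using z2[of \<nu>, OF \<nu>] \<nu>[of e] unfolding e by (simp add: inner_diff_right inner_add_left inner_add_right inner_commute)
    moreover have "z (h + N) \<bullet> (z (h + N) - \<nu>) = 0"
      using z2[of "z (h + N)", OF z] z2[of \<nu>, OF \<nu>] z[of h e] \<nu>[of e] unfolding e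
      by (simp add: inner_diff_right inner_add_left inner_add_right inner_commute)
    ultimately have "(z (h + N) - \<nu>) \<bullet> (z (h + N) - \<nu>) = 0"
      by (simp add: inner_diff_left)
    then have "z (h + N) = \<nu>" by simp
    then show ?thesis
      using e by (metis add.commute)
  qed
  then have "convergent (\<lambda>h. z (h + N))"
    using tendsto_normal_part[OF xlim \<open>x0 \<in> D\<close> tendsto_d2f[OF xlim \<open>x0 \<in> D\<close> alim blim], of "\<lambda>h. z (h + N)"] z
    by blast
  then show ?thesis
    by (simp add: convergent_ignore_initial_segment)
qed

text \<open>A vector normal at the limit point has a product with \<open>X h\<close> that is bounded
  by the tilt of the tangent planes and so tends to 0. The normal part of \<open>X0\<close> is
  therefore orthogonal to itself.\<close>

lemma tangent_plane_limit:
  assumes q: "q \<longlonglongrightarrow> \<phi> x0" and "x0 \<in> D" and qM: "\<forall>\<^sub>F h in sequentially. q h \<in> M"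
    and X: "X \<longlonglongrightarrow> X0" and T: "\<forall>\<^sub>F h in sequentially. X h \<in> tangent_plane M \<iota> (q h)"
  shows "X0 \<in> tangent_plane M \<iota> (\<phi> x0)"
proof -
  obtain r m C where ctrl: "controlled x0 r m C"
    using ex_controlled[OF \<open>x0 \<in> D\<close>] .
  define x where "x h = \<psi> (q h)" for h
  have xlim: "x \<longlonglongrightarrow> x0"
    unfolding x_def by (rule eventually_in_chart(2)[OF q \<open>x0 \<in> D\<close> qM])
  have perp: "X0 \<bullet> \<nu> = 0" if \<nu>: "\<And>e. \<nu> \<bullet> df x0 e = 0" for \<nu>
  proof -
    have "\<forall>\<^sub>F h in sequentially. norm (X h \<bullet> \<nu>) \<le> C * norm (x h - x0) * (norm (X h) / m) * norm \<nu>"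
      using eventually_controlled[OF ctrl xlim] eventually_in_chart(1)[OF q \<open>x0 \<in> D\<close> qM] T
    proof eventually_elim
      case (elim h)
      have "\<phi> (x h) = q h"
        using elim by (simp add: x_def)
      then obtain a where a: "X h = df (x h) a"
        using elim tangent_plane_chart[OF controlledD(6)[OF ctrl elim(1)]] by auto
      have "X h \<bullet> \<nu> = (df (x h) a - df x0 a) \<bullet> \<nu>"
        using \<nu>[of a] by (simp add: a inner_diff_left inner_diff_right inner_commute)
      then have "norm (X h \<bullet> \<nu>) \<le> norm (df (x h) a - df x0 a) * norm \<nu>"
        by (simp add: Cauchy_Schwarz_ineq2)
      also have "\<dots> \<le> (C * norm (x h - x0) * norm a) * norm \<nu>"
        using controlledD(1)[OF ctrl] by (intro mult_right_mono controlled_lip[OF ctrl elim(1)]) auto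
      also have "\<dots> \<le> (C * norm (x h - x0) * (norm (X h) / m)) * norm \<nu>"
        using controlledD(4)[OF ctrl] controlled_coords_le[OF ctrl elim(1), of a]
        by (intro mult_right_mono mult_left_mono) (auto simp: a)
      finally show ?case .
    qed
    moreover have "(\<lambda>h. C * norm (x h - x0) * (norm (X h) / m) * norm \<nu>) \<longlonglongrightarrow> C * norm (x0 - x0) * (norm X0 / m) * norm \<nu>"
      by (intro tendsto_mult tendsto_divide tendsto_norm tendsto_diff tendsto_const xlim X controlledD(3)[OF ctrl])
    ultimately have "(\<lambda>h. X h \<bullet> \<nu>) \<longlonglongrightarrow> 0"
      using Lim_null_comparison[of "\<lambda>h. X h \<bullet> \<nu>"] by simp
    then show ?thesis
      using LIMSEQ_unique tendsto_inner[OF X tendsto_const] by blast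
  qed
  obtain e \<nu> where e: "X0 = df x0 e + \<nu>" and \<nu>: "\<And>a. \<nu> \<bullet> df x0 a = 0"
    using range_df_decomp[OF \<open>x0 \<in> D\<close>, of X0] by blast
  have "\<nu> \<bullet> \<nu> = 0"
    using perp[OF \<nu>] \<nu>[of e] unfolding e by (simp add: inner_add_left inner_add_right inner_commute)
  then show ?thesis
    using e tangent_plane_chart[OF \<open>x0 \<in> D\<close>] by simp
qed

lemma open_chart_image: "open U \<Longrightarrow> U \<subseteq> D \<Longrightarrow> openin (top_of_set M) (\<phi> ` U)"
  using homeomorphism_imp_open_map[OF homeo, of U] open_domain openin_trans[OF _ open_image]
  by (simp add: openin_open_eq)

text \<open>A connectedness argument: the parameters at which the curve lies in the chart image of
  the small closed ball form a closed and open set. Another sheet of \<open>M\<close> passing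
  through the same region of the Euclidean space cannot be reached.\<close>

lemma curve_stays:
  fixes \<gamma> :: "real \<Rightarrow> 'm"
  assumes ctrl: "controlled x0 r m C" and "a \<le> b" and cont: "continuous_on {a..b} \<gamma>" and M: "\<gamma> ` {a..b} \<subseteq> M"
    and y: "\<gamma> a = \<phi> y" and r: "norm (y - x0) + \<kappa> / m < r"
    and \<kappa>: "\<And>t. t \<in> {a..b} \<Longrightarrow> norm (\<iota> (\<gamma> t) - \<iota> (\<gamma> a)) \<le> \<kappa>"
  shows "\<gamma> b \<in> \<phi> ` cball y (\<kappa> / m)"
proof -
  have "0 \<le> \<kappa>"
    using \<kappa>[of a] \<open>a \<le> b\<close> by auto
  then have "0 \<le> \<kappa> / m"
    using controlledD(2)[OF ctrl] by simp
  have sub: "cball y (\<kappa> / m) \<subseteq> ball x0 r"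
  proof
    fix x assume "x \<in> cball y (\<kappa> / m)"
    then have "norm (x - x0) \<le> norm (y - x0) + \<kappa> / m"
      using norm_triangle_ineq[of "x - y" "y - x0"] by (simp add: dist_norm norm_minus_commute)
    then show "x \<in> ball x0 r"
      using r by (simp add: dist_norm norm_minus_commute)
  qed
  have bD: "ball x0 r \<subseteq> D"
    using controlledD(5)[OF ctrl] ball_subset_cball by blast
  have y0: "y \<in> cball x0 r"
    using sub \<open>0 \<le> \<kappa> / m\<close> centre_in_cball ball_subset_cball by blast
  define S where "S = {a..b} \<inter> \<gamma> -` (\<phi> ` cball y (\<kappa> / m))"
  have "continuous_on (cball y (\<kappa> / m)) \<phi>"
    using continuous_on_phi sub bD by (meson continuous_on_subset order_trans)
  then have "compact (\<phi> ` cball y (\<kappa> / m))"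
    using compact_cball by (rule compact_continuous_image)
  then have "closedin (top_of_set {a..b}) S"
    unfolding S_def by (intro continuous_closedin_preimage[OF cont] compact_imp_closed)
  moreover have "openin (top_of_set {a..b}) S"
  proof -
    obtain W where "open W" and W: "\<phi> ` ball x0 r = M \<inter> W"
      using open_chart_image[OF open_ball bD] openin_open by blast
    \<comment> \<open>Inside the larger ball the lower bound \<open>m\<close> turns the displacement
      bound \<open>\<kappa>\<close> into a coordinate distance of at most
      \<open>\<kappa> / m\<close>, so lying in the open ball already means lying in the small closed
      one.\<close>
    have "S = {a..b} \<inter> \<gamma> -` W"
    proof (intro set_eqI iffI)
      fix t assume "t \<in> S"
      then show "t \<in> {a..b} \<inter> \<gamma> -` W"
        using sub W unfolding S_def by blast
    next
      fix t assume t: "t \<in> {a..b} \<inter> \<gamma> -` W"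
      then have "\<gamma> t \<in> \<phi> ` ball x0 r"
        using W M by blast
      then obtain x where x: "x \<in> ball x0 r" "\<gamma> t = \<phi> x"
        by blast
      then have "m * norm (x - y) \<le> norm (\<iota> (\<gamma> t) - \<iota> (\<gamma> a))"
        using controlled_bilip[OF ctrl _ y0, of x] y by auto
      also have "\<dots> \<le> \<kappa>"
        using \<kappa> t by blast
      finally have "norm (x - y) \<le> \<kappa> / m"
        using controlledD(2)[OF ctrl] by (simp add: field_simps)
      then have "x \<in> cball y (\<kappa> / m)"
        by (simp add: dist_norm norm_minus_commute)
      then show "t \<in> S"
        using t x(2) unfolding S_def by blast
    qed
    then show ?thesis
      using continuous_openin_preimage_gen[OF cont \<open>open W\<close>] by simp
  qed
  moreover have "a \<in> S"
    using \<open>a \<le> b\<close> y \<open>0 \<le> \<kappa> / m\<close> unfolding S_def by auto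
  ultimately have "S = {a..b}"
    using connected_Icc[of a b] unfolding connected_clopen by blast
  then show ?thesis
    using \<open>a \<le> b\<close> unfolding S_def by auto
qed

lemma controlled_smaller:
  assumes "controlled x0 r m C" "0 < r'" "r' \<le> r"
  shows "controlled x0 r' m C"
  using assms subset_cball[OF assms(3), of x0] unfolding controlled_def by (meson subset_iff)

end

section \<open>Local estimates without reference to a chart\<close>

lemma ex_surface_chart:
  assumes "immersed_surface M \<iota>" "p \<in> M"
  obtains D \<phi> \<psi> x0 where "surface_chart M \<iota> D \<phi> \<psi>" "x0 \<in> D" "\<phi> x0 = p"
proof -
  obtain D \<phi> where "local_param M \<iota> D \<phi>" "p \<in> \<phi> ` D"
    using assms unfolding immersed_surface_def by blast
  then show ?thesis
    using that unfolding local_param_def surface_chart_def by blast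
qed

text \<open>A substitute for injectivity of \<open>\<iota>\<close>: smallness is measured in the
  Euclidean space, the conclusion holds in the topology of \<open>M\<close>.\<close>

lemma curve_trapped:
  fixes M :: "'m::t2_space set" and \<iota> :: "'m \<Rightarrow> 'a::euclidean_space"
  assumes "immersed_surface M \<iota>" and U: "openin (top_of_set M) U" "p \<in> U"
  obtains V \<kappa> where "openin (top_of_set M) V" "p \<in> V" "0 < \<kappa>"
    "\<And>\<gamma> a (b::real). a \<le> b \<Longrightarrow> continuous_on {a..b} \<gamma> \<Longrightarrow> \<gamma> ` {a..b} \<subseteq> M \<Longrightarrow> \<gamma> a \<in> V \<Longrightarrow>
      (\<And>t. t \<in> {a..b} \<Longrightarrow> norm (\<iota> (\<gamma> t) - \<iota> (\<gamma> a)) \<le> \<kappa>) \<Longrightarrow> \<gamma> b \<in> U"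
proof -
  have "p \<in> M"
    using U openin_subset by fastforce
  then obtain D \<phi> \<psi> x0 where "surface_chart M \<iota> D \<phi> \<psi>" and x0: "x0 \<in> D" "\<phi> x0 = p"
    using ex_surface_chart assms(1) by metis
  interpret surface_chart M \<iota> D \<phi> \<psi> by fact
  obtain r0 m C where ctrl0: "controlled x0 r0 m C"
    using ex_controlled[OF x0(1)] .
  obtain W where "open W" and W: "U = M \<inter> W"
    using U(1) openin_open by blast
  have "open (D \<inter> \<phi> -` W)"
    using continuous_on_phi open_domain \<open>open W\<close> by (rule continuous_open_preimage)
  moreover have "x0 \<in> D \<inter> \<phi> -` W"
    using x0 U W by auto
  ultimately obtain r1 where r1: "0 < r1" "cball x0 r1 \<subseteq> D \<inter> \<phi> -` W"
    using open_contains_cball by blast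
  define r where "r = min r0 r1"
  have ctrl: "controlled x0 r m C"
    using controlled_smaller[OF ctrl0, of r] r1(1) controlledD(1)[OF ctrl0] by (simp add: r_def)
  have rU: "\<phi> ` cball x0 r \<subseteq> U"
    using r1(2) W chart_in_M by (auto simp: r_def)
  \<comment> \<open>In coordinates the drift is at most \<open>\<kappa> / m = r / 4\<close>, and the
    curve starts within \<open>r / 2\<close> of \<open>x0\<close>, so it stays inside the ball of
    radius \<open>r\<close>.\<close>
  define \<kappa> where "\<kappa> = m * r / 4"
  have "0 < \<kappa>"
    using controlledD(1,2)[OF ctrl] by (simp add: \<kappa>_def)
  have half: "ball x0 (r / 2) \<subseteq> D"
    using controlledD(1,5)[OF ctrl] by (auto simp: subset_iff)
  show ?thesis
  proof (rule that[of "\<phi> ` ball x0 (r / 2)" \<kappa>])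
    show "openin (top_of_set M) (\<phi> ` ball x0 (r / 2))"
      by (rule open_chart_image[OF open_ball half])
    show "p \<in> \<phi> ` ball x0 (r / 2)"
      using x0 controlledD(1)[OF ctrl] by force
    fix \<gamma> :: "real \<Rightarrow> 'm" and a b :: real
    assume "a \<le> b" "continuous_on {a..b} \<gamma>" "\<gamma> ` {a..b} \<subseteq> M" and start: "\<gamma> a \<in> \<phi> ` ball x0 (r / 2)"
      and small: "\<And>t. t \<in> {a..b} \<Longrightarrow> norm (\<iota> (\<gamma> t) - \<iota> (\<gamma> a)) \<le> \<kappa>"
    from start obtain y where y: "\<gamma> a = \<phi> y" "y \<in> ball x0 (r / 2)"
      by blast
    have \<kappa>m: "\<kappa> / m = r / 4"
      using controlledD(3)[OF ctrl] by (simp add: \<kappa>_def)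
    have ny: "norm (y - x0) < r / 2"
      using y(2) by (simp add: dist_norm norm_minus_commute)
    then have "norm (y - x0) + \<kappa> / m < r"
      unfolding \<kappa>m using controlledD(1)[OF ctrl] by linarith
    then have "\<gamma> b \<in> \<phi> ` cball y (\<kappa> / m)"
      using curve_stays[OF ctrl \<open>a \<le> b\<close>] y(1) small \<open>continuous_on {a..b} \<gamma>\<close> \<open>\<gamma> ` {a..b} \<subseteq> M\<close> by blast
    moreover have "cball y (\<kappa> / m) \<subseteq> cball x0 r"
    proof
      fix x assume "x \<in> cball y (\<kappa> / m)"
      then have "norm (x - y) \<le> r / 4"
        unfolding \<kappa>m by (simp add: dist_norm norm_minus_commute)
      then have "norm (x - x0) \<le> r"
        using ny norm_triangle_ineq[of "x - y" "y - x0"] controlledD(1)[OF ctrl] by simp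
      then show "x \<in> cball x0 r"
        by (simp add: dist_norm norm_minus_commute)
    qed
    ultimately show "\<gamma> b \<in> U"
      using rU by blast
  qed (rule \<open>0 < \<kappa>\<close>)
qed

lemma local_curvature_bound:
  assumes "immersed_surface M \<iota>" "p \<in> M"
  obtains U C where "openin (top_of_set M) U" "p \<in> U" "0 \<le> C"
    "\<And>q u w z. q \<in> U \<Longrightarrow> parallel_at M \<iota> q u w z \<Longrightarrow> norm z \<le> C * norm u * norm w"
    "\<And>q q' y \<nu>. q \<in> U \<Longrightarrow> q' \<in> U \<Longrightarrow> y \<in> tangent_plane M \<iota> q \<Longrightarrow> (\<And>v. v \<in> tangent_plane M \<iota> q' \<Longrightarrow> \<nu> \<bullet> v = 0) \<Longrightarrow>
      \<bar>y \<bullet> \<nu>\<bar> \<le> C * norm (\<iota> q - \<iota> q') * norm y * norm \<nu>"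
proof -
  obtain D \<phi> \<psi> x0 where "surface_chart M \<iota> D \<phi> \<psi>" and x0: "x0 \<in> D" "\<phi> x0 = p"
    using ex_surface_chart assms by metis
  interpret surface_chart M \<iota> D \<phi> \<psi> by fact
  obtain r m C where ctrl: "controlled x0 r m C"
    using ex_controlled[OF x0(1)] .
  have bD: "ball x0 r \<subseteq> D"
    using controlledD(5)[OF ctrl] ball_subset_cball by blast
  show ?thesis
  proof (rule that[of "\<phi> ` ball x0 r" "C / (m * m)"])
    show "openin (top_of_set M) (\<phi> ` ball x0 r)"
      by (rule open_chart_image[OF open_ball bD])
    show "p \<in> \<phi> ` ball x0 r"
      using x0 controlledD(1)[OF ctrl] by force
    show "0 \<le> C / (m * m)"
      using controlledD(4)[OF ctrl] by simp
    show "norm z \<le> C / (m * m) * norm u * norm w" if "q \<in> \<phi> ` ball x0 r" "parallel_at M \<iota> q u w z" for q u w z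
      using parallel_at_bound[OF ctrl] that ball_subset_cball by blast
    show "\<bar>y \<bullet> \<nu>\<bar> \<le> C / (m * m) * norm (\<iota> q - \<iota> q') * norm y * norm \<nu>"
      if q: "q \<in> \<phi> ` ball x0 r" "q' \<in> \<phi> ` ball x0 r" and y: "y \<in> tangent_plane M \<iota> q"
        and \<nu>: "\<And>v. v \<in> tangent_plane M \<iota> q' \<Longrightarrow> \<nu> \<bullet> v = 0" for q q' y \<nu>
    proof -
      obtain x x' where x: "x \<in> cball x0 r" "x' \<in> cball x0 r" "q = \<phi> x" "q' = \<phi> x'"
        using q ball_subset_cball by blast
      show ?thesis
        unfolding x(3,4) by (rule tangent_tilt[OF ctrl x(1,2)]) (use y \<nu> x in auto)
    qed
  qed
qed

lemma second_form_convergent: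
  assumes "immersed_surface M \<iota>" "p \<in> M" and "q \<longlonglongrightarrow> p" and "\<forall>\<^sub>F h in sequentially. q h \<in> M"
    and "u \<longlonglongrightarrow> u0" and "w \<longlonglongrightarrow> w0" and "u0 \<in> tangent_plane M \<iota> p" "w0 \<in> tangent_plane M \<iota> p"
    and "\<forall>\<^sub>F h in sequentially. parallel_at M \<iota> (q h) (u h) (w h) (z h)"
  shows "convergent z"
proof -
  obtain D \<phi> \<psi> x0 where "surface_chart M \<iota> D \<phi> \<psi>" and x0: "x0 \<in> D" "\<phi> x0 = p"
    using ex_surface_chart assms(1,2) by metis
  then show ?thesis
    using surface_chart.parallel_at_convergent[of M \<iota> D \<phi> \<psi> q x0 u u0 w w0 z] assms by simp
qed

lemma tangent_plane_closed:
  assumes "immersed_surface M \<iota>" "p \<in> M" and "q \<longlonglongrightarrow> p" and "\<forall>\<^sub>F h in sequentially. q h \<in> M"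
    and "X \<longlonglongrightarrow> X0" and "\<forall>\<^sub>F h in sequentially. X h \<in> tangent_plane M \<iota> (q h)"
  shows "X0 \<in> tangent_plane M \<iota> p"
proof -
  obtain D \<phi> \<psi> x0 where "surface_chart M \<iota> D \<phi> \<psi>" and x0: "x0 \<in> D" "\<phi> x0 = p"
    using ex_surface_chart assms(1,2) by metis
  then show ?thesis
    using surface_chart.tangent_plane_limit[of M \<iota> D \<phi> \<psi> q x0 X X0] assms by simp
qed

lemma curve_derivative_tangent:
  fixes \<gamma> :: "real \<Rightarrow> 'm::t2_space"
  assumes "immersed_surface M \<iota>" and "continuous (at s within S) \<gamma>" and "s \<in> S" and "\<gamma> ` S \<subseteq> M"
    and "at s within S \<noteq> bot" and "((\<iota> \<circ> \<gamma>) has_vector_derivative u) (at s within S)"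
  shows "u \<in> tangent_plane M \<iota> (\<gamma> s)"
proof -
  have "\<gamma> s \<in> M"
    using assms by blast
  then obtain D \<phi> \<psi> x0 where ch: "surface_chart M \<iota> D \<phi> \<psi>" and x0: "x0 \<in> D" "\<phi> x0 = \<gamma> s"
    using ex_surface_chart assms(1) by metis
  interpret surface_chart M \<iota> D \<phi> \<psi> by (rule ch)
  obtain b where "u = df x0 b"
    by (rule curve_in_chart[OF assms(2-4) x0(2)[symmetric] x0(1) assms(5,6)])
  then show ?thesis
    using tangent_plane_chart[OF x0(1)] x0(2) by auto
qed

lemma subspace_tangent_plane:
  assumes "immersed_surface M \<iota>" "p \<in> M"
  shows "subspace (tangent_plane M \<iota> p)"
proof -
  obtain D \<phi> \<psi> x0 where ch: "surface_chart M \<iota> D \<phi> \<psi>" and x0: "x0 \<in> D" "\<phi> x0 = p"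
    using ex_surface_chart assms by metis
  interpret surface_chart M \<iota> D \<phi> \<psi> by (rule ch)
  show ?thesis
    using subspace_range_df[OF x0(1)] tangent_plane_chart[OF x0(1)] x0(2) by simp
qed

text \<open>The tangent plane is an injective linear image of the plane, so it has dimension 2 and
  is spanned by any two orthonormal vectors in it.\<close>

lemma tangent_plane_orthonormal_expand:
  assumes "immersed_surface M \<iota>" "p \<in> M" and e: "e1 \<in> tangent_plane M \<iota> p" "e2 \<in> tangent_plane M \<iota> p"
    "norm e1 = 1" "norm e2 = 1" "e1 \<bullet> e2 = 0" and v: "v \<in> tangent_plane M \<iota> p"
  shows "v = (v \<bullet> e1) *\<^sub>R e1 + (v \<bullet> e2) *\<^sub>R e2"
proof -
  obtain D \<phi> \<psi> x0 where ch: "surface_chart M \<iota> D \<phi> \<psi>" and x0: "x0 \<in> D" "\<phi> x0 = p"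
    using ex_surface_chart assms(1,2) by metis
  interpret surface_chart M \<iota> D \<phi> \<psi> by (rule ch)
  let ?T = "tangent_plane M \<iota> p"
  have T: "?T = range (df x0)"
    using tangent_plane_chart[OF x0(1)] x0(2) by simp
  have "dim ?T = dim (UNIV :: (real^2) set)"
    unfolding T using linear_df[OF x0(1)] inj_df[OF x0(1)] by (intro dim_image_eq) auto
  then have "dim ?T = 2"
    by simp
  have "e1 \<noteq> e2"
    using e by auto
  have po: "pairwise orthogonal {e1, e2}"
    using e by (auto simp: pairwise_def orthogonal_def inner_commute)
  have "0 \<notin> {e1, e2}"
    using e by auto
  then have "independent {e1, e2}"
    using pairwise_orthogonal_independent[OF po] by blast
  then have "?T \<subseteq> span {e1, e2}"
    using e \<open>dim ?T = 2\<close> \<open>e1 \<noteq> e2\<close> by (intro card_ge_dim_independent) auto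
  then have "v \<in> span {e1, e2}"
    using v by blast
  then have "(\<Sum>i\<in>{e1, e2}. (v \<bullet> i) *\<^sub>R i) = v"
    using e po by (intro orthonormal_basis_expand) auto
  then show ?thesis
    using \<open>e1 \<noteq> e2\<close> by simp
qed

subsection \<open>Functions of bounded variation\<close>

text \<open>Subsequences are taken one member at a time; the limits already found survive the later
  selections.\<close>

lemma Helly_selection_family:
  fixes f :: "'i \<Rightarrow> nat \<Rightarrow> real \<Rightarrow> real"
  assumes "finite I" and "\<And>i n x. i \<in> I \<Longrightarrow> continuous (at_right x) (f i n)"
    and "\<And>i n. i \<in> I \<Longrightarrow> mono (f i n)" and "\<And>i n x. i \<in> I \<Longrightarrow> \<bar>f i n x\<bar> \<le> B"
  shows "\<exists>r F. strict_mono (r :: nat \<Rightarrow> nat) \<and>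
    (\<forall>i\<in>I. (\<forall>x. continuous (at_right x) (F i)) \<and> mono (F i) \<and> (\<forall>x. \<bar>F i x\<bar> \<le> B) \<and>
      (\<forall>x. isCont (F i) x \<longrightarrow> (\<lambda>n. f i (r n) x) \<longlonglongrightarrow> F i x))"
  using assms
proof (induction I rule: finite_induct)
  case empty
  show ?case
    by (intro exI[of _ id]) (auto simp: strict_mono_def)
next
  case (insert j I)
  have "\<exists>r F. strict_mono (r :: nat \<Rightarrow> nat) \<and>
    (\<forall>i\<in>I. (\<forall>x. continuous (at_right x) (F i)) \<and> mono (F i) \<and> (\<forall>x. \<bar>F i x\<bar> \<le> B) \<and>
      (\<forall>x. isCont (F i) x \<longrightarrow> (\<lambda>n. f i (r n) x) \<longlonglongrightarrow> F i x))"
    by (rule insert.IH) (use insert.prems in auto)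
  then obtain r F where r: "strict_mono (r :: nat \<Rightarrow> nat)" and F: "\<forall>i\<in>I. (\<forall>x. continuous (at_right x) (F i)) \<and> mono (F i) \<and>
      (\<forall>x. \<bar>F i x\<bar> \<le> B) \<and> (\<forall>x. isCont (F i) x \<longrightarrow> (\<lambda>n. f i (r n) x) \<longlonglongrightarrow> F i x)"
    by blast
  have "\<exists>s. strict_mono (s :: nat \<Rightarrow> nat) \<and> (\<exists>G. (\<forall>x. continuous (at_right x) G) \<and> mono G \<and> (\<forall>x. \<bar>G x\<bar> \<le> B) \<and>
      (\<forall>x. continuous (at x) G \<longrightarrow> (\<lambda>n. f j (r (s n)) x) \<longlonglongrightarrow> G x))"
    by (rule Helly_selection[of "\<lambda>n. f j (r n)"]) (use insert.prems in auto)
  then obtain s G where s: "strict_mono (s :: nat \<Rightarrow> nat)" and G: "\<forall>x. continuous (at_right x) G" "mono G" "\<forall>x. \<bar>G x\<bar> \<le> B"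
      "\<And>x. isCont G x \<Longrightarrow> (\<lambda>n. f j (r (s n)) x) \<longlonglongrightarrow> G x"
    by blast
  have old: "(\<lambda>n. f i (r (s n)) x) \<longlonglongrightarrow> F i x" if "i \<in> I" "isCont (F i) x" for i x
    using LIMSEQ_subseq_LIMSEQ[OF _ s, of "\<lambda>n. f i (r n) x"] F that by (auto simp: o_def)
  show ?case
  proof (intro exI[of _ "r \<circ> s"] exI[of _ "F(j := G)"] conjI strict_mono_o r s ballI)
    fix i assume "i \<in> insert j I"
    then show "\<forall>x. continuous (at_right x) ((F(j := G)) i)" "mono ((F(j := G)) i)" "\<forall>x. \<bar>(F(j := G)) i x\<bar> \<le> B"
      "\<forall>x. isCont ((F(j := G)) i) x \<longrightarrow> (\<lambda>n. f i ((r \<circ> s) n) x) \<longlonglongrightarrow> (F(j := G)) i x"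
      using F G old by (cases "i = j"; simp)+
  qed
qed

text \<open>Statements that hold off a countable set are extended to every point along such
  sequences, by right-continuity.\<close>

lemma ex_sequence_from_right:
  fixes s :: real
  assumes "countable E"
  obtains \<sigma> :: "nat \<Rightarrow> real" where "\<And>k. \<sigma> k \<notin> E" "filterlim \<sigma> (at_right s) sequentially"
proof -
  have "\<exists>x. x \<notin> E \<and> s < x \<and> x < s + inverse (real (Suc k))" for k
  proof -
    have "uncountable {s<..<s + inverse (real (Suc k))}"
      by (intro uncountable_open_interval[THEN iffD2]) simp
    then have "\<not> {s<..<s + inverse (real (Suc k))} \<subseteq> E"
      using assms countable_subset by blast
    then show ?thesis by auto
  qed
  then obtain \<sigma> where \<sigma>: "\<And>k. \<sigma> k \<notin> E" "\<And>k. s < \<sigma> k" "\<And>k. \<sigma> k < s + inverse (real (Suc k))"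
    by metis
  have "\<sigma> \<longlonglongrightarrow> s"
  proof (rule tendsto_sandwich[of "\<lambda>k. s" _ _ "\<lambda>k. s + inverse (real (Suc k))"])
    show "(\<lambda>k. s + inverse (real (Suc k))) \<longlonglongrightarrow> s"
      using tendsto_add[OF tendsto_const LIMSEQ_inverse_real_of_nat, of s] by simp
  qed (simp_all add: less_imp_le[OF \<sigma>(2)] less_imp_le[OF \<sigma>(3)] del: of_nat_Suc)
  then have "filterlim \<sigma> (at_right s) sequentially"
    unfolding filterlim_at using \<sigma>(2) by (auto intro: always_eventually)
  then show ?thesis
    using that \<sigma>(1) by blast
qed

lemma continuous_variation_bound:
  fixes g :: "real \<Rightarrow> 'a::real_normed_vector" and W :: "real \<Rightarrow> real"
  assumes var: "\<And>s t. s \<le> t \<Longrightarrow> norm (g t - g s) \<le> W t - W s" and cont: "continuous (at x within S) W"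
  shows "continuous (at x within S) g"
proof -
  have bound: "norm (g t - g x) \<le> \<bar>W t - W x\<bar>" for t
    using var[of t x] var[of x t] by (cases "x \<le> t") (auto simp: norm_minus_commute)
  have "((\<lambda>t. \<bar>W t - W x\<bar>) \<longlongrightarrow> 0) (at x within S)"
    using cont by (simp add: continuous_within LIM_zero tendsto_rabs_zero)
  then have "((\<lambda>t. g t - g x) \<longlongrightarrow> 0) (at x within S)"
    by (rule Lim_null_comparison[rotated]) (simp add: bound)
  then show ?thesis
    unfolding continuous_within by (rule LIM_zero_cancel)
qed

text \<open>If \<open>W n\<close> dominates the variation of \<open>g n\<close>, then
  \<open>W n\<close> plus a component of \<open>g n\<close> is nondecreasing, and Helly's theorem
  applies to these sums and to \<open>W n\<close>. Subtracting the limit of \<open>W n\<close>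
  recovers \<open>T\<close>, and the same limit dominates the variation of \<open>T\<close>.\<close>

lemma bounded_variation_selection:
  fixes g :: "nat \<Rightarrow> real \<Rightarrow> 'a::euclidean_space" and W :: "nat \<Rightarrow> real \<Rightarrow> real"
  assumes Wmono: "\<And>n. mono (W n)" and Wr: "\<And>n x. continuous (at_right x) (W n)" and Wb: "\<And>n x. \<bar>W n x\<bar> \<le> B"
    and gb: "\<And>n x. norm (g n x) \<le> B" and var: "\<And>n s t. s \<le> t \<Longrightarrow> norm (g n t - g n s) \<le> W n t - W n s"
  obtains r F T where "strict_mono (r :: nat \<Rightarrow> nat)" "mono F" "\<And>x. continuous (at_right x) F" "\<And>x. \<bar>F x\<bar> \<le> 2 * B"
    "\<And>s t. s \<le> t \<Longrightarrow> norm (T t - T s) \<le> F t - F s" "\<And>x. isCont F x \<Longrightarrow> (\<lambda>n. g (r n) x) \<longlonglongrightarrow> T x"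
proof -
  define f where "f b n x = W n x + g n x \<bullet> b" for b n x
  \<comment> \<open>The index 0 stands for \<open>W n\<close> alone.\<close>
  define I :: "'a set" where "I = insert 0 Basis"
  have nb: "norm b \<le> 1" if "b \<in> I" for b
    using that by (auto simp: I_def)
  have gr: "continuous (at_right x) (g n)" for n x
    by (rule continuous_variation_bound[OF var Wr])
  have gbb: "\<bar>v \<bullet> b\<bar> \<le> norm v" if "b \<in> I" for v b
    using Cauchy_Schwarz_ineq2[of v b] nb[OF that] mult_left_le[of "norm b" "norm v"] by simp
  have "\<exists>r F. strict_mono (r :: nat \<Rightarrow> nat) \<and>
    (\<forall>b\<in>I. (\<forall>x. continuous (at_right x) (F b)) \<and> mono (F b) \<and> (\<forall>x. \<bar>F b x\<bar> \<le> 2 * B) \<and>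
      (\<forall>x. isCont (F b) x \<longrightarrow> (\<lambda>n. f b (r n) x) \<longlonglongrightarrow> F b x))"
  proof (rule Helly_selection_family)
    show "finite I" by (simp add: I_def)
    fix b n x assume b: "b \<in> I"
    show "continuous (at_right x) (f b n)"
      unfolding f_def[abs_def] by (intro continuous_add continuous_inner Wr gr continuous_const)
    show "mono (f b n)"
    proof (rule monoI)
      fix s t :: real assume "s \<le> t"
      then have "\<bar>(g n t - g n s) \<bullet> b\<bar> \<le> W n t - W n s"
        using gbb[OF b, of "g n t - g n s"] var[of s t n] by linarith
      then show "f b n s \<le> f b n t"
        by (simp add: f_def inner_diff_left)
    qed
    show "\<bar>f b n x\<bar> \<le> 2 * B"
      using gbb[OF b, of "g n x"] gb[of n x] Wb[of n x] by (simp add: f_def)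
  qed
  then obtain r F where r: "strict_mono (r :: nat \<Rightarrow> nat)" and F: "\<And>b x. b \<in> I \<Longrightarrow> continuous (at_right x) (F b)"
      "\<And>b. b \<in> I \<Longrightarrow> mono (F b)" "\<And>b x. b \<in> I \<Longrightarrow> \<bar>F b x\<bar> \<le> 2 * B"
      "\<And>b x. b \<in> I \<Longrightarrow> isCont (F b) x \<Longrightarrow> (\<lambda>n. f b (r n) x) \<longlonglongrightarrow> F b x"
    by blast
  have I: "0 \<in> I" "\<And>b. b \<in> Basis \<Longrightarrow> b \<in> I"
    by (auto simp: I_def)
  define T where "T x = (\<Sum>b\<in>Basis. (F b x - F 0 x) *\<^sub>R b)" for x
  have Tb: "T x \<bullet> b = F b x - F 0 x" if "b \<in> Basis" for x b
    using that by (simp add: T_def)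
  define E where "E = (\<Union>b\<in>I. {x. \<not> isCont (F b) x})"
  have "countable E"
    unfolding E_def by (intro countable_UN mono_ctble_discont F(2)) (auto simp: I_def intro: countable_finite)
  have lim0: "(\<lambda>n. W (r n) x) \<longlonglongrightarrow> F 0 x" if "isCont (F 0) x" for x
    using F(4)[OF I(1) that] by (simp add: f_def)
  have limg: "(\<lambda>n. g (r n) x) \<longlonglongrightarrow> T x" if "\<And>b. b \<in> I \<Longrightarrow> isCont (F b) x" for x
  proof (rule tendsto_componentwise_iff[THEN iffD2], intro ballI)
    fix b :: 'a assume b: "b \<in> Basis"
    have "(\<lambda>n. f b (r n) x - W (r n) x) \<longlonglongrightarrow> F b x - F 0 x"
      by (intro tendsto_diff F(4) lim0 that I b)
    then show "(\<lambda>n. g (r n) x \<bullet> b) \<longlonglongrightarrow> T x \<bullet> b"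
      using Tb[OF b] by (simp add: f_def)
  qed
  have E: "isCont (F b) x" if "x \<notin> E" "b \<in> I" for x b
    using that by (auto simp: E_def)
  have Tr: "continuous (at_right x) T" for x
    unfolding T_def[abs_def] by (intro continuous_sum continuous_scaleR continuous_diff F(1) I continuous_const)
  \<comment> \<open>The estimate passes to the limit at points outside \<open>E\<close>; approaching
    \<open>s\<close> and \<open>t\<close> from the right through such points gives it in
    general.\<close>
  have Tvar: "norm (T t - T s) \<le> F 0 t - F 0 s" if "s \<le> t" for s t
  proof (cases "s = t")
    case False
    obtain \<sigma> where \<sigma>: "\<And>k. \<sigma> k \<notin> E" "filterlim \<sigma> (at_right s) sequentially"
      using ex_sequence_from_right[OF \<open>countable E\<close>, where s=s] by blast
    obtain \<tau> where \<tau>: "\<And>k. \<tau> k \<notin> E" "filterlim \<tau> (at_right t) sequentially"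
      using ex_sequence_from_right[OF \<open>countable E\<close>, where s=t] by blast
    have lims: "(\<lambda>k. T (\<sigma> k)) \<longlonglongrightarrow> T s" "(\<lambda>k. T (\<tau> k)) \<longlonglongrightarrow> T t"
      "(\<lambda>k. F 0 (\<sigma> k)) \<longlonglongrightarrow> F 0 s" "(\<lambda>k. F 0 (\<tau> k)) \<longlonglongrightarrow> F 0 t"
      using Tr F(1)[OF I(1)] \<sigma>(2) \<tau>(2) unfolding continuous_within by (auto intro: filterlim_compose)
    have "\<sigma> \<longlonglongrightarrow> s" "\<forall>\<^sub>F k in sequentially. t < \<tau> k"
      using \<sigma>(2) \<tau>(2) unfolding filterlim_at by (auto elim: eventually_mono)
    moreover have "s < t"
      using that False by simp
    ultimately have "\<forall>\<^sub>F k in sequentially. \<sigma> k \<le> \<tau> k"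
      using order_tendstoD(2)[of \<sigma> s sequentially t] by (auto elim: eventually_elim2)
    then have "\<forall>\<^sub>F k in sequentially. norm (T (\<tau> k) - T (\<sigma> k)) \<le> F 0 (\<tau> k) - F 0 (\<sigma> k)"
    proof eventually_elim
      case (elim k)
      have "(\<lambda>n. norm (g (r n) (\<tau> k) - g (r n) (\<sigma> k))) \<longlonglongrightarrow> norm (T (\<tau> k) - T (\<sigma> k))"
        by (intro tendsto_norm tendsto_diff limg E \<sigma> \<tau>)
      moreover have "(\<lambda>n. W (r n) (\<tau> k) - W (r n) (\<sigma> k)) \<longlonglongrightarrow> F 0 (\<tau> k) - F 0 (\<sigma> k)"
        by (intro tendsto_diff lim0 E \<sigma> \<tau> I)
      ultimately show ?case
        by (rule LIMSEQ_le) (use var[OF elim] in blast)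
    qed
    then show ?thesis
      by (intro tendsto_le[OF sequentially_bot tendsto_diff[OF lims(4,3)] tendsto_norm[OF tendsto_diff[OF lims(2,1)]]])
  qed simp
  \<comment> \<open>Continuity of \<open>F 0\<close> at \<open>x\<close> is enough: \<open>T\<close>
    inherits it from the variation bound, and then so does every \<open>F b\<close>, being the sum
    of \<open>F 0\<close> and a component of \<open>T\<close>.\<close>
  have "(\<lambda>n. g (r n) x) \<longlonglongrightarrow> T x" if x: "isCont (F 0) x" for x
  proof (rule limg)
    fix b assume "b \<in> I"
    have "isCont T x"
      by (rule continuous_variation_bound[OF Tvar x])
    then have "isCont (\<lambda>x. F 0 x + T x \<bullet> b) x"
      using x by (intro continuous_add continuous_inner continuous_const)
    moreover have "(\<lambda>x. F 0 x + T x \<bullet> b) = F b"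
      using \<open>b \<in> I\<close> Tb by (auto simp: I_def)
    ultimately show "isCont (F b) x" by simp
  qed
  then show ?thesis
    using that[of r "F 0" T] r F[OF I(1)] Tvar by blast
qed

section \<open>Angles for circle-valued functions of bounded variation\<close>

lemma arcsin_half_lipschitz:
  assumes "\<bar>x\<bar> \<le> 1 / 2" "\<bar>y\<bar> \<le> 1 / 2"
  shows "\<bar>arcsin x - arcsin y\<bar> \<le> 2 * \<bar>x - y\<bar>"
proof -
  have "norm (arcsin x - arcsin y) \<le> 2 * norm (x - y)"
  proof (rule field_differentiable_bound[of "{-(1/2)..1/2}" arcsin "\<lambda>z. inverse (sqrt (1 - z\<^sup>2))"])
    fix z :: real assume z: "z \<in> {-(1/2)..1/2}"
    show "(arcsin has_field_derivative inverse (sqrt (1 - z\<^sup>2))) (at z within {-(1/2)..1/2})"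
      using z by (intro DERIV_subset[OF DERIV_arcsin]) auto
    have "z\<^sup>2 \<le> (1/2)\<^sup>2"
      using z by (intro power2_le_iff_abs_le[THEN iffD2]) auto
    then have "1 / 4 \<le> 1 - z\<^sup>2"
      by (simp add: power2_eq_square)
    then have "sqrt (1 / 4) \<le> sqrt (1 - z\<^sup>2)"
      by (rule real_sqrt_le_mono)
    then have "1 / 2 \<le> sqrt (1 - z\<^sup>2)"
      by (simp add: real_sqrt_divide)
    then show "norm (inverse (sqrt (1 - z\<^sup>2))) \<le> 2"
      using le_imp_inverse_le[of "1/2" "sqrt (1 - z\<^sup>2)"] by simp
  qed (use assms in \<open>auto simp: abs_le_iff\<close>)
  then show ?thesis by simp
qed

text \<open>
  The classes of equal \<open>\<lfloor>4 V\<rfloor>\<close> are finitely many intervals on which \<open>(a, b)\<close> stays close to one point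
  of the circle, so that \<open>arcsin\<close> provides a Lipschitz branch of the angle on each of them.
\<close>

lemma circle_lifting:
  fixes a b V :: "real \<Rightarrow> real"
  assumes V: "mono V" and circle: "\<And>s. s \<in> I \<Longrightarrow> (a s)\<^sup>2 + (b s)\<^sup>2 = 1"
    and a: "\<And>s t. s \<in> I \<Longrightarrow> t \<in> I \<Longrightarrow> s \<le> t \<Longrightarrow> \<bar>a t - a s\<bar> \<le> V t - V s"
    and b: "\<And>s t. s \<in> I \<Longrightarrow> t \<in> I \<Longrightarrow> s \<le> t \<Longrightarrow> \<bar>b t - b s\<bar> \<le> V t - V s"
  obtains \<Theta> where "\<And>s. s \<in> I \<Longrightarrow> a s = cos (\<Theta> s) \<and> b s = sin (\<Theta> s)"
    "\<And>s t. s \<in> I \<Longrightarrow> t \<in> I \<Longrightarrow> s \<le> t \<Longrightarrow> \<bar>\<Theta> t - \<Theta> s\<bar> \<le>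
      (4 * V t + 16 * real_of_int \<lfloor>4 * V t\<rfloor>) - (4 * V s + 16 * real_of_int \<lfloor>4 * V s\<rfloor>)"
proof -
  define k where "k s = \<lfloor>4 * V s\<rfloor>" for s
  define p where "p j = (SOME s. s \<in> I \<and> k s = j)" for j
  have p: "p (k s) \<in> I \<and> k (p (k s)) = k s" if "s \<in> I" for s
    unfolding p_def by (rule someI[of _ s]) (simp add: that)
  define \<alpha> where "\<alpha> j = (SOME x. 0 \<le> x \<and> x < 2 * pi \<and> a (p j) = cos x \<and> b (p j) = sin x)" for j
  have \<alpha>: "0 \<le> \<alpha> (k s) \<and> \<alpha> (k s) < 2 * pi \<and> a (p (k s)) = cos (\<alpha> (k s)) \<and> b (p (k s)) = sin (\<alpha> (k s))" if "s \<in> I" for s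
    unfolding \<alpha>_def by (rule someI_ex) (use sincos_total_2pi[OF circle[OF conjunct1[OF p[OF that]]]] in metis)
  \<comment> \<open>The sine of the angle from the reference point of the class to
    \<open>(a s, b s)\<close>.\<close>
  define w where "w s = b s * a (p (k s)) - a s * b (p (k s))" for s
  have near: "\<bar>a s - a t\<bar> \<le> 1 / 4" "\<bar>b s - b t\<bar> \<le> 1 / 4" if "s \<in> I" "t \<in> I" "k s = k t" for s t
  proof -
    have "\<bar>4 * V s - 4 * V t\<bar> < 1"
      using \<open>k s = k t\<close> unfolding k_def by linarith
    then have "\<bar>V s - V t\<bar> \<le> 1 / 4" by linarith
    moreover have "\<bar>f s - f t\<bar> \<le> \<bar>V s - V t\<bar>"
      if f: "\<And>s t. s \<in> I \<Longrightarrow> t \<in> I \<Longrightarrow> s \<le> t \<Longrightarrow> \<bar>f t - f s\<bar> \<le> V t - V s" for f :: "real \<Rightarrow> real"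
    proof (cases "s \<le> t")
      case True
      show ?thesis
        using f[OF \<open>s \<in> I\<close> \<open>t \<in> I\<close> True] by linarith
    next
      case False
      then have "\<bar>f s - f t\<bar> \<le> V s - V t"
        by (intro f \<open>s \<in> I\<close> \<open>t \<in> I\<close>) simp
      then show ?thesis by linarith
    qed
    from this[OF a] this[OF b]
    have "\<bar>a s - a t\<bar> \<le> \<bar>V s - V t\<bar>" "\<bar>b s - b t\<bar> \<le> \<bar>V s - V t\<bar>"
      by simp_all
    ultimately show "\<bar>a s - a t\<bar> \<le> 1 / 4" "\<bar>b s - b t\<bar> \<le> 1 / 4"
      by linarith+
  qed
  have le1: "\<bar>a s\<bar> \<le> 1" "\<bar>b s\<bar> \<le> 1" if "s \<in> I" for s
  proof -
    have "(a s)\<^sup>2 \<le> 1" "(b s)\<^sup>2 \<le> 1"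
      using circle[OF that] zero_le_power2[of "a s"] zero_le_power2[of "b s"] by linarith+
    then show "\<bar>a s\<bar> \<le> 1" "\<bar>b s\<bar> \<le> 1"
      by (simp_all add: abs_square_le_1)
  qed
  have w: "\<bar>w s\<bar> \<le> 1 / 2" if "s \<in> I" for s
  proof -
    let ?q = "p (k s)"
    have q: "?q \<in> I" "k s = k ?q"
      using p[OF that] by auto
    have "w s = (b s - b ?q) * a ?q - (a s - a ?q) * b ?q"
      by (simp add: w_def algebra_simps)
    then have "\<bar>w s\<bar> \<le> \<bar>b s - b ?q\<bar> * \<bar>a ?q\<bar> + \<bar>a s - a ?q\<bar> * \<bar>b ?q\<bar>"
      by (metis abs_mult abs_triangle_ineq4)
    also have "\<dots> \<le> 1 / 4 * 1 + 1 / 4 * 1"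
      using near[OF that q] le1[OF q(1)] by (intro add_mono mult_mono) auto
    finally show ?thesis by simp
  qed
  define \<Theta> where "\<Theta> s = \<alpha> (k s) + arcsin (w s)" for s
  have eq: "a s = cos (\<Theta> s) \<and> b s = sin (\<Theta> s)" if "s \<in> I" for s
  proof -
    let ?q = "p (k s)"
    have q: "?q \<in> I" "k s = k ?q"
      using p[OF that] by auto
    \<comment> \<open>The cosine of the same angle. The two points being close makes it nonnegative,
      so \<open>arcsin (w s)\<close> is the angle itself.\<close>
    define c where "c = a s * a ?q + b s * b ?q"
    have c1: "c\<^sup>2 + (w s)\<^sup>2 = ((a s)\<^sup>2 + (b s)\<^sup>2) * ((a ?q)\<^sup>2 + (b ?q)\<^sup>2)"
      unfolding c_def w_def by algebra
    have c2: "2 * c = ((a s)\<^sup>2 + (b s)\<^sup>2) + ((a ?q)\<^sup>2 + (b ?q)\<^sup>2) - ((a s - a ?q)\<^sup>2 + (b s - b ?q)\<^sup>2)"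
      unfolding c_def by algebra
    have "(a s - a ?q)\<^sup>2 \<le> 1" "(b s - b ?q)\<^sup>2 \<le> 1"
      using near[OF that q] by (auto simp: abs_square_le_1)
    then have "0 \<le> c"
      using c2 circle[OF that] circle[OF q(1)] by linarith
    have "c\<^sup>2 = 1 - (w s)\<^sup>2"
      using c1 circle[OF that] circle[OF q(1)] by simp
    then have "cos (arcsin (w s)) = c"
      using w[OF that] \<open>0 \<le> c\<close> by (subst cos_arcsin) (auto simp: real_sqrt_unique)
    moreover have "sin (arcsin (w s)) = w s"
      using w[OF that] by (intro sin_arcsin) auto
    ultimately have "cos (\<Theta> s) = a ?q * c - b ?q * w s" "sin (\<Theta> s) = b ?q * c + a ?q * w s"
      using \<alpha>[OF that] by (simp_all add: \<Theta>_def cos_add sin_add)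
    moreover have "a ?q * c - b ?q * w s = a s * ((a ?q)\<^sup>2 + (b ?q)\<^sup>2)" "b ?q * c + a ?q * w s = b s * ((a ?q)\<^sup>2 + (b ?q)\<^sup>2)"
      unfolding c_def w_def by algebra+
    ultimately show ?thesis
      using circle[OF q(1)] by simp
  qed
  have var: "\<bar>\<Theta> t - \<Theta> s\<bar> \<le> (4 * V t + 16 * real_of_int (k t)) - (4 * V s + 16 * real_of_int (k s))"
    if st: "s \<in> I" "t \<in> I" "s \<le> t" for s t
  proof (cases "k s = k t")
    case True
    let ?q = "p (k s)"
    have q: "?q \<in> I"
      using p[OF st(1)] by auto
    have "w t - w s = (b t - b s) * a ?q - (a t - a s) * b ?q"
      unfolding w_def True by algebra
    then have "\<bar>w t - w s\<bar> \<le> \<bar>b t - b s\<bar> * \<bar>a ?q\<bar> + \<bar>a t - a s\<bar> * \<bar>b ?q\<bar>"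
      by (metis abs_mult abs_triangle_ineq4)
    also have "\<dots> \<le> (V t - V s) * 1 + (V t - V s) * 1"
      using a[OF st] b[OF st] le1[OF q] by (intro add_mono mult_mono) auto
    finally have "\<bar>w t - w s\<bar> \<le> 2 * (V t - V s)" by simp
    then have "2 * \<bar>w t - w s\<bar> \<le> 4 * (V t - V s)" by simp
    then have "\<bar>arcsin (w t) - arcsin (w s)\<bar> \<le> 4 * (V t - V s)"
      by (rule order_trans[OF arcsin_half_lipschitz[OF w[OF st(2)] w[OF st(1)]]])
    then show ?thesis
      using True by (simp add: \<Theta>_def)
  next
    case False
    have Vst: "V s \<le> V t"
      using V st(3) by (simp add: mono_def)
    then have "k s \<le> k t"
      unfolding k_def by (intro floor_mono) simp
    then have kst: "real_of_int (k s) + 1 \<le> real_of_int (k t)"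
      using False by linarith
    \<comment> \<open>Across classes the values of \<open>\<Theta>\<close> are compared only through
      this range, \<open>\<alpha>\<close> being below 8. Its width 10 is covered by the factor 16,
      because the floor grows by at least 1.\<close>
    have range: "-1 \<le> \<Theta> x \<and> \<Theta> x \<le> 9" if "x \<in> I" for x
    proof -
      have "\<bar>arcsin (w x)\<bar> \<le> 1"
        using arcsin_half_lipschitz[OF w[OF that], of 0] w[OF that] by simp
      then show ?thesis
        using \<alpha>[OF that] pi_less_4 unfolding \<Theta>_def by linarith
    qed
    have "\<bar>\<Theta> t - \<Theta> s\<bar> \<le> 16"
      using range[OF st(1)] range[OF st(2)] by (simp add: abs_le_iff)
    also have "\<dots> \<le> (4 * V t + 16 * real_of_int (k t)) - (4 * V s + 16 * real_of_int (k s))"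
      using Vst kst by (simp add: algebra_simps)
    finally show ?thesis .
  qed
  show ?thesis
    using that[of \<Theta>] eq var unfolding k_def by blast
qed

subsection \<open>Weak derivatives\<close>

lemma integrable_bounded_interval:
  fixes f :: "real \<Rightarrow> 'a::euclidean_space"
  assumes "f \<in> borel_measurable (lebesgue_on {a<..<b})" and "\<And>s. s \<in> {a<..<b} \<Longrightarrow> norm (f s) \<le> K"
  shows "integrable (lebesgue_on {a<..<b}) f"
proof -
  interpret finite_measure "lebesgue_on {a<..<b}"
    by (rule finite_measure_lebesgue_on) (simp add: lmeasurable_open)
  show ?thesis
    by (rule integrable_const_bound[of _ K]) (use assms in \<open>auto intro!: AE_I2\<close>)
qed

text \<open>The support is enclosed in an interval with endpoints strictly inside
  \<open>(a, b)\<close>, so that the function and its derivative vanish at these endpoints too and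
  boundary terms disappear.\<close>

lemma test_fun_props:
  assumes "test_fun a b \<eta>" and "a < b"
  obtains p q B where "a < p" "p < q" "q < b" "\<And>s. s \<notin> {p<..<q} \<Longrightarrow> \<eta> s = 0" "\<And>s. s \<notin> {p<..<q} \<Longrightarrow> deriv \<eta> s = 0"
    "\<And>s. (\<eta> has_real_derivative deriv \<eta> s) (at s)" "continuous_on UNIV \<eta>" "continuous_on UNIV (deriv \<eta>)"
    "\<And>s. \<bar>\<eta> s\<bar> \<le> B" "\<And>s. \<bar>deriv \<eta> s\<bar> \<le> B"
proof -
  obtain K where K: "compact K" "K \<subseteq> {a<..<b}" "\<And>s. s \<notin> K \<Longrightarrow> \<eta> s = 0" and C1: "\<eta> C1_differentiable_on UNIV"
    using assms(1) unfolding test_fun_def by blast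
  obtain D where D: "\<And>s. (\<eta> has_vector_derivative D s) (at s)" "continuous_on UNIV D"
    using C1 unfolding C1_differentiable_on_def by auto
  have DD: "(\<eta> has_real_derivative D s) (at s)" for s
    using D(1) by (simp add: has_real_derivative_iff_has_vector_derivative)
  then have dD: "deriv \<eta> = D"
    by (auto intro: DERIV_imp_deriv)
  \<comment> \<open>The midpoint is inserted because \<open>K\<close> may be empty.\<close>
  define K' where "K' = insert ((a + b) / 2) K"
  have K': "compact K'" "K' \<noteq> {}" "K' \<subseteq> {a<..<b}"
    using K(1,2) \<open>a < b\<close> by (auto simp: K'_def compact_insert)
  obtain lo where lo: "lo \<in> K'" "\<And>x. x \<in> K' \<Longrightarrow> lo \<le> x"
    using compact_attains_inf[OF K'(1,2)] by blast
  obtain hi where hi: "hi \<in> K'" "\<And>x. x \<in> K' \<Longrightarrow> x \<le> hi"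
    using compact_attains_sup[OF K'(1,2)] by blast
  define p where "p = (a + lo) / 2"
  define q where "q = (hi + b) / 2"
  have "a < lo" "hi < b" "lo \<le> hi"
    using lo hi K'(3) by auto
  then have pq: "a < p" "p < lo" "hi < q" "q < b" "p < q"
    by (auto simp: p_def q_def field_simps)
  have zero: "\<eta> s = 0" if "s < lo \<or> hi < s" for s
  proof -
    have "s \<notin> K'"
      using lo(2)[of s] hi(2)[of s] that by force
    then show ?thesis
      using K(3) by (simp add: K'_def)
  qed
  have dzero: "D s = 0" if "s < lo \<or> hi < s" for s
  proof -
    have "open ({..<lo} \<union> {hi<..})" by auto
    moreover have "s \<in> {..<lo} \<union> {hi<..}"
      using that by auto
    ultimately have "(\<eta> has_real_derivative 0) (at s)"
      by (rule has_field_derivative_transform_within_open[OF DERIV_const, of _ _ 0]) (use zero in auto)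
    then show ?thesis
      using DD DERIV_unique by blast
  qed
  have ceta: "continuous_on UNIV \<eta>"
    using DD DERIV_isCont by (simp add: continuous_on_eq_continuous_at) blast
  have "bounded (\<eta> ` {p..q})" "bounded (D ` {p..q})"
    using ceta D(2) by (auto intro!: compact_imp_bounded compact_continuous_image intro: continuous_on_subset)
  then obtain B1 B2 where B1: "\<And>s. s \<in> {p..q} \<Longrightarrow> \<bar>\<eta> s\<bar> \<le> B1" and B2: "\<And>s. s \<in> {p..q} \<Longrightarrow> \<bar>D s\<bar> \<le> B2"
    unfolding bounded_iff by (metis imageI real_norm_def)
  have out: "\<eta> s = 0 \<and> D s = 0" if "s \<notin> {p<..<q}" for s
  proof -
    have "s < lo \<or> hi < s"
      using that pq by auto
    then show ?thesis
      using zero dzero by blast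
  qed
  have bound: "\<bar>\<eta> s\<bar> \<le> max B1 B2 \<and> \<bar>D s\<bar> \<le> max B1 B2" for s
  proof (cases "s \<in> {p..q}")
    case True
    then show ?thesis using B1[OF True] B2[OF True] by auto
  next
    case False
    then have "\<eta> s = 0" "D s = 0"
      using out[of s] by auto
    then show ?thesis
      using B1[of p] pq by auto
  qed
  show ?thesis
    by (rule that[of p q "max B1 B2"]) (use pq out bound DD ceta D(2) dD in auto)
qed

text \<open>The product with a test function vanishes at both ends, so its derivative integrates to
  0; the fundamental theorem tolerates the finitely many exceptional points of a continuous
  function.\<close>

lemma has_weak_deriv_ftc:
  fixes f g :: "real \<Rightarrow> 'a::euclidean_space"
  assumes "a < b" and "continuous_on {a..b} f" and "finite S"
    and deriv: "\<And>s. s \<in> {a<..<b} - S \<Longrightarrow> (f has_vector_derivative g s) (at s)"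
    and g: "g \<in> borel_measurable (lebesgue_on {a<..<b})" and gK: "\<And>s. s \<in> {a<..<b} \<Longrightarrow> norm (g s) \<le> K"
  shows "has_weak_deriv a b f g"
proof -
  have meas: "h \<in> borel_measurable (lebesgue_on {a<..<b})" if "continuous_on {a<..<b} h" for h :: "real \<Rightarrow> 'c::euclidean_space"
    using that by (intro continuous_imp_measurable_on_sets_lebesgue) auto
  have fm: "f \<in> borel_measurable (lebesgue_on {a<..<b})"
    using assms(2) by (intro meas continuous_on_subset[OF assms(2)]) auto
  obtain F where F: "\<And>s. s \<in> {a..b} \<Longrightarrow> norm (f s) \<le> F"
    using compact_imp_bounded[OF compact_continuous_image[OF assms(2) compact_Icc]] unfolding bounded_iff by (metis imageI)
  have if_: "integrable (lebesgue_on {a<..<b}) f"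
    by (rule integrable_bounded_interval[OF fm, of F]) (use F in auto)
  moreover have ig: "integrable (lebesgue_on {a<..<b}) g"
    by (rule integrable_bounded_interval[OF g gK])
  moreover have "(LINT s|lebesgue_on {a<..<b}. deriv \<eta> s *\<^sub>R f s) = - (LINT s|lebesgue_on {a<..<b}. \<eta> s *\<^sub>R g s)"
    if tf: "test_fun a b \<eta>" for \<eta>
  proof -
    obtain p q B where \<eta>: "a < p" "p < q" "q < b" "\<And>s. s \<notin> {p<..<q} \<Longrightarrow> \<eta> s = 0" "\<And>s. s \<notin> {p<..<q} \<Longrightarrow> deriv \<eta> s = 0"
      "\<And>s. (\<eta> has_real_derivative deriv \<eta> s) (at s)" "continuous_on UNIV \<eta>" "continuous_on UNIV (deriv \<eta>)"
      "\<And>s. \<bar>\<eta> s\<bar> \<le> B" "\<And>s. \<bar>deriv \<eta> s\<bar> \<le> B"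
      using test_fun_props[OF tf \<open>a < b\<close>] by blast
    have \<eta>m: "\<eta> \<in> borel_measurable (lebesgue_on {a<..<b})" "deriv \<eta> \<in> borel_measurable (lebesgue_on {a<..<b})"
      using \<eta>(7,8) continuous_on_subset by (auto intro!: meas)
    have "0 \<le> B"
      using \<eta>(9)[of 0] by linarith
    have i1: "integrable (lebesgue_on {a<..<b}) (\<lambda>s. deriv \<eta> s *\<^sub>R f s)"
    proof (rule integrable_bounded_interval[of _ _ _ "B * F"])
      show "norm (deriv \<eta> s *\<^sub>R f s) \<le> B * F" if "s \<in> {a<..<b}" for s
        using \<eta>(10)[of s] F[of s] that \<open>0 \<le> B\<close> by (auto intro!: mult_mono)
    qed (intro borel_measurable_scaleR \<eta>m fm)
    have i2: "integrable (lebesgue_on {a<..<b}) (\<lambda>s. \<eta> s *\<^sub>R g s)"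
    proof (rule integrable_bounded_interval[of _ _ _ "B * K"])
      show "norm (\<eta> s *\<^sub>R g s) \<le> B * K" if "s \<in> {a<..<b}" for s
        using \<eta>(9)[of s] gK[OF that] \<open>0 \<le> B\<close> by (auto intro!: mult_mono)
    qed (intro borel_measurable_scaleR \<eta>m g)
    have "((\<lambda>s. \<eta> s *\<^sub>R g s + deriv \<eta> s *\<^sub>R f s) has_integral (\<eta> b *\<^sub>R f b - \<eta> a *\<^sub>R f a)) {a..b}"
    proof (rule fundamental_theorem_of_calculus_interior_strong[OF \<open>finite S\<close>])
      show "((\<lambda>s. \<eta> s *\<^sub>R f s) has_vector_derivative \<eta> s *\<^sub>R g s + deriv \<eta> s *\<^sub>R f s) (at s)" if "s \<in> {a<..<b} - S" for s
        by (rule has_vector_derivative_scaleR[OF \<eta>(6) deriv[OF that]])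
      show "continuous_on {a..b} (\<lambda>s. \<eta> s *\<^sub>R f s)"
        by (intro continuous_on_scaleR assms(2) continuous_on_subset[OF \<eta>(7)]) auto
    qed (use \<open>a < b\<close> in simp)
    moreover have "\<eta> b *\<^sub>R f b - \<eta> a *\<^sub>R f a = 0"
      using \<eta>(1-4) by simp
    ultimately have "((\<lambda>s. \<eta> s *\<^sub>R g s + deriv \<eta> s *\<^sub>R f s) has_integral 0) {a<..<b}"
      by (simp add: has_integral_Icc_iff_Ioo)
    moreover have "((\<lambda>s. \<eta> s *\<^sub>R g s + deriv \<eta> s *\<^sub>R f s) has_integral
        ((LINT s|lebesgue_on {a<..<b}. \<eta> s *\<^sub>R g s) + (LINT s|lebesgue_on {a<..<b}. deriv \<eta> s *\<^sub>R f s))) {a<..<b}"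
      by (intro has_integral_add has_integral_integral_lebesgue_on i1 i2) auto
    ultimately have "(LINT s|lebesgue_on {a<..<b}. \<eta> s *\<^sub>R g s) + (LINT s|lebesgue_on {a<..<b}. deriv \<eta> s *\<^sub>R f s) = 0"
      using has_integral_unique by blast
    then show ?thesis
      by (simp add: eq_neg_iff_add_eq_0 add.commute)
  qed
  ultimately show ?thesis
    unfolding has_weak_deriv_def by blast
qed

text \<open>Both sides of the integration by parts formula pass to the limit by dominated
  convergence, a constant being an integrable majorant on a bounded interval.\<close>

lemma has_weak_deriv_limit:
  fixes f g :: "nat \<Rightarrow> real \<Rightarrow> 'a::euclidean_space"
  assumes "a < b" and wd: "\<And>n. has_weak_deriv a b (f n) (g n)"
    and fK: "\<And>n s. s \<in> {a<..<b} \<Longrightarrow> norm (f n s) \<le> K" and gK: "\<And>n s. s \<in> {a<..<b} \<Longrightarrow> norm (g n s) \<le> K"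
    and flim: "AE s in lebesgue_on {a<..<b}. (\<lambda>n. f n s) \<longlonglongrightarrow> F s" and glim: "AE s in lebesgue_on {a<..<b}. (\<lambda>n. g n s) \<longlonglongrightarrow> G s"
    and Fm: "F \<in> borel_measurable (lebesgue_on {a<..<b})" and Gm: "G \<in> borel_measurable (lebesgue_on {a<..<b})"
  shows "has_weak_deriv a b F G"
proof -
  let ?M = "lebesgue_on {a<..<b}"
  interpret finite_measure ?M
    by (rule finite_measure_lebesgue_on) (simp add: lmeasurable_open)
  have if_: "integrable ?M (f n)" and ig: "integrable ?M (g n)" for n
    using wd unfolding has_weak_deriv_def by blast+
  have dom: "integrable ?M Q \<and> (\<lambda>n. LINT s|?M. \<eta> s *\<^sub>R q n s) \<longlonglongrightarrow> (LINT s|?M. \<eta> s *\<^sub>R Q s)"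
    if Q: "Q \<in> borel_measurable ?M" and q: "\<And>n. q n \<in> borel_measurable ?M" and lim: "AE s in ?M. (\<lambda>n. q n s) \<longlonglongrightarrow> Q s"
      and qK: "\<And>n s. s \<in> {a<..<b} \<Longrightarrow> norm (q n s) \<le> K" and \<eta>: "\<eta> \<in> borel_measurable ?M" and B: "\<And>s. \<bar>\<eta> s\<bar> \<le> B"
    for q :: "nat \<Rightarrow> real \<Rightarrow> 'a" and Q \<eta> B
  proof
    have qK': "AE s in ?M. norm (q n s) \<le> K" for n
      using qK by (auto intro!: AE_I2)
    show "integrable ?M Q"
      by (rule integrable_dominated_convergence[where s=q and w="\<lambda>s. K"]) (use Q q lim qK' in auto)
    show "(\<lambda>n. LINT s|?M. \<eta> s *\<^sub>R q n s) \<longlonglongrightarrow> (LINT s|?M. \<eta> s *\<^sub>R Q s)"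
    proof (rule integral_dominated_convergence[where w="\<lambda>s. \<bar>B\<bar> * \<bar>K\<bar>"])
      show "AE s in ?M. (\<lambda>n. \<eta> s *\<^sub>R q n s) \<longlonglongrightarrow> \<eta> s *\<^sub>R Q s"
        using lim by eventually_elim (intro tendsto_scaleR tendsto_const)
      show "AE s in ?M. norm (\<eta> s *\<^sub>R q n s) \<le> \<bar>B\<bar> * \<bar>K\<bar>" for n
        using qK'[of n]
      proof eventually_elim
        case (elim s)
        have "\<bar>\<eta> s\<bar> \<le> \<bar>B\<bar>" "norm (q n s) \<le> \<bar>K\<bar>"
          using B[of s] elim by linarith+
        then have "\<bar>\<eta> s\<bar> * norm (q n s) \<le> \<bar>B\<bar> * \<bar>K\<bar>"
          by (intro mult_mono) auto
        then show ?case by simp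
      qed
    qed (use Q q \<eta> in auto)
  qed
  have fm: "f n \<in> borel_measurable ?M" and gm: "g n \<in> borel_measurable ?M" for n
    using if_ ig by auto
  have meas: "h \<in> borel_measurable ?M" if "continuous_on UNIV h" for h :: "real \<Rightarrow> real"
    using continuous_on_subset[OF that] by (intro continuous_imp_measurable_on_sets_lebesgue) auto
  have one: "(\<lambda>_. 1) \<in> borel_measurable ?M" by simp
  have "integrable ?M F" "integrable ?M G"
    using dom[OF Fm fm flim fK one, of 1] dom[OF Gm gm glim gK one, of 1] by auto
  moreover have "(LINT s|?M. deriv \<eta> s *\<^sub>R F s) = - (LINT s|?M. \<eta> s *\<^sub>R G s)" if tf: "test_fun a b \<eta>" for \<eta>
  proof -
    obtain p q B where "a < p" "p < q" "q < b" "\<And>s. s \<notin> {p<..<q} \<Longrightarrow> \<eta> s = 0" "\<And>s. s \<notin> {p<..<q} \<Longrightarrow> deriv \<eta> s = 0"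
      "\<And>s. (\<eta> has_real_derivative deriv \<eta> s) (at s)" and \<eta>: "continuous_on UNIV \<eta>" "continuous_on UNIV (deriv \<eta>)"
      "\<And>s. \<bar>\<eta> s\<bar> \<le> B" "\<And>s. \<bar>deriv \<eta> s\<bar> \<le> B"
      using test_fun_props[OF tf \<open>a < b\<close>] by blast
    have "(\<lambda>n. LINT s|?M. deriv \<eta> s *\<^sub>R f n s) \<longlonglongrightarrow> (LINT s|?M. deriv \<eta> s *\<^sub>R F s)"
      using dom[OF Fm fm flim fK meas[OF \<eta>(2)] \<eta>(4)] by blast
    moreover have "(\<lambda>n. - (LINT s|?M. \<eta> s *\<^sub>R g n s)) \<longlonglongrightarrow> - (LINT s|?M. \<eta> s *\<^sub>R G s)"
      using dom[OF Gm gm glim gK meas[OF \<eta>(1)] \<eta>(3)] by (intro tendsto_minus) blast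
    moreover have "(LINT s|?M. deriv \<eta> s *\<^sub>R f n s) = - (LINT s|?M. \<eta> s *\<^sub>R g n s)" for n
      using wd tf unfolding has_weak_deriv_def by blast
    ultimately show ?thesis
      using LIMSEQ_unique by simp
  qed
  ultimately show ?thesis
    unfolding has_weak_deriv_def by blast
qed

section \<open>Uniqueness of the weak derivative\<close>

text \<open>A continuously differentiable \<open>w\<close> that is positive exactly on
  \<open>(p, q)\<close> is turned into \<open>w / (w + 1 / (n + 1))\<close>, which tends to 1 where
  \<open>w\<close> is positive and is 0 elsewhere.\<close>

lemma test_fun_approx_indicator:
  assumes "a < p" "p < q" "q < b"
  obtains \<eta> :: "nat \<Rightarrow> real \<Rightarrow> real" where "\<And>n. test_fun a b (\<eta> n)" "\<And>n s. \<bar>\<eta> n s\<bar> \<le> 1"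
    "\<And>s. (\<lambda>n. \<eta> n s) \<longlonglongrightarrow> indicator {p<..<q} s"
proof -
  \<comment> \<open>The square of the positive part is still differentiable at 0, with continuous
    derivative.\<close>
  define k :: "real \<Rightarrow> real" where "k x = (max 0 x)\<^sup>2" for x
  have dk: "(k has_real_derivative 2 * max 0 x) (at x)" for x
  proof -
    consider "x < 0" | "x > 0" | "x = 0" by linarith
    then show ?thesis
    proof cases
      case 1
      have "(k has_real_derivative 0) (at x)"
        by (rule has_field_derivative_transform_within_open[OF DERIV_const open_lessThan, of _ 0 0]) (use 1 in \<open>auto simp: k_def\<close>)
      then show ?thesis using 1 by simp
    next
      case 2
      have "((\<lambda>x. x\<^sup>2) has_real_derivative 2 * x) (at x)"
        by (auto intro!: derivative_eq_intros)
      then have "(k has_real_derivative 2 * x) (at x)"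
        by (rule has_field_derivative_transform_within_open[OF _ open_greaterThan, of _ _ _ 0]) (use 2 in \<open>auto simp: k_def\<close>)
      then show ?thesis using 2 by simp
    next
      case 3
      have "((\<lambda>h. \<bar>h\<bar>) \<longlongrightarrow> 0) (at (0::real))"
        using tendsto_rabs[OF tendsto_ident_at[of 0 UNIV]] by simp
      then have "((\<lambda>h. (k (0 + h) - k 0) / h) \<longlongrightarrow> 0) (at 0)"
      proof (rule Lim_null_comparison[rotated])
        show "\<forall>\<^sub>F h in at 0. norm ((k (0 + h) - k 0) / h) \<le> \<bar>h\<bar>"
          by (rule always_eventually) (auto simp: k_def max_def power2_eq_square)
      qed
      then show ?thesis
        using 3 by (simp add: DERIV_def)
    qed
  qed
  define w where "w s = k (s - p) * k (q - s)" for s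
  define w' where "w' s = k (s - p) * (- 2 * max 0 (q - s)) + 2 * max 0 (s - p) * k (q - s)" for s
  have dw: "(w has_real_derivative w' s) (at s)" for s
  proof -
    have "((\<lambda>s. k (s - p)) has_real_derivative 2 * max 0 (s - p) * 1) (at s)"
      by (rule DERIV_chain2[OF dk]) (auto intro!: derivative_eq_intros)
    moreover have "((\<lambda>s. k (q - s)) has_real_derivative 2 * max 0 (q - s) * (-1)) (at s)"
      by (rule DERIV_chain2[OF dk]) (auto intro!: derivative_eq_intros)
    ultimately show ?thesis
      unfolding w_def[abs_def] w'_def by (auto intro!: derivative_eq_intros)
  qed
  have kc: "continuous_on UNIV k"
    by (rule DERIV_continuous_on) (rule dk)
  have w'c: "continuous_on UNIV w'"
    unfolding w'_def[abs_def] k_def by (intro continuous_intros)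
  have wc: "continuous_on UNIV w"
    by (rule DERIV_continuous_on) (rule dw)
  have w0: "0 \<le> w s" for s
    by (simp add: w_def k_def)
  define \<eta> where "\<eta> n s = w s / (w s + inverse (real (Suc n)))" for n s
  have pos: "0 < w s + inverse (real (Suc n))" for n s
    using w0[of s] by (intro add_nonneg_pos) auto
  have "test_fun a b (\<eta> n)" for n
    unfolding test_fun_def
  proof (intro conjI exI[of _ "{p..q}"])
    let ?d = "\<lambda>s. (w' s * (w s + inverse (real (Suc n))) - w s * w' s) / ((w s + inverse (real (Suc n))) * (w s + inverse (real (Suc n))))"
    have "(\<eta> n has_real_derivative ?d s) (at s)" for s
    proof -
      have *: "((\<lambda>s. w s + inverse (real (Suc n))) has_real_derivative w' s) (at s)"
        using DERIV_add[OF dw DERIV_const] by simp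
      show ?thesis
        unfolding \<eta>_def[abs_def] by (rule DERIV_divide[OF dw *]) (use pos[of s n] in simp)
    qed
    moreover have "continuous_on UNIV ?d"
    proof (intro continuous_on_divide continuous_on_diff continuous_on_mult continuous_on_add continuous_on_const wc w'c ballI)
      show "(w s + inverse (real (Suc n))) * (w s + inverse (real (Suc n))) \<noteq> 0" for s
        using pos[of s n] by simp
    qed
    ultimately show "\<eta> n C1_differentiable_on UNIV"
      unfolding C1_differentiable_on_def has_real_derivative_iff_has_vector_derivative
      by (intro exI[of _ ?d]) blast
    show "\<forall>s. s \<notin> {p..q} \<longrightarrow> \<eta> n s = 0"
      by (auto simp: \<eta>_def w_def k_def)
  qed (use assms in auto)
  moreover have "\<bar>\<eta> n s\<bar> \<le> 1" for n s
    using pos[of s n] w0[of s] by (simp add: \<eta>_def field_simps)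
  moreover have "(\<lambda>n. \<eta> n s) \<longlonglongrightarrow> indicator {p<..<q} s" for s
  proof (cases "s \<in> {p<..<q}")
    case True
    then have "0 < w s"
      by (simp add: w_def k_def)
    then have "(\<lambda>n. \<eta> n s) \<longlonglongrightarrow> w s / (w s + 0)"
      unfolding \<eta>_def by (intro tendsto_divide tendsto_add tendsto_const LIMSEQ_inverse_real_of_nat) simp
    then show ?thesis
      using True \<open>0 < w s\<close> by simp
  next
    case False
    then have "w s = 0"
      by (auto simp: w_def k_def)
    then show ?thesis
      using False by (simp add: \<eta>_def)
  qed
  ultimately show ?thesis
    using that by blast
qed

text \<open>Lebesgue differentiation: almost everywhere \<open>d s\<close> is the limit of the
  averages over short intervals to the right of \<open>s\<close>, and these averages vanish.\<close>

lemma null_interval_integrals_AE_zero: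
  fixes d :: "real \<Rightarrow> 'a::euclidean_space"
  assumes int: "integrable (lebesgue_on {a<..<b}) d"
    and zero: "\<And>p q. a < p \<Longrightarrow> p < q \<Longrightarrow> q < b \<Longrightarrow> integral {p..q} d = 0"
  shows "AE s in lebesgue_on {a<..<b}. d s = 0"
proof -
  define D where "D s = (if s \<in> {a<..<b} then d s else 0)" for s
  have "integrable lebesgue D"
    unfolding D_def[abs_def] by (subst Lebesgue_Measure.integrable_restrict_UNIV) (use int in auto)
  then have "D integrable_on UNIV"
    by (rule integrable_on_lebesgue)
  then have "D integrable_on cbox x y" for x y
    by (rule integrable_on_subcbox) simp
  then obtain N where N: "negligible N" and lim: "\<And>x e. x \<notin> N \<Longrightarrow> 0 < e \<Longrightarrow>
      \<exists>\<delta>>0. \<forall>h. 0 < h \<and> h < \<delta> \<longrightarrow> norm (integral (cbox x (x + h *\<^sub>R One)) D /\<^sub>R h ^ DIM(real) - D x) < e"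
    using integrable_ccontinuous_explicit[of D] by blast
  have "d s = 0" if s: "s \<in> {a<..<b}" "s \<notin> N" for s
  proof (rule ccontr)
    assume "d s \<noteq> 0"
    then obtain \<delta> where "0 < \<delta>" and \<delta>: "\<And>h. 0 < h \<Longrightarrow> h < \<delta> \<Longrightarrow>
        norm (integral (cbox s (s + h *\<^sub>R One)) D /\<^sub>R h ^ DIM(real) - D s) < norm (d s)"
      using lim[OF s(2), of "norm (d s)"] by auto
    define h where "h = min (\<delta> / 2) ((b - s) / 2)"
    have h: "0 < h" "h < \<delta>" "s + h < b"
      using \<open>0 < \<delta>\<close> s(1) by (auto simp: h_def min_def field_simps)
    have "integral (cbox s (s + h *\<^sub>R One)) D = integral {s..s + h} d"
      using s(1) h by (auto simp: D_def intro!: integral_cong)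
    also have "\<dots> = 0"
      using zero[of s "s + h"] s(1) h by simp
    finally show False
      using \<delta>[OF h(1,2)] s(1) by (simp add: D_def)
  qed
  moreover have "AE s in lebesgue. s \<notin> N"
    using N by (simp add: AE_not_in negligible_iff_null_sets)
  ultimately show ?thesis
    by (subst AE_restrict_space_iff) (auto elim: eventually_mono)
qed

text \<open>The difference of two weak derivatives is orthogonal to all test functions.
  Approximating indicators by these shows that its integral over every inner interval is 0.\<close>

lemma weak_deriv_unique:
  fixes f :: "real \<Rightarrow> 'a::euclidean_space"
  assumes "a < b" and g: "has_weak_deriv a b f g" and g': "has_weak_deriv a b f g'"
  shows "AE s in lebesgue_on {a<..<b}. g s = g' s"
proof -
  let ?M = "lebesgue_on {a<..<b}"
  have ints: "integrable ?M g" "integrable ?M g'"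
    using g g' unfolding has_weak_deriv_def by blast+
  define d where "d s = g s - g' s" for s
  have dint: "integrable ?M d"
    unfolding d_def[abs_def] using ints by (rule Bochner_Integration.integrable_diff)
  have meas: "\<eta> \<in> borel_measurable ?M" if "test_fun a b \<eta>" for \<eta>
  proof -
    have "continuous_on UNIV \<eta>"
      using that C1_diff_imp_diff differentiable_imp_continuous_on unfolding test_fun_def by blast
    then show ?thesis
      using continuous_on_subset by (intro continuous_imp_measurable_on_sets_lebesgue) auto
  qed
  have bdd: "integrable ?M (\<lambda>s. \<eta> s *\<^sub>R k s)"
    if k: "integrable ?M k" and \<eta>: "\<eta> \<in> borel_measurable ?M" "\<And>s. \<bar>\<eta> s\<bar> \<le> 1" for \<eta> and k :: "real \<Rightarrow> 'a"
  proof (rule Bochner_Integration.integrable_bound[OF k])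
    show "AE s in ?M. norm (\<eta> s *\<^sub>R k s) \<le> norm (k s)"
      using \<eta>(2) by (intro AE_I2) (simp add: mult_left_le_one_le)
  qed (use k \<eta>(1) in auto)
  have ioo: "{p<..<q} \<in> sets ?M" if "a < p" "p < q" "q < b" for p q
    using that by (subst sets_restrict_space_iff) auto
  have null: "(LINT s|?M. \<eta> s *\<^sub>R d s) = 0" if tf: "test_fun a b \<eta>" and le: "\<And>s. \<bar>\<eta> s\<bar> \<le> 1" for \<eta>
  proof -
    have "- (LINT s|?M. \<eta> s *\<^sub>R g s) = - (LINT s|?M. \<eta> s *\<^sub>R g' s)"
      using g g' tf unfolding has_weak_deriv_def by metis
    moreover have "(LINT s|?M. \<eta> s *\<^sub>R d s) = (LINT s|?M. \<eta> s *\<^sub>R g s) - (LINT s|?M. \<eta> s *\<^sub>R g' s)"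
      unfolding d_def scaleR_diff_right
      by (rule Bochner_Integration.integral_diff) (intro bdd ints meas tf le)+
    ultimately show ?thesis by simp
  qed
  have "integral {p..q} d = 0" if pq: "a < p" "p < q" "q < b" for p q
  proof -
    obtain \<eta> :: "nat \<Rightarrow> real \<Rightarrow> real" where \<eta>: "\<And>n. test_fun a b (\<eta> n)" "\<And>n s. \<bar>\<eta> n s\<bar> \<le> 1"
      "\<And>s. (\<lambda>n. \<eta> n s) \<longlonglongrightarrow> indicator {p<..<q} s"
      using test_fun_approx_indicator[OF pq] by blast
    have "(\<lambda>n. LINT s|?M. \<eta> n s *\<^sub>R d s) \<longlonglongrightarrow> (LINT s|?M. indicator {p<..<q} s *\<^sub>R d s)"
    proof (rule integral_dominated_convergence[where w="\<lambda>s. norm (d s)"])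
      show "(\<lambda>s. indicator {p<..<q} s *\<^sub>R d s) \<in> borel_measurable ?M"
        using dint by (intro borel_measurable_scaleR borel_measurable_indicator ioo[OF pq]) auto
      show "(\<lambda>s. \<eta> n s *\<^sub>R d s) \<in> borel_measurable ?M" for n
        using dint by (intro borel_measurable_scaleR meas \<eta>(1)) auto
      show "AE s in ?M. (\<lambda>n. \<eta> n s *\<^sub>R d s) \<longlonglongrightarrow> indicator {p<..<q} s *\<^sub>R d s"
        by (intro AE_I2 tendsto_scaleR \<eta>(3) tendsto_const)
      show "AE s in ?M. norm (\<eta> n s *\<^sub>R d s) \<le> norm (d s)" for n
        using \<eta>(2) by (intro AE_I2) (simp add: mult_left_le_one_le)
    qed (use dint in auto)
    then have "(LINT s|?M. indicator {p<..<q} s *\<^sub>R d s) = 0"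
      using null[OF \<eta>(1,2)] LIMSEQ_unique[OF _ tendsto_const] by force
    moreover have "(LINT s|?M. indicator {p<..<q} s *\<^sub>R d s) = integral {p<..<q} d"
    proof -
      have sub: "{p<..<q} \<subseteq> {a<..<b}"
        using pq by auto
      have "integrable ?M (\<lambda>s. indicator {p<..<q} s *\<^sub>R d s)"
        by (rule bdd[OF dint borel_measurable_indicator[OF ioo[OF pq]]]) (simp split: split_indicator)
      then have "(LINT s|?M. indicator {p<..<q} s *\<^sub>R d s) = integral {a<..<b} (\<lambda>s. indicator {p<..<q} s *\<^sub>R d s)"
        by (intro lebesgue_integral_eq_integral) auto
      also have "\<dots> = integral {a<..<b} (\<lambda>s. if s \<in> {p<..<q} then d s else 0)"
        by (intro integral_cong) auto
      also have "\<dots> = integral {p<..<q} d"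
        by (simp only: Henstock_Kurzweil_Integration.integral_restrict_Int Int_absorb2[OF sub])
      finally show ?thesis .
    qed
    ultimately show ?thesis
      by (simp add: integral_open_interval_real)
  qed
  then have "AE s in ?M. d s = 0"
    by (rule null_interval_integrals_AE_zero[OF dint])
  then show ?thesis
    by eventually_elim (simp add: d_def)
qed

text \<open>By uniqueness the norm can be computed with any weak derivative in place of the one
  picked by the choice operator.\<close>

lemma W11_norm_eq:
  fixes f :: "real \<Rightarrow> 'a::euclidean_space"
  assumes "a < b" and g: "has_weak_deriv a b f g"
  shows "W11_norm a b f = (LINT s|lebesgue_on {a<..<b}. norm (f s)) + (LINT s|lebesgue_on {a<..<b}. norm (g s))"
proof -
  let ?g = "SOME g. has_weak_deriv a b f g"
  have g': "has_weak_deriv a b f ?g"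
    using someI[of "has_weak_deriv a b f" g] g by blast
  have "AE s in lebesgue_on {a<..<b}. norm (?g s) = norm (g s)"
    using weak_deriv_unique[OF \<open>a < b\<close> g' g] by eventually_elim simp
  then have "(LINT s|lebesgue_on {a<..<b}. norm (?g s)) = (LINT s|lebesgue_on {a<..<b}. norm (g s))"
    using g g' unfolding has_weak_deriv_def
    by (intro integral_cong_AE) (auto intro!: borel_measurable_norm)
  then show ?thesis
    unfolding W11_norm_def by simp
qed

text \<open>\<open>f\<close> is the difference of the nondecreasing functions \<open>U + f\<close>
  and \<open>U\<close>. This gives measurability, and for each of them the second mean value theorem
  evaluates the integral against \<open>deriv \<eta>\<close> as its increment times a value of
  \<open>- \<eta>\<close>.\<close>

lemma BV_of_variation_bound:
  assumes "a < b" and U: "mono U" and UB: "\<And>s. \<bar>U s\<bar> \<le> B"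
    and var: "\<And>s t. a < s \<Longrightarrow> s \<le> t \<Longrightarrow> t < b \<Longrightarrow> \<bar>f t - f s\<bar> \<le> U t - U s"
  shows "f \<in> BV a b"
proof -
  let ?M = "lebesgue_on {a<..<b}"
  have g: "U s + f s \<le> U t + f t" if "a < s" "s \<le> t" "t < b" for s t
    using var[OF that] by linarith
  have Um: "U \<in> borel_measurable ?M"
    using borel_measurable_mono[OF U] by (intro measurable_restrict_space1 measurable_completion) simp
  have gm: "(\<lambda>s. U s + f s) \<in> borel_measurable ?M"
  proof -
    have "mono_on {a<..<b} (\<lambda>s. U s + f s)"
      using g by (intro mono_onI) auto
    then have "(\<lambda>s. U s + f s) \<in> borel_measurable (restrict_space borel {a<..<b})"
      by (rule borel_measurable_mono_on_fnc)
    then have "(\<lambda>s. indicator {a<..<b} s *\<^sub>R (U s + f s)) \<in> borel_measurable borel"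
      by (subst (asm) borel_measurable_restrict_space_iff) auto
    then have "(\<lambda>s. indicator {a<..<b} s *\<^sub>R (U s + f s)) \<in> borel_measurable lebesgue"
      by (intro measurable_completion) simp
    then show ?thesis
      by (subst borel_measurable_restrict_space_iff) auto
  qed
  have fm: "f \<in> borel_measurable ?M"
    using borel_measurable_diff[OF gm Um] by simp
  define m where "m = (a + b) / 2"
  have m: "a < m" "m < b"
    using \<open>a < b\<close> by (auto simp: m_def)
  have fB: "\<bar>f s\<bar> \<le> \<bar>f m\<bar> + 2 * B" if "s \<in> {a<..<b}" for s
    using var[of s m] var[of m s] m that UB[of s] UB[of m] by (cases "s \<le> m") auto
  have fi: "integrable ?M f"
    by (rule integrable_bounded_interval[OF fm]) (use fB in auto)
  \<comment> \<open>The two parts contribute at most twice and once the increment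
    \<open>U q - U p\<close>, which is at most \<open>2 * B\<close>.\<close>
  moreover have "(LINT s|?M. f s * deriv \<eta> s) \<le> 6 * B" if tf: "test_fun a b \<eta>" and le: "\<forall>s. \<bar>\<eta> s\<bar> \<le> 1" for \<eta>
  proof -
    obtain p q C where \<eta>: "a < p" "p < q" "q < b" "\<And>s. s \<notin> {p<..<q} \<Longrightarrow> \<eta> s = 0" "\<And>s. s \<notin> {p<..<q} \<Longrightarrow> deriv \<eta> s = 0"
      "\<And>s. (\<eta> has_real_derivative deriv \<eta> s) (at s)" "continuous_on UNIV \<eta>" "continuous_on UNIV (deriv \<eta>)"
      "\<And>s. \<bar>\<eta> s\<bar> \<le> C" "\<And>s. \<bar>deriv \<eta> s\<bar> \<le> C"
      using test_fun_props[OF tf \<open>a < b\<close>] by blast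
    have dint: "deriv \<eta> integrable_on {p..q}"
      using \<eta>(8) continuous_on_subset by (intro integrable_continuous_real) auto
    have ftc: "integral {x..y} (deriv \<eta>) = \<eta> y - \<eta> x" if "x \<le> y" for x y
      using that \<eta>(6) by (intro integral_unique fundamental_theorem_of_calculus)
        (auto simp flip: has_real_derivative_iff_has_vector_derivative intro: has_field_derivative_at_within)
    have mono_part: "\<exists>J. ((\<lambda>s. g s * deriv \<eta> s) has_integral J) {p..q} \<and> \<bar>J\<bar> \<le> g q - g p"
      if g: "\<And>s t. p \<le> s \<Longrightarrow> s \<le> t \<Longrightarrow> t \<le> q \<Longrightarrow> g s \<le> g t" for g
    proof -
      obtain c where c: "c \<in> {p..q}"
        and hi: "((\<lambda>x. g x * deriv \<eta> x) has_integral (g p * integral {p..c} (deriv \<eta>) + g q * integral {c..q} (deriv \<eta>))) {p..q}"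
        using second_mean_value_theorem_full[OF dint, of g] \<eta>(2) g by (metis less_imp_le)
      have "g p * integral {p..c} (deriv \<eta>) + g q * integral {c..q} (deriv \<eta>) = (g p - g q) * \<eta> c"
        using c \<eta>(4)[of p] \<eta>(4)[of q] by (simp add: ftc algebra_simps)
      moreover have "\<bar>(g p - g q) * \<eta> c\<bar> \<le> g q - g p"
        using g[of p q] \<eta>(2) le by (simp add: abs_mult mult_left_le)
      ultimately show ?thesis
        using hi by metis
    qed
    obtain J1 where J1: "((\<lambda>s. (U s + f s) * deriv \<eta> s) has_integral J1) {p..q}" "\<bar>J1\<bar> \<le> (U q + f q) - (U p + f p)"
      using mono_part[of "\<lambda>s. U s + f s"] g \<eta>(1,3) by force
    obtain J2 where J2: "((\<lambda>s. U s * deriv \<eta> s) has_integral J2) {p..q}" "\<bar>J2\<bar> \<le> U q - U p"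
      using mono_part[of U] U by (auto simp: mono_def)
    have "((\<lambda>s. f s * deriv \<eta> s) has_integral (J1 - J2)) {p..q}"
      using has_integral_diff[OF J1(1) J2(1)] by (simp add: algebra_simps)
    then have "((\<lambda>s. f s * deriv \<eta> s) has_integral (J1 - J2)) {a<..<b}"
      by (rule has_integral_on_superset) (use \<eta>(1,3,5) in auto)
    moreover have "integrable ?M (\<lambda>s. f s * deriv \<eta> s)"
    proof (rule integrable_bounded_interval[of _ _ _ "(\<bar>f m\<bar> + 2 * B) * C"])
      have "deriv \<eta> \<in> borel_measurable ?M"
        using \<eta>(8) continuous_on_subset by (intro continuous_imp_measurable_on_sets_lebesgue) auto
      then show "(\<lambda>s. f s * deriv \<eta> s) \<in> borel_measurable ?M"
        using fm by (intro borel_measurable_times)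
      show "norm (f s * deriv \<eta> s) \<le> (\<bar>f m\<bar> + 2 * B) * C" if "s \<in> {a<..<b}" for s
        using fB[OF that] \<eta>(10)[of s] UB[of s] by (auto simp: abs_mult intro!: mult_mono)
    qed
    ultimately have "(LINT s|?M. f s * deriv \<eta> s) = J1 - J2"
      using lebesgue_integral_eq_integral[of "{a<..<b}" "\<lambda>s. f s * deriv \<eta> s"] by (auto dest: integral_unique)
    moreover have "U q - U p \<le> 2 * B"
      using UB[of p] UB[of q] by linarith
    moreover have "f q - f p \<le> U q - U p"
      using var[of p q] \<eta>(1-3) by auto
    ultimately show ?thesis
      using J1(2) J2(2) by linarith
  qed
  ultimately show ?thesis
    unfolding BV_def bdd_above_def by blast
qed

lemma has_weak_deriv_diff:
  fixes f g :: "real \<Rightarrow> 'a::euclidean_space"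
  assumes "a < b" and f: "has_weak_deriv a b f f'" and g: "has_weak_deriv a b g g'"
  shows "has_weak_deriv a b (\<lambda>s. f s - g s) (\<lambda>s. f' s - g' s)"
proof -
  let ?M = "lebesgue_on {a<..<b}"
  have int: "integrable ?M f" "integrable ?M f'" "integrable ?M g" "integrable ?M g'"
    using f g unfolding has_weak_deriv_def by blast+
  have wint: "integrable ?M (\<lambda>s. \<eta> s *\<^sub>R k s)"
    if k: "integrable ?M k" and "continuous_on UNIV \<eta>" and B: "\<And>s. \<bar>\<eta> s\<bar> \<le> B" for \<eta> B and k :: "real \<Rightarrow> 'a"
  proof (rule Bochner_Integration.integrable_bound[of _ "\<lambda>s. B *\<^sub>R k s"])
    show "integrable ?M (\<lambda>s. B *\<^sub>R k s)"
      using k by (rule integrable_scaleR_right)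
    have "\<eta> \<in> borel_measurable ?M"
      using continuous_on_subset[OF \<open>continuous_on UNIV \<eta>\<close>] by (intro continuous_imp_measurable_on_sets_lebesgue) auto
    then show "(\<lambda>s. \<eta> s *\<^sub>R k s) \<in> borel_measurable ?M"
      using k by (intro borel_measurable_scaleR) auto
    have "\<bar>\<eta> s\<bar> * norm (k s) \<le> \<bar>B\<bar> * norm (k s)" for s
      using B[of s] by (intro mult_right_mono) auto
    then show "AE s in ?M. norm (\<eta> s *\<^sub>R k s) \<le> norm (B *\<^sub>R k s)"
      by (intro AE_I2) simp
  qed
  have "(LINT s|?M. deriv \<eta> s *\<^sub>R (f s - g s)) = - (LINT s|?M. \<eta> s *\<^sub>R (f' s - g' s))" if tf: "test_fun a b \<eta>" for \<eta>
  proof -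
    obtain p q B where "a < p" "p < q" "q < b" "\<And>s. s \<notin> {p<..<q} \<Longrightarrow> \<eta> s = 0" "\<And>s. s \<notin> {p<..<q} \<Longrightarrow> deriv \<eta> s = 0"
      "\<And>s. (\<eta> has_real_derivative deriv \<eta> s) (at s)" and \<eta>: "continuous_on UNIV \<eta>" "continuous_on UNIV (deriv \<eta>)"
      "\<And>s. \<bar>\<eta> s\<bar> \<le> B" "\<And>s. \<bar>deriv \<eta> s\<bar> \<le> B"
      using test_fun_props[OF tf \<open>a < b\<close>] by blast
    have "(LINT s|?M. deriv \<eta> s *\<^sub>R (f s - g s)) = (LINT s|?M. deriv \<eta> s *\<^sub>R f s) - (LINT s|?M. deriv \<eta> s *\<^sub>R g s)"
      unfolding scaleR_diff_right
      by (rule Bochner_Integration.integral_diff) (intro wint[OF _ \<eta>(2,4)] int)+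
    moreover have "(LINT s|?M. \<eta> s *\<^sub>R (f' s - g' s)) = (LINT s|?M. \<eta> s *\<^sub>R f' s) - (LINT s|?M. \<eta> s *\<^sub>R g' s)"
      unfolding scaleR_diff_right
      by (rule Bochner_Integration.integral_diff) (intro wint[OF _ \<eta>(1,3)] int)+
    moreover have "(LINT s|?M. deriv \<eta> s *\<^sub>R f s) = - (LINT s|?M. \<eta> s *\<^sub>R f' s)"
      "(LINT s|?M. deriv \<eta> s *\<^sub>R g s) = - (LINT s|?M. \<eta> s *\<^sub>R g' s)"
      using f g tf unfolding has_weak_deriv_def by blast+
    ultimately show ?thesis by simp
  qed
  then show ?thesis
    unfolding has_weak_deriv_def using int by (auto intro: Bochner_Integration.integrable_diff)
qed

subsection \<open>Length and inscribed polygonals\<close>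

definition chord_sum :: "(real \<Rightarrow> 'a::real_normed_vector) \<Rightarrow> real list \<Rightarrow> real" where
  "chord_sum f xs = (\<Sum>i<length xs - 1. norm (f (xs ! Suc i) - f (xs ! i)))"

lemma chord_sum_simps [simp]:
  "chord_sum f [] = 0" "chord_sum f [x] = 0"
  "chord_sum f (x # y # zs) = norm (f y - f x) + chord_sum f (y # zs)"
  by (simp_all add: chord_sum_def sum.lessThan_Suc_shift del: sum.lessThan_Suc)

lemma chord_sum_nonneg: "0 \<le> chord_sum f xs"
  by (simp add: chord_sum_def sum_nonneg)

lemma chord_sum_append: "chord_sum f xs + chord_sum f ys \<le> chord_sum f (xs @ ys)"
proof (induction xs)
  case (Cons x xs)
  show ?case
  proof (cases xs)
    case Nil
    then show ?thesis by (cases ys) auto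
  next
    case (Cons y zs)
    then show ?thesis using Cons.IH by simp
  qed
qed simp

text \<open>A telescoping estimate with an error \<open>e\<close> per listed point. \<open>g\<close>
  plays the part of a running length: linear in time for a Lipschitz curve, the length of the
  polygonal up to a vertex for an inscribed one.\<close>

lemma chord_sum_le:
  assumes "sorted xs" "xs \<noteq> []"
    and "\<And>a b. a \<in> set xs \<Longrightarrow> b \<in> set xs \<Longrightarrow> a \<le> b \<Longrightarrow> norm (f b - f a) \<le> g b - g a + e" and "0 \<le> e"
  shows "chord_sum f xs \<le> g (last xs) - g (hd xs) + e * real (length xs)"
  using assms
proof (induction xs)
  case (Cons x xs)
  show ?case
  proof (cases xs)
    case Nil
    then show ?thesis using \<open>0 \<le> e\<close> by simp
  next
    case (Cons y zs)
    have "chord_sum f xs \<le> g (last xs) - g (hd xs) + e * real (length xs)"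
      by (rule Cons.IH) (use Cons.prems \<open>xs = y # zs\<close> in auto)
    moreover have "norm (f y - f x) \<le> g y - g x + e"
      using Cons.prems \<open>xs = y # zs\<close> by auto
    ultimately show ?thesis
      using \<open>xs = y # zs\<close> by (simp add: algebra_simps)
  qed
qed simp

lemma curve_length_alt: "curve_length f a b = (SUP xs\<in>{xs. sorted xs \<and> set xs \<subseteq> {a..b}}. ereal (chord_sum f xs))"
  unfolding curve_length_def chord_sum_def ..

lemma chord_sum_le_curve_length: "sorted xs \<Longrightarrow> set xs \<subseteq> {a..b} \<Longrightarrow> ereal (chord_sum f xs) \<le> curve_length f a b"
  unfolding curve_length_alt by (rule SUP_upper) simp

lemma chord_le_curve_length:
  assumes "a \<le> b"
  shows "ereal (norm (f b - f a)) \<le> curve_length f a b"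
  using chord_sum_le_curve_length[of "[a, b]" a b f] assms by simp

lemma curve_length_superadditive:
  assumes "a \<le> m" "m \<le> b"
  shows "curve_length f a m + curve_length f m b \<le> curve_length f a b"
proof -
  have "ereal (chord_sum f xs) + ereal (chord_sum f ys) \<le> curve_length f a b"
    if "sorted xs" "set xs \<subseteq> {a..m}" "sorted ys" "set ys \<subseteq> {m..b}" for xs ys
  proof -
    have "x \<le> y" if "x \<in> set xs" "y \<in> set ys" for x y
    proof -
      have "x \<le> m" "m \<le> y"
        using \<open>set xs \<subseteq> {a..m}\<close> \<open>set ys \<subseteq> {m..b}\<close> that by auto
      then show ?thesis by simp
    qed
    then have "sorted (xs @ ys)"
      using that(1,3) unfolding sorted_append by blast
    moreover have "{a..m} \<subseteq> {a..b}" "{m..b} \<subseteq> {a..b}"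
      using assms by auto
    then have "set (xs @ ys) \<subseteq> {a..b}"
      using that(2,4) unfolding set_append by blast
    ultimately have *: "ereal (chord_sum f (xs @ ys)) \<le> curve_length f a b"
      by (rule chord_sum_le_curve_length)
    have "ereal (chord_sum f xs) + ereal (chord_sum f ys) = ereal (chord_sum f xs + chord_sum f ys)"
      by simp
    also have "\<dots> \<le> ereal (chord_sum f (xs @ ys))"
      by (simp add: chord_sum_append)
    also note *
    finally show ?thesis .
  qed
  note 1 = this
  have nn: "0 \<le> curve_length f x y" for x y
    using chord_sum_le_curve_length[of "[]" x y f] by (simp add: zero_ereal_def)
  have ne: "{xs. sorted xs \<and> set xs \<subseteq> {x..y::real}} \<noteq> {}" for x y
  proof -
    have "[] \<in> {xs. sorted xs \<and> set xs \<subseteq> {x..y}}" by simp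
    then show ?thesis by blast
  qed
  have 2: "ereal (chord_sum f xs) + curve_length f m b \<le> curve_length f a b"
    if "sorted xs" "set xs \<subseteq> {a..m}" for xs
  proof -
    have "ereal (chord_sum f xs) + curve_length f m b =
        (SUP ys\<in>{ys. sorted ys \<and> set ys \<subseteq> {m..b}}. ereal (chord_sum f xs) + ereal (chord_sum f ys))"
      unfolding curve_length_alt by (rule SUP_ereal_add_right[symmetric, OF ne]) (auto simp: chord_sum_nonneg)
    also have "\<dots> \<le> curve_length f a b"
      using 1 that by (intro SUP_least) auto
    finally show ?thesis .
  qed
  have "curve_length f a m + curve_length f m b =
      (SUP xs\<in>{xs. sorted xs \<and> set xs \<subseteq> {a..m}}. ereal (chord_sum f xs) + curve_length f m b)"
    by (subst (1) curve_length_alt, rule SUP_ereal_add_left[symmetric, OF ne]) (use nn[of m b] in auto)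
  also have "\<dots> \<le> curve_length f a b"
    using 2 by (intro SUP_least) auto
  finally show ?thesis .
qed

lemma curve_length_lipschitz:
  assumes "a \<le> b" and lip: "\<And>s t. a \<le> s \<Longrightarrow> s \<le> t \<Longrightarrow> t \<le> b \<Longrightarrow> norm (f t - f s) \<le> v * (t - s)" and "0 \<le> v"
  shows "curve_length f a b \<le> ereal (v * (b - a))"
  unfolding curve_length_alt
proof (rule SUP_least, clarify)
  fix xs :: "real list" assume xs: "sorted xs" "set xs \<subseteq> {a..b}"
  have "chord_sum f xs \<le> v * (b - a)"
  proof (cases "xs = []")
    case False
    have "chord_sum f xs \<le> v * last xs - v * hd xs + 0 * real (length xs)"
    proof (rule chord_sum_le[OF xs(1) False, where g="\<lambda>s. v * s"])
      fix s t assume "s \<in> set xs" "t \<in> set xs" "s \<le> t"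
      moreover from this have "a \<le> s" "t \<le> b"
        using xs(2) by auto
      ultimately show "norm (f t - f s) \<le> v * t - v * s + 0"
        using lip[of s t] by (simp add: right_diff_distrib)
    qed simp
    moreover have "v * last xs \<le> v * b" "v * a \<le> v * hd xs"
      using xs(2) False \<open>0 \<le> v\<close> by (auto intro!: mult_left_mono dest: subsetD[OF _ hd_in_set] subsetD[OF _ last_in_set])
    ultimately show ?thesis
      by (simp add: right_diff_distrib)
  qed (use assms in simp)
  then show "ereal (chord_sum f xs) \<le> ereal (v * (b - a))" by simp
qed

text \<open>Near each point a chord has length at least \<open>v - e\<close> times the elapsed time,
  by differentiability there; bisection and superadditivity of length spread this to the whole
  interval.\<close>

lemma curve_length_constant_speed:
  fixes f :: "real \<Rightarrow> 'a::euclidean_space"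
  assumes "a \<le> b" and deriv: "\<And>s. s \<in> {a..b} \<Longrightarrow> (f has_vector_derivative f' s) (at s within {a..b})"
    and speed: "\<And>s. s \<in> {a..b} \<Longrightarrow> norm (f' s) = v"
  shows "ereal (v * (b - a)) \<le> curve_length f a b"
proof (rule ereal_le_epsilon2)
  fix e0 :: real assume "0 < e0"
  \<comment> \<open>The summand 1 keeps the denominator positive when \<open>a = b\<close>.\<close>
  define e where "e = e0 / (b - a + 1)"
  have "0 < e"
    using \<open>0 < e0\<close> \<open>a \<le> b\<close> by (simp add: e_def)
  have "e * (b - a) \<le> e0"
    using \<open>0 < e0\<close> \<open>a \<le> b\<close> by (simp add: e_def field_simps)
  have "a \<le> a \<longrightarrow> b \<le> b \<longrightarrow> ereal ((v - e) * (b - a)) \<le> curve_length f a b"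
    using \<open>a \<le> b\<close>
  proof (induction rule: Bolzano[where P="\<lambda>w u. a \<le> w \<longrightarrow> u \<le> b \<longrightarrow> ereal ((v - e) * (u - w)) \<le> curve_length f w u"])
    case (trans w m u)
    show ?case
    proof (intro impI)
      assume "a \<le> w" "u \<le> b"
      have "ereal ((v - e) * (u - w)) = ereal ((v - e) * (m - w)) + ereal ((v - e) * (u - m))"
        by (simp add: algebra_simps)
      also have "\<dots> \<le> curve_length f w m + curve_length f m u"
        using trans \<open>a \<le> w\<close> \<open>u \<le> b\<close> by (intro add_mono) auto
      also have "\<dots> \<le> curve_length f w u"
        using trans by (intro curve_length_superadditive)
      finally show "ereal ((v - e) * (u - w)) \<le> curve_length f w u" .
    qed
  next
    case (local x)
    then have x: "x \<in> {a..b}" by simp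
    obtain d where "0 < d" and d: "\<And>y. y \<in> {a..b} \<Longrightarrow> norm (y - x) < d \<Longrightarrow>
        norm (f y - f x - (y - x) *\<^sub>R f' x) \<le> e * norm (y - x)"
      using deriv[OF x] \<open>0 < e\<close> unfolding has_vector_derivative_def has_derivative_within_alt by blast
    have "ereal ((v - e) * (u - w)) \<le> curve_length f w u" if "w \<le> x" "x \<le> u" "u - w < d" "a \<le> w" "u \<le> b" for w u
    proof -
      have 1: "norm (f u - f x - (u - x) *\<^sub>R f' x) \<le> e * (u - x)"
        using d[of u] that x by auto
      have 2: "norm (f w - f x - (w - x) *\<^sub>R f' x) \<le> e * (x - w)"
        using d[of w] that x by auto
      have "(u - w) *\<^sub>R f' x = (f u - f w) - (f u - f x - (u - x) *\<^sub>R f' x) + (f w - f x - (w - x) *\<^sub>R f' x)"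
        by (simp add: algebra_simps)
      then have "norm ((u - w) *\<^sub>R f' x) \<le> norm (f u - f w) + e * (u - x) + e * (x - w)"
        using norm_triangle_ineq4[of "f u - f w" "f u - f x - (u - x) *\<^sub>R f' x"]
          norm_triangle_ineq[of "(f u - f w) - (f u - f x - (u - x) *\<^sub>R f' x)" "f w - f x - (w - x) *\<^sub>R f' x"] 1 2
        by simp
      moreover have "norm ((u - w) *\<^sub>R f' x) = (u - w) * v"
        using speed[OF x] that by simp
      ultimately have "ereal ((v - e) * (u - w)) \<le> ereal (norm (f u - f w))"
        by (simp add: algebra_simps)
      also have "\<dots> \<le> curve_length f w u"
        using that by (intro chord_le_curve_length) simp
      finally show ?thesis .
    qed
    then show ?case
      using \<open>0 < d\<close> by blast
  qed
  then have "ereal ((v - e) * (b - a)) + ereal e0 \<le> curve_length f a b + ereal e0"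
    by (intro add_right_mono) simp
  moreover have "ereal (v * (b - a)) \<le> ereal ((v - e) * (b - a)) + ereal e0"
    using \<open>e * (b - a) \<le> e0\<close> by (simp add: algebra_simps)
  ultimately show "ereal (v * (b - a)) \<le> curve_length f a b + ereal e0"
    by (rule order_trans[rotated])
qed

lemma norm_le_geodesic_dist: "ereal (norm (\<iota> q - \<iota> p)) \<le> geodesic_dist M \<iota> p q"
  unfolding geodesic_dist_def
proof (rule INF_greatest, clarify)
  fix \<gamma> assume "p = pathstart \<gamma>" "q = pathfinish \<gamma>"
  then show "ereal (norm (\<iota> (pathfinish \<gamma>) - \<iota> (pathstart \<gamma>))) \<le> curve_length (\<iota> \<circ> \<gamma>) 0 1"
    using chord_le_curve_length[of 0 1 "\<iota> \<circ> \<gamma>"] by (simp add: pathstart_def pathfinish_def)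
qed

lemma geodesic_dist_le_diam: "p \<in> A \<Longrightarrow> q \<in> A \<Longrightarrow> geodesic_dist M \<iota> p q \<le> geodesic_diam M \<iota> A"
  unfolding geodesic_diam_def by (meson SUP_upper2 order_refl)

lemma arc_length_curve_lipschitz:
  assumes "arc_length_curve M \<iota> c L" "0 \<le> s" "s \<le> t" "t \<le> L"
  shows "norm (\<iota> (c t) - \<iota> (c s)) \<le> t - s"
proof -
  have len: "curve_length (\<iota> \<circ> c) 0 s = ereal s" "curve_length (\<iota> \<circ> c) 0 t = ereal t"
    using assms unfolding arc_length_curve_def by auto
  have "ereal s + ereal (norm (\<iota> (c t) - \<iota> (c s))) \<le> curve_length (\<iota> \<circ> c) 0 s + curve_length (\<iota> \<circ> c) s t"
    unfolding len using chord_le_curve_length[OF assms(3), of "\<iota> \<circ> c"] by (intro add_mono) auto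
  also have "\<dots> \<le> ereal t"
    using curve_length_superadditive[OF assms(2,3), of "\<iota> \<circ> c"] unfolding len by simp
  finally show ?thesis by simp
qed

text \<open>The arc of \<open>c\<close> between the two points, reparameterized on
  \<open>[0, 1]\<close>, competes in the infimum.\<close>

lemma geodesic_dist_arc_length_curve:
  assumes c: "arc_length_curve M \<iota> c L" and st: "0 \<le> s" "s \<le> t" "t \<le> L"
  shows "geodesic_dist M \<iota> (c s) (c t) \<le> ereal (t - s)"
proof -
  define \<gamma> where "\<gamma> x = c (s + x * (t - s))" for x
  have sub: "s + x * (t - s) \<in> {0..L}" if "x \<in> {0..1}" for x
    using that st mult_left_le_one_le[of "t - s" x] mult_nonneg_nonneg[of x "t - s"] by auto
  have "continuous_on {0..1} \<gamma>"
    unfolding \<gamma>_def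
  proof (rule continuous_on_compose2[of "{0..L}" c "{0..1}" "\<lambda>x. s + x * (t - s)"])
    show "continuous_on {0..L} c"
      using c by (simp add: arc_length_curve_def)
    show "(\<lambda>x. s + x * (t - s)) ` {0..1} \<subseteq> {0..L}"
      using sub by blast
  qed (intro continuous_intros)
  then have "path \<gamma>"
    by (simp add: path_def)
  moreover have "path_image \<gamma> \<subseteq> M"
    using c sub unfolding arc_length_curve_def path_image_def \<gamma>_def by auto
  ultimately have "geodesic_dist M \<iota> (c s) (c t) \<le> curve_length (\<iota> \<circ> \<gamma>) 0 1"
    unfolding geodesic_dist_def by (intro INF_lower) (auto simp: \<gamma>_def pathstart_def pathfinish_def)
  also have "\<dots> \<le> ereal ((t - s) * (1 - 0))"
  proof (rule curve_length_lipschitz)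
    fix x y :: real assume xy: "0 \<le> x" "x \<le> y" "y \<le> 1"
    have "norm (\<iota> (c (s + y * (t - s))) - \<iota> (c (s + x * (t - s)))) \<le> (s + y * (t - s)) - (s + x * (t - s))"
      using sub[of x] sub[of y] xy st by (intro arc_length_curve_lipschitz[OF c]) (auto intro: mult_right_mono)
    then show "norm ((\<iota> \<circ> \<gamma>) y - (\<iota> \<circ> \<gamma>) x) \<le> (t - s) * (y - x)"
      by (simp add: \<gamma>_def algebra_simps)
  qed (use st in auto)
  finally show ?thesis by simp
qed

section \<open>Polygonals with an explicit speed\<close>

locale constant_speed_polygon =
  fixes M :: "'m::t2_space set" and \<iota> :: "'m \<Rightarrow> 'a::euclidean_space"
    and l :: real and ss :: "real list" and P :: "real \<Rightarrow> 'm" and v :: real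
  assumes length_ss: "2 \<le> length ss" and sorted_ss: "sorted ss" and hd_ss: "hd ss = 0" and last_ss: "last ss = l"
    and l_pos: "0 < l" and v_pos: "0 < v"
    and arcs: "\<And>i. Suc i < length ss \<Longrightarrow> geodesic_arc M \<iota> v P (ss ! i) (ss ! Suc i)"
begin

lemma nth_first: "ss ! 0 = 0"
  using hd_ss length_ss by (metis hd_conv_nth list.size(3) not_numeral_le_zero)

lemma nth_last: "ss ! (length ss - 1) = l"
  using last_ss length_ss by (metis last_conv_nth list.size(3) not_numeral_le_zero)

lemma nth_mono: "i \<le> j \<Longrightarrow> j < length ss \<Longrightarrow> ss ! i \<le> ss ! j"
  using sorted_ss by (simp add: sorted_iff_nth_mono)

lemma nth_bounds: "i < length ss \<Longrightarrow> 0 \<le> ss ! i \<and> ss ! i \<le> l"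
  using nth_mono[of 0 i] nth_mono[of i "length ss - 1"] length_ss nth_first nth_last by auto

text \<open>Consecutive parameters in \<open>ss\<close> may coincide; taking the last index whose
  parameter is at most \<open>s\<close> selects an arc of positive duration that continues beyond
  \<open>s\<close>.\<close>

lemma arc_to_right:
  assumes "0 \<le> s" "s < l"
  obtains i where "Suc i < length ss" "ss ! i \<le> s" "s < ss ! Suc i"
proof -
  define I where "I = {i. i < length ss \<and> ss ! i \<le> s}"
  have I: "finite I" "0 \<in> I"
    using assms nth_first length_ss by (auto simp: I_def)
  then have "Max I \<in> I"
    using Max_in by blast
  then have i: "Max I < length ss" "ss ! Max I \<le> s"
    by (auto simp: I_def)
  have "Max I \<noteq> length ss - 1"
    using i nth_last assms by auto
  then have "Suc (Max I) < length ss"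
    using i by linarith
  moreover have "Suc (Max I) \<notin> I"
    using I(1) Max_ge not_less_eq_eq by blast
  ultimately show ?thesis
    using that[of "Max I"] i by (auto simp: I_def)
qed

lemma arc_to_left:
  assumes "0 < s" "s \<le> l"
  obtains i where "Suc i < length ss" "ss ! i < s" "s \<le> ss ! Suc i"
proof -
  define I where "I = {i. i < length ss \<and> ss ! i < s}"
  have I: "finite I" "0 \<in> I"
    using assms nth_first length_ss by (auto simp: I_def)
  then have "Max I \<in> I"
    using Max_in by blast
  then have i: "Max I < length ss" "ss ! Max I < s"
    by (auto simp: I_def)
  have "Max I \<noteq> length ss - 1"
    using i nth_last assms by auto
  then have "Suc (Max I) < length ss"
    using i by linarith
  moreover have "Suc (Max I) \<notin> I"
    using I(1) Max_ge not_less_eq_eq by blast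
  ultimately show ?thesis
    using that[of "Max I"] i by (auto simp: I_def)
qed

lemma arcD:
  assumes "Suc i < length ss"
  obtains g g' where "continuous_on {ss ! i..ss ! Suc i} P" "P ` {ss ! i..ss ! Suc i} \<subseteq> M"
    "\<And>s. s \<in> {ss ! i..ss ! Suc i} \<Longrightarrow> ((\<iota> \<circ> P) has_vector_derivative g s) (at s within {ss ! i..ss ! Suc i})"
    "\<And>s. s \<in> {ss ! i..ss ! Suc i} \<Longrightarrow> (g has_vector_derivative g' s) (at s within {ss ! i..ss ! Suc i})"
    "\<And>s. s \<in> {ss ! i..ss ! Suc i} \<Longrightarrow> norm (g s) = v"
    "\<And>s w. s \<in> {ss ! i..ss ! Suc i} \<Longrightarrow> w \<in> tangent_plane M \<iota> (P s) \<Longrightarrow> g' s \<bullet> w = 0"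
  using arcs[OF assms] unfolding geodesic_arc_def by blast

lemma continuous_on_initial: "i < length ss \<Longrightarrow> continuous_on {0..ss ! i} P"
proof (induction i)
  case 0
  then show ?case by (simp add: nth_first)
next
  case (Suc i)
  have "{0..ss ! Suc i} = {0..ss ! i} \<union> {ss ! i..ss ! Suc i}"
    using nth_bounds[of i] nth_mono[of i "Suc i"] Suc.prems by auto
  moreover have "continuous_on {ss ! i..ss ! Suc i} P"
    by (rule arcD[OF Suc.prems])
  ultimately show ?case
    using Suc by (auto intro: continuous_on_closed_Un)
qed

lemma continuous_on_polygon: "continuous_on {0..l} P"
  using continuous_on_initial[of "length ss - 1"] length_ss nth_last by simp

lemma polygon_in_M:
  assumes "s \<in> {0..l}"
  shows "P s \<in> M"
proof (cases "s = l")
  case True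
  then obtain i where i: "Suc i < length ss" "ss ! i < s" "s \<le> ss ! Suc i"
    using arc_to_left[of s] l_pos by auto
  show ?thesis
    by (rule arcD[OF i(1)]) (use i in auto)
next
  case False
  then obtain i where i: "Suc i < length ss" "ss ! i \<le> s" "s < ss ! Suc i"
    using arc_to_right[of s] assms by auto
  show ?thesis
    by (rule arcD[OF i(1)]) (use i in auto)
qed

lemma lipschitz_arc:
  assumes i: "Suc i < length ss" and st: "ss ! i \<le> s" "s \<le> t" "t \<le> ss ! Suc i"
  shows "norm (\<iota> (P t) - \<iota> (P s)) \<le> v * (t - s)"
proof (rule arcD[OF i])
  fix g g' :: "real \<Rightarrow> 'a"
  assume d: "\<And>s. s \<in> {ss ! i..ss ! Suc i} \<Longrightarrow> ((\<iota> \<circ> P) has_vector_derivative g s) (at s within {ss ! i..ss ! Suc i})"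
    and n: "\<And>s. s \<in> {ss ! i..ss ! Suc i} \<Longrightarrow> norm (g s) = v"
  have "norm ((\<iota> \<circ> P) t - (\<iota> \<circ> P) s) \<le> v * norm (t - s)"
  proof (rule differentiable_bound[of "{ss ! i..ss ! Suc i}" _ "\<lambda>s h. h *\<^sub>R g s"])
    show "(\<iota> \<circ> P has_derivative (\<lambda>h. h *\<^sub>R g x)) (at x within {ss ! i..ss ! Suc i})" if "x \<in> {ss ! i..ss ! Suc i}" for x
      using d[OF that] by (simp add: has_vector_derivative_def)
    show "onorm (\<lambda>h. h *\<^sub>R g x) \<le> v" if "x \<in> {ss ! i..ss ! Suc i}" for x
      using n[OF that] by (intro onorm_le) (simp add: mult.commute)
  qed (use st in auto)
  then show ?thesis
    using st by simp
qed

lemma lipschitz_initial: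
  "i < length ss \<Longrightarrow> 0 \<le> s \<Longrightarrow> s \<le> t \<Longrightarrow> t \<le> ss ! i \<Longrightarrow> norm (\<iota> (P t) - \<iota> (P s)) \<le> v * (t - s)"
proof (induction i arbitrary: s t)
  case 0
  then have "s = t" by (simp add: nth_first)
  then show ?case by simp
next
  case (Suc i)
  have i: "i < length ss" "0 \<le> ss ! i"
    using Suc.prems nth_bounds[of i] by auto
  consider "t \<le> ss ! i" | "ss ! i \<le> s" | "s < ss ! i" "ss ! i < t" by linarith
  then show ?case
  proof cases
    case 1
    then show ?thesis using Suc.IH i Suc.prems by blast
  next
    case 2
    then show ?thesis using lipschitz_arc Suc.prems by blast
  next
    case 3
    have "norm (\<iota> (P (ss ! i)) - \<iota> (P s)) \<le> v * (ss ! i - s)"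
      using Suc.IH[of s "ss ! i"] i 3 Suc.prems by simp
    moreover have "norm (\<iota> (P t) - \<iota> (P (ss ! i))) \<le> v * (t - ss ! i)"
      using lipschitz_arc[of i "ss ! i" t] 3 Suc.prems by simp
    moreover have "norm (\<iota> (P t) - \<iota> (P s)) \<le> norm (\<iota> (P t) - \<iota> (P (ss ! i))) + norm (\<iota> (P (ss ! i)) - \<iota> (P s))"
      using norm_triangle_ineq[of "\<iota> (P t) - \<iota> (P (ss ! i))" "\<iota> (P (ss ! i)) - \<iota> (P s)"] by simp
    ultimately show ?thesis
      by (simp add: algebra_simps)
  qed
qed

lemma lipschitz_polygon:
  assumes "0 \<le> s" "s \<le> t" "t \<le> l"
  shows "norm (\<iota> (P t) - \<iota> (P s)) \<le> v * (t - s)"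
  using lipschitz_initial[of "length ss - 1" s t] assms length_ss nth_last by simp

lemma length_of_arc:
  assumes "Suc i < length ss"
  shows "ereal (v * (ss ! Suc i - ss ! i)) \<le> curve_length (\<iota> \<circ> P) (ss ! i) (ss ! Suc i)"
  by (rule arcD[OF assms], rule curve_length_constant_speed)
     (use nth_mono[of i "Suc i"] assms in auto)

end

lemma polygonal_speed:
  assumes "polygonal M \<iota> l ss P"
  obtains v where "constant_speed_polygon M \<iota> l ss P v"
  using assms unfolding polygonal_def constant_speed_polygon_def by blast

section \<open>Comparison of an inscribed polygonal with its curve\<close>

locale inscribed_polygon = constant_speed_polygon M \<iota> L ss P v
  for M :: "'m::t2_space set" and \<iota> :: "'m \<Rightarrow> 'a::euclidean_space" and L ss P v +
  fixes c :: "real \<Rightarrow> 'm" and ts :: "real list" and \<mu> :: real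
  assumes c: "arc_length_curve M \<iota> c L"
    and ins: "inscribed M \<iota> c 0 L L ts ss P"
    and hd_ts: "hd ts = 0" and last_ts: "last ts = L"
    and modulus: "modulus M \<iota> c ts \<le> ereal \<mu>"
begin

lemma length_ts: "length ts = length ss"
  using ins by (simp add: inscribed_def)

lemma vertex: "i < length ss \<Longrightarrow> P (ss ! i) = c (ts ! i)"
  using ins length_ts by (simp add: inscribed_def)

lemma ts_mono: "i < j \<Longrightarrow> j < length ss \<Longrightarrow> ts ! i < ts ! j"
  using ins length_ts by (simp add: inscribed_def sorted_wrt_iff_nth_less)

lemma ts_first: "ts ! 0 = 0"
  using hd_ts length_ts length_ss by (metis hd_conv_nth list.size(3) not_numeral_le_zero)

lemma ts_last: "ts ! (length ss - 1) = L"
  using last_ts length_ts length_ss by (metis last_conv_nth list.size(3) not_numeral_le_zero)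

lemma ts_bounds: "i < length ss \<Longrightarrow> 0 \<le> ts ! i \<and> ts ! i \<le> L"
  using ins length_ts unfolding inscribed_def by (metis atLeastAtMost_iff nth_mem subsetD)

lemma geodesic_dist_arc_le:
  assumes "Suc i < length ss" "ts ! i \<le> x" "x \<le> ts ! Suc i" "ts ! i \<le> y" "y \<le> ts ! Suc i"
  shows "geodesic_dist M \<iota> (c x) (c y) \<le> ereal \<mu>"
proof -
  have "geodesic_dist M \<iota> (c x) (c y) \<le> geodesic_diam M \<iota> (c ` {ts ! i..ts ! Suc i})"
    using assms by (intro geodesic_dist_le_diam) auto
  also have "\<dots> \<le> modulus M \<iota> c ts"
    unfolding modulus_def using assms length_ts by (intro Max_ge) auto
  finally show ?thesis
    using modulus by (rule order_trans)
qed

text \<open>The arcs are minimizing, so their lengths are geodesic distances. These are at most the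
  length of the arc of \<open>c\<close> between the same vertices, and at most the modulus.\<close>

lemma arc_length_le:
  assumes "Suc i < length ss"
  shows "v * (ss ! Suc i - ss ! i) \<le> ts ! Suc i - ts ! i" and "v * (ss ! Suc i - ss ! i) \<le> \<mu>"
proof -
  have len: "ereal (v * (ss ! Suc i - ss ! i)) \<le> geodesic_dist M \<iota> (c (ts ! i)) (c (ts ! Suc i))"
    using length_of_arc[OF assms] ins assms length_ts by (simp add: inscribed_def)
  have ts: "ts ! i < ts ! Suc i" "0 \<le> ts ! i" "ts ! Suc i \<le> L"
    using ts_mono[of i "Suc i"] ts_bounds[of i] ts_bounds[of "Suc i"] assms by auto
  have "geodesic_dist M \<iota> (c (ts ! i)) (c (ts ! Suc i)) \<le> ereal (ts ! Suc i - ts ! i)"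
    using ts by (intro geodesic_dist_arc_length_curve[OF c]) auto
  with len have "ereal (v * (ss ! Suc i - ss ! i)) \<le> ereal (ts ! Suc i - ts ! i)"
    by (rule order_trans)
  then show "v * (ss ! Suc i - ss ! i) \<le> ts ! Suc i - ts ! i" by simp
  have "geodesic_dist M \<iota> (c (ts ! i)) (c (ts ! Suc i)) \<le> ereal \<mu>"
    using ts assms by (intro geodesic_dist_arc_le[of i]) auto
  with len have "ereal (v * (ss ! Suc i - ss ! i)) \<le> ereal \<mu>"
    by (rule order_trans)
  then show "v * (ss ! Suc i - ss ! i) \<le> \<mu>" by simp
qed

lemma mu_nonneg: "0 \<le> \<mu>"
proof -
  have "0 \<le> v * (ss ! Suc 0 - ss ! 0)"
    using v_pos nth_mono[of 0 "Suc 0"] length_ss by simp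
  also have "\<dots> \<le> \<mu>"
    using length_ss by (intro arc_length_le) simp
  finally show ?thesis .
qed

lemma length_le: "i \<le> j \<Longrightarrow> j < length ss \<Longrightarrow> v * (ss ! j - ss ! i) \<le> ts ! j - ts ! i"
proof (induction j rule: dec_induct)
  case (step j)
  then show ?case
    using arc_length_le(1)[of j] by (simp add: algebra_simps)
qed simp

lemma v_le_1: "v \<le> 1"
  using length_le[of 0 "length ss - 1"] length_ss nth_first nth_last ts_first ts_last l_pos by simp

text \<open>The part of the polygonal before the vertex is no longer than the part of
  \<open>c\<close> before it, and the same holds after it. The two inequalities squeeze the
  difference of the parameters, which becomes small as \<open>v\<close> approaches 1.\<close>

lemma vertex_parameters_close:
  assumes "i < length ss"
  shows "\<bar>ts ! i - ss ! i\<bar> \<le> (1 - v) * L"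
proof -
  have 1: "v * ss ! i \<le> ts ! i" "v * (L - ss ! i) \<le> L - ts ! i"
    using length_le[of 0 i] length_le[of i "length ss - 1"] assms length_ss nth_first nth_last ts_first ts_last
    by auto
  have 2: "(1 - v) * ss ! i \<le> (1 - v) * L" "0 \<le> (1 - v) * ss ! i"
    using v_le_1 nth_bounds[OF assms] by (auto intro: mult_left_mono)
  show ?thesis
    using 1 2 by (simp add: abs_le_iff algebra_simps)
qed

text \<open>The vertex that starts the arc through \<open>s\<close> was passed at most
  \<open>\<mu> / v\<close> earlier, since an arc has length at most \<open>\<mu>\<close>.\<close>

lemma close_vertex:
  assumes s: "s \<in> {0..L}"
  obtains \<sigma> \<tau> where "0 \<le> \<sigma>" "\<sigma> \<le> s" "s - \<sigma> \<le> \<mu> / v" "\<tau> \<in> {0..L}" "\<bar>\<tau> - s\<bar> \<le> (1 - v) * L + \<mu> / v" "P \<sigma> = c \<tau>"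
proof -
  have "\<exists>i < length ss. ss ! i \<le> s \<and> s - ss ! i \<le> \<mu> / v"
  proof (cases "s = L")
    case True
    then show ?thesis
      using nth_last length_ss mu_nonneg v_pos by (intro exI[of _ "length ss - 1"]) auto
  next
    case False
    then obtain i where i: "Suc i < length ss" "ss ! i \<le> s" "s < ss ! Suc i"
      using arc_to_right[of s] s by auto
    have "ss ! Suc i - ss ! i \<le> \<mu> / v"
      using arc_length_le(2)[OF i(1)] v_pos by (simp add: field_simps)
    then show ?thesis
      using i by (intro exI[of _ i]) auto
  qed
  then obtain i where i: "i < length ss" "ss ! i \<le> s" "s - ss ! i \<le> \<mu> / v" by blast
  show ?thesis
    using that[of "ss ! i" "ts ! i"] i nth_bounds[OF i(1)] ts_bounds[OF i(1)] vertex[OF i(1)] vertex_parameters_close[OF i(1)]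
    by auto
qed

text \<open>Each point of \<open>c\<close> is replaced by the preceding vertex at a cost of
  \<open>\<mu>\<close>, hence \<open>2 * \<mu>\<close> per chord, while chords between vertices are
  bounded by the polygonal. This is the lower semicontinuity of length that drives the speeds to
  1.\<close>

lemma chord_sum_le_length:
  assumes xs: "sorted xs" "set xs \<subseteq> {0..L}"
  shows "chord_sum (\<iota> \<circ> c) xs \<le> v * L + 2 * \<mu> * real (length xs)"
proof (cases "xs = []")
  case True
  then show ?thesis using v_pos l_pos by simp
next
  case False
  \<comment> \<open>The index of the last vertex of the curve at or before the parameter
    \<open>a\<close>.\<close>
  define idx where "idx a = Max {i. i < length ss \<and> ts ! i \<le> a}" for a
  have fin: "finite {i. i < length ss \<and> ts ! i \<le> a}" for a by simp
  have ne: "{i. i < length ss \<and> ts ! i \<le> a} \<noteq> {}" if "0 \<le> a" for a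
    using that ts_first length_ss by (auto intro!: exI[of _ 0])
  have idx: "idx a < length ss" "ts ! idx a \<le> a" if "0 \<le> a" for a
    using Max_in[OF fin ne[OF that]] unfolding idx_def by auto
  have idx_next: "a < ts ! Suc (idx a)" if "0 \<le> a" "Suc (idx a) < length ss" for a
  proof (rule ccontr)
    assume "\<not> a < ts ! Suc (idx a)"
    then have "Suc (idx a) \<le> idx a"
      using that unfolding idx_def by (intro Max_ge fin) auto
    then show False by simp
  qed
  have idx_mono: "idx a \<le> idx b" if "0 \<le> a" "a \<le> b" for a b
    unfolding idx_def using that by (intro Max_mono ne fin) auto
  have near: "norm (\<iota> (c a) - \<iota> (c (ts ! idx a))) \<le> \<mu>" if a: "a \<in> {0..L}" for a
  proof (cases "Suc (idx a) < length ss")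
    case True
    have "ereal (norm (\<iota> (c a) - \<iota> (c (ts ! idx a)))) \<le> geodesic_dist M \<iota> (c (ts ! idx a)) (c a)"
      by (rule norm_le_geodesic_dist)
    also have "\<dots> \<le> ereal \<mu>"
      using idx[of a] idx_next[of a] a True ts_mono[of "idx a" "Suc (idx a)"] by (intro geodesic_dist_arc_le[of "idx a"]) auto
    finally show ?thesis by simp
  next
    case False
    then have "idx a = length ss - 1"
      using idx(1)[of a] a by auto
    then have "a = ts ! idx a"
      using ts_last idx(2)[of a] a by auto
    then show ?thesis
      using mu_nonneg by simp
  qed
  have "chord_sum (\<iota> \<circ> c) xs \<le> v * ss ! idx (last xs) - v * ss ! idx (hd xs) + 2 * \<mu> * real (length xs)"
  proof (rule chord_sum_le[OF xs(1) False, where g="\<lambda>a. v * ss ! idx a"])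
    fix a b assume ab: "a \<in> set xs" "b \<in> set xs" "a \<le> b"
    have in0L: "a \<in> {0..L}" "b \<in> {0..L}"
      using ab xs(2) by auto
    have i: "idx a < length ss" "idx b < length ss" "idx a \<le> idx b"
      using idx(1) idx_mono in0L ab(3) by auto
    have "norm (\<iota> (c (ts ! idx b)) - \<iota> (c (ts ! idx a))) \<le> v * (ss ! idx b - ss ! idx a)"
      using lipschitz_polygon[of "ss ! idx a" "ss ! idx b"] nth_bounds[OF i(1)] nth_bounds[OF i(2)] nth_mono[OF i(3,2)]
        vertex[OF i(1)] vertex[OF i(2)] by simp
    moreover have "norm (\<iota> (c b) - \<iota> (c a)) \<le> norm (\<iota> (c b) - \<iota> (c (ts ! idx b))) +
        norm (\<iota> (c (ts ! idx b)) - \<iota> (c (ts ! idx a))) + norm (\<iota> (c a) - \<iota> (c (ts ! idx a)))"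
      by norm
    ultimately show "norm ((\<iota> \<circ> c) b - (\<iota> \<circ> c) a) \<le> v * ss ! idx b - v * ss ! idx a + 2 * \<mu>"
      using near[OF in0L(1)] near[OF in0L(2)] by (simp add: right_diff_distrib)
  qed (use mu_nonneg in simp)
  moreover have "0 \<le> v * ss ! idx (hd xs)" "v * ss ! idx (last xs) \<le> v * L"
  proof -
    have "0 \<le> hd xs" "0 \<le> last xs"
      using xs(2) False by (metis atLeastAtMost_iff hd_in_set last_in_set subsetD)+
    then show "0 \<le> v * ss ! idx (hd xs)" "v * ss ! idx (last xs) \<le> v * L"
      using nth_bounds[OF idx(1)] v_pos by auto
  qed
  ultimately show ?thesis by linarith
qed

end

subsection \<open>Velocity of a polygonal\<close>

text \<open>On a circle of radius \<open>v\<close> the chord is at most the arc, here through the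
  formula for \<open>1 - cos \<theta>\<close> in terms of the half angle. It converts turning angles
  into jumps of the velocity.\<close>

lemma norm_diff_le_vec_angle:
  assumes "norm u = v" "norm w = v" "0 < v"
  shows "norm (w - u) \<le> v * vec_angle u w"
proof -
  define x where "x = (u \<bullet> w) / (norm u * norm w)"
  define \<theta> where "\<theta> = arccos x"
  have "\<bar>u \<bullet> w\<bar> \<le> v * v"
    using Cauchy_Schwarz_ineq2[of u w] assms by simp
  then have x: "\<bar>x\<bar> \<le> 1"
    using assms by (simp add: x_def)
  then have "cos \<theta> = x" "0 \<le> \<theta>"
    unfolding \<theta>_def by (auto simp: abs_le_iff intro: cos_arccos arccos_lbound)
  have "1 - cos \<theta> = 2 * (sin (\<theta> / 2))\<^sup>2"
    using cos_double_sin[of "\<theta> / 2"] by simp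
  also have "\<dots> \<le> 2 * (\<theta> / 2)\<^sup>2"
    using abs_sin_x_le_abs_x[of "\<theta> / 2"] unfolding abs_le_square_iff by (rule mult_left_mono) simp
  finally have cos_le: "2 * (1 - x) \<le> \<theta>\<^sup>2"
    unfolding \<open>cos \<theta> = x\<close> by (simp add: power_divide)
  have "(norm (w - u))\<^sup>2 = v\<^sup>2 * (2 * (1 - x))"
  proof -
    have "(norm (w - u))\<^sup>2 = (norm w)\<^sup>2 + (norm u)\<^sup>2 - 2 * (u \<bullet> w)"
      by (simp add: power2_norm_eq_inner inner_diff_left inner_diff_right inner_commute)
    moreover have "u \<bullet> w = v\<^sup>2 * x"
      using assms by (simp add: x_def power2_eq_square)
    ultimately show ?thesis
      using assms by (simp add: algebra_simps)
  qed
  also have "\<dots> \<le> v\<^sup>2 * \<theta>\<^sup>2"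
    by (intro mult_left_mono cos_le) simp
  finally have "(norm (w - u))\<^sup>2 \<le> (v * \<theta>)\<^sup>2"
    by (simp add: power_mult_distrib)
  then have "norm (w - u) \<le> v * \<theta>"
    by (rule power2_le_imp_le) (use assms \<open>0 \<le> \<theta>\<close> in simp)
  then show ?thesis
    by (simp add: \<theta>_def x_def vec_angle_def)
qed

context constant_speed_polygon
begin

text \<open>The right derivative is defined at the vertices too, and it is the right-continuous
  choice that Helly's theorem requires.\<close>

definition velocity :: "real \<Rightarrow> 'a" where
  "velocity s = vector_derivative (\<iota> \<circ> P) (at_right s)"

definition velocity_left :: "real \<Rightarrow> 'a" where
  "velocity_left s = vector_derivative (\<iota> \<circ> P) (at_left s)"

lemma velocity_right_eq:
  assumes "ss ! i \<le> s" "s < ss ! Suc i" and "((\<iota> \<circ> P) has_vector_derivative d) (at s within {ss ! i..ss ! Suc i})"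
  shows "((\<iota> \<circ> P) has_vector_derivative d) (at_right s)" "velocity s = d"
proof -
  have "((\<iota> \<circ> P) has_vector_derivative d) (at s within {s..ss ! Suc i})"
    by (rule has_vector_derivative_within_subset[OF assms(3)]) (use assms in auto)
  then show 1: "((\<iota> \<circ> P) has_vector_derivative d) (at_right s)"
    using assms by (simp add: at_within_Icc_at_right)
  show "velocity s = d"
    unfolding velocity_def by (rule vector_derivative_within[OF _ 1]) simp
qed

lemma velocity_left_eq:
  assumes "ss ! i < s" "s \<le> ss ! Suc i" and "((\<iota> \<circ> P) has_vector_derivative d) (at s within {ss ! i..ss ! Suc i})"
  shows "((\<iota> \<circ> P) has_vector_derivative d) (at_left s)" "velocity_left s = d"
proof -
  have "((\<iota> \<circ> P) has_vector_derivative d) (at s within {ss ! i..s})"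
    by (rule has_vector_derivative_within_subset[OF assms(3)]) (use assms in auto)
  then show 1: "((\<iota> \<circ> P) has_vector_derivative d) (at_left s)"
    using assms by (simp add: at_within_Icc_at_left)
  show "velocity_left s = d"
    unfolding velocity_left_def by (rule vector_derivative_within[OF _ 1]) simp
qed

lemma velocity_props:
  assumes "0 \<le> s" "s < l"
  shows "((\<iota> \<circ> P) has_vector_derivative velocity s) (at_right s)" "norm (velocity s) = v"
proof -
  obtain i where i: "Suc i < length ss" "ss ! i \<le> s" "s < ss ! Suc i"
    using arc_to_right assms by blast
  obtain g g' where g: "\<And>s. s \<in> {ss ! i..ss ! Suc i} \<Longrightarrow> ((\<iota> \<circ> P) has_vector_derivative g s) (at s within {ss ! i..ss ! Suc i})"
    and n: "\<And>s. s \<in> {ss ! i..ss ! Suc i} \<Longrightarrow> norm (g s) = v"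
    by (rule arcD[OF i(1)]) blast
  have s: "s \<in> {ss ! i..ss ! Suc i}"
    using i by auto
  show "((\<iota> \<circ> P) has_vector_derivative velocity s) (at_right s)" "norm (velocity s) = v"
    using velocity_right_eq[OF i(2,3) g[OF s]] n[OF s] by simp_all
qed

lemma velocity_left_props:
  assumes "0 < s" "s \<le> l"
  shows "((\<iota> \<circ> P) has_vector_derivative velocity_left s) (at_left s)" "norm (velocity_left s) = v"
proof -
  obtain i where i: "Suc i < length ss" "ss ! i < s" "s \<le> ss ! Suc i"
    using arc_to_left assms by blast
  obtain g g' where g: "\<And>s. s \<in> {ss ! i..ss ! Suc i} \<Longrightarrow> ((\<iota> \<circ> P) has_vector_derivative g s) (at s within {ss ! i..ss ! Suc i})"
    and n: "\<And>s. s \<in> {ss ! i..ss ! Suc i} \<Longrightarrow> norm (g s) = v"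
    by (rule arcD[OF i(1)]) blast
  have s: "s \<in> {ss ! i..ss ! Suc i}"
    using i by auto
  show "((\<iota> \<circ> P) has_vector_derivative velocity_left s) (at_left s)" "norm (velocity_left s) = v"
    using velocity_left_eq[OF i(2,3) g[OF s]] n[OF s] by simp_all
qed

lemma not_vertex_interior:
  assumes "s \<in> {0<..<l} - set ss"
  obtains i where "Suc i < length ss" "ss ! i < s" "s < ss ! Suc i"
proof -
  obtain i where i: "Suc i < length ss" "ss ! i \<le> s" "s < ss ! Suc i"
    using arc_to_right[of s] assms by auto
  moreover have "ss ! i \<noteq> s"
    using assms i(1) by (metis DiffD2 Suc_lessD nth_mem)
  ultimately show ?thesis
    using that[of i] by simp
qed

lemma velocity_derivative:
  assumes "s \<in> {0<..<l} - set ss"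
  shows "((\<iota> \<circ> P) has_vector_derivative velocity s) (at s)"
proof -
  obtain i where i: "Suc i < length ss" "ss ! i < s" "s < ss ! Suc i"
    using not_vertex_interior assms by blast
  obtain g g' where g: "\<And>s. s \<in> {ss ! i..ss ! Suc i} \<Longrightarrow> ((\<iota> \<circ> P) has_vector_derivative g s) (at s within {ss ! i..ss ! Suc i})"
    by (rule arcD[OF i(1)]) blast
  have s: "s \<in> {ss ! i..ss ! Suc i}"
    using i by auto
  have "at s within {ss ! i..ss ! Suc i} = at s"
    using i by (simp add: at_within_Icc_at)
  then show ?thesis
    using velocity_right_eq(2)[OF _ i(3) g[OF s]] g[OF s] i(2) by simp
qed

lemma velocity_tangent:
  assumes "immersed_surface M \<iota>" "0 \<le> s" "s < l"
  shows "velocity s \<in> tangent_plane M \<iota> (P s)"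
proof (rule curve_derivative_tangent[OF assms(1), where S="{s..l}"])
  show "continuous (at s within {s..l}) P"
    using continuous_on_polygon assms(2,3)
    by (metis atLeastAtMost_iff atLeastatMost_subset_iff continuous_on_eq_continuous_within continuous_on_subset less_imp_le order_refl)
  show "P ` {s..l} \<subseteq> M"
    using polygon_in_M assms by auto
  show "((\<iota> \<circ> P) has_vector_derivative velocity s) (at s within {s..l})"
    using velocity_props(1)[OF assms(2,3)] assms(3) by (simp add: at_within_Icc_at_right)
qed (use assms(3) in \<open>auto simp: at_within_Icc_at_right\<close>)

text \<open>The velocity of a geodesic is parallel along it, so \<open>C\<close> bounds the
  acceleration at interior points; the mean value inequality does the rest, also up to the ends of
  the arc.\<close>

lemma velocity_arc:
  assumes imm: "immersed_surface M \<iota>"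
    and C: "\<And>s u w z. s \<in> {0<..<l} \<Longrightarrow> parallel_at M \<iota> (P s) u w z \<Longrightarrow> norm z \<le> C * norm u * norm w"
    and i: "Suc i < length ss" and st: "ss ! i \<le> s" "s \<le> t" "t \<le> ss ! Suc i"
    and g: "\<And>s. s \<in> {ss ! i..ss ! Suc i} \<Longrightarrow> ((\<iota> \<circ> P) has_vector_derivative g s) (at s within {ss ! i..ss ! Suc i})"
    and g': "\<And>s. s \<in> {ss ! i..ss ! Suc i} \<Longrightarrow> (g has_vector_derivative g' s) (at s within {ss ! i..ss ! Suc i})"
    and n: "\<And>s. s \<in> {ss ! i..ss ! Suc i} \<Longrightarrow> norm (g s) = v"
    and perp: "\<And>s w. s \<in> {ss ! i..ss ! Suc i} \<Longrightarrow> w \<in> tangent_plane M \<iota> (P s) \<Longrightarrow> g' s \<bullet> w = 0"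
  shows "norm (g t - g s) \<le> C * v * v * (t - s)"
proof (cases "s = t")
  case False
  then have "s < t" using st by simp
  let ?I = "{ss ! i<..<ss ! Suc i}"
  have int: "0 < x \<and> x < l" if "x \<in> ?I" for x
    using that nth_bounds[of i] nth_bounds[of "Suc i"] i by auto
  have "norm (g' x) \<le> C * v * v" if x: "x \<in> ?I" for x
  proof -
    have at: "at y within {ss ! i..ss ! Suc i} = at y" if "y \<in> ?I" for y
      using that by (simp add: at_within_Icc_at)
    have gv: "g y = velocity y" if "y \<in> ?I" for y
      using velocity_right_eq(2)[OF _ _ g[of y]] that by auto
    have contP: "isCont P x"
    proof -
      have "continuous (at x within {0..l}) P"
        using continuous_on_polygon int[OF x] by (auto simp: continuous_on_eq_continuous_within)
      then show ?thesis
        using int[OF x] by (simp add: at_within_Icc_at[of 0 x l])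
    qed
    have "parallel_at M \<iota> (P x) (g x) (g x) (g' x)"
      unfolding parallel_at_def
    proof (rule exI[of _ P], rule exI[of _ g], rule exI[of _ x], rule exI[of _ ?I], intro conjI ballI)
      show "P ` ?I \<subseteq> M"
        using polygon_in_M int by (auto simp: less_imp_le)
      show "((\<iota> \<circ> P) has_vector_derivative g x) (at x)" "(g has_vector_derivative g' x) (at x)"
        using g[of x] g'[of x] x at[OF x] by auto
      show "g y \<in> tangent_plane M \<iota> (P y)" if "y \<in> ?I" for y
        using velocity_tangent[OF imm, of y] gv[OF that] int[OF that] by simp
      show "g' x \<bullet> w = 0" if "w \<in> tangent_plane M \<iota> (P x)" for w
        using perp[OF _ that] x by simp
    qed (use x contP in auto)
    then show ?thesis
      using C[of x "g x" "g x" "g' x"] int[OF x] n[of x] x by simp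
  qed
  moreover have "\<exists>x\<in>{s<..<t}. norm (g t - g s) \<le> norm ((t - s) *\<^sub>R g' x)"
  proof (rule mvt_general[OF \<open>s < t\<close>])
    show "continuous_on {s..t} g"
      using g' st by (intro continuous_on_subset[OF continuous_on_vector_derivative[OF g']]) auto
    show "(g has_derivative (\<lambda>h. h *\<^sub>R g' x)) (at x)" if "s < x" "x < t" for x
      using g'[of x] that st by (simp add: has_vector_derivative_def at_within_Icc_at)
  qed
  then obtain x where x: "x \<in> {s<..<t}" "norm (g t - g s) \<le> norm ((t - s) *\<^sub>R g' x)" by blast
  ultimately have "norm (g' x) \<le> C * v * v"
    using st by auto
  have "norm (g t - g s) \<le> (t - s) * norm (g' x)"
    using x(2) \<open>s < t\<close> by simp
  also have "\<dots> \<le> (t - s) * (C * v * v)"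
    using \<open>norm (g' x) \<le> C * v * v\<close> \<open>s < t\<close> by (intro mult_left_mono) auto
  also have "\<dots> = C * v * v * (t - s)"
    by (rule mult.commute)
  finally show ?thesis .
qed simp

definition vertex_angle :: "real \<Rightarrow> real" where
  "vertex_angle s = vec_angle (velocity_left s) (velocity s)"

lemma vertex_angle_nonneg:
  assumes "0 < s" "s < l"
  shows "0 \<le> vertex_angle s"
proof -
  have "norm (velocity s - velocity_left s) \<le> v * vertex_angle s"
    unfolding vertex_angle_def
    using velocity_left_props(2)[of s] velocity_props(2)[of s] assms v_pos by (intro norm_diff_le_vec_angle) auto
  then have "0 \<le> v * vertex_angle s"
    using norm_ge_zero order_trans by blast
  then show ?thesis
    using v_pos by (simp add: zero_le_mult_iff)
qed

lemma rotation_eq: "rotation \<iota> l ss P = (\<Sum>s\<in>set ss \<inter> {0<..<l}. vertex_angle s)"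
  unfolding rotation_def vertex_angle_def velocity_def velocity_left_def ..

text \<open>Induction on the number of vertices between \<open>s\<close> and \<open>t\<close>. After
  the last vertex \<open>\<sigma>\<close> only the curvature of the surface acts, at
  \<open>\<sigma>\<close> the turning angle is added, and before it one steps back along the arc
  that ends there.\<close>

lemma velocity_variation:
  assumes imm: "immersed_surface M \<iota>"
    and C: "\<And>s u w z. s \<in> {0<..<l} \<Longrightarrow> parallel_at M \<iota> (P s) u w z \<Longrightarrow> norm z \<le> C * norm u * norm w"
    and "0 \<le> s"
  shows "s \<le> t \<Longrightarrow> t < l \<Longrightarrow> norm (velocity t - velocity s) \<le>
    C * v * v * (t - s) + v * (\<Sum>\<sigma>\<in>set ss \<inter> {0<..<l} \<inter> {s<..t}. vertex_angle \<sigma>)"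
proof (induction "card (set ss \<inter> {0<..<l} \<inter> {s<..t})" arbitrary: t rule: less_induct)
  case less
  let ?V = "set ss \<inter> {0<..<l}"
  have same_arc: "norm (velocity t - velocity x) \<le> C * v * v * (t - x)"
    if x: "0 \<le> x" "x \<le> t" and none: "?V \<inter> {x<..t} = {}" for x
  proof -
    have "x < l" using x less.prems by simp
    then obtain i where i: "Suc i < length ss" "ss ! i \<le> x" "x < ss ! Suc i"
      using arc_to_right x by blast
    have "t < ss ! Suc i"
    proof (rule ccontr)
      assume "\<not> t < ss ! Suc i"
      then have "ss ! Suc i \<in> ?V \<inter> {x<..t}"
        using i x less.prems by auto
      then show False using none by blast
    qed
    obtain g g' where g: "\<And>s. s \<in> {ss ! i..ss ! Suc i} \<Longrightarrow> ((\<iota> \<circ> P) has_vector_derivative g s) (at s within {ss ! i..ss ! Suc i})"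
      and g': "\<And>s. s \<in> {ss ! i..ss ! Suc i} \<Longrightarrow> (g has_vector_derivative g' s) (at s within {ss ! i..ss ! Suc i})"
      and n: "\<And>s. s \<in> {ss ! i..ss ! Suc i} \<Longrightarrow> norm (g s) = v"
      and p: "\<And>s w. s \<in> {ss ! i..ss ! Suc i} \<Longrightarrow> w \<in> tangent_plane M \<iota> (P s) \<Longrightarrow> g' s \<bullet> w = 0"
      by (rule arcD[OF i(1)]) blast
    have "norm (g t - g x) \<le> C * v * v * (t - x)"
      by (rule velocity_arc[OF imm C i(1) i(2) x(2) _ g g' n p]) (use \<open>t < ss ! Suc i\<close> in auto)
    moreover have "velocity t = g t" "velocity x = g x"
      using velocity_right_eq(2)[OF _ _ g] i x \<open>t < ss ! Suc i\<close> by auto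
    ultimately show ?thesis by simp
  qed
  show ?case
  proof (cases "?V \<inter> {s<..t} = {}")
    case True
    then show ?thesis
      using same_arc[OF \<open>0 \<le> s\<close> \<open>s \<le> t\<close> True] by simp
  next
    case False
    define \<sigma> where "\<sigma> = Max (?V \<inter> {s<..t})"
    have fin: "finite (?V \<inter> {s<..t})" by simp
    have \<sigma>: "\<sigma> \<in> ?V" "s < \<sigma>" "\<sigma> \<le> t"
      using Max_in[OF fin False] by (auto simp: \<sigma>_def)
    have "?V \<inter> {\<sigma><..t} = {}"
    proof (rule ccontr)
      assume "?V \<inter> {\<sigma><..t} \<noteq> {}"
      then obtain x where "x \<in> ?V \<inter> {\<sigma><..t}" by blast
      then have "x \<le> \<sigma>" "\<sigma> < x"
        using Max_ge[OF fin, of x] \<sigma>(2) by (auto simp: \<sigma>_def[symmetric])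
      then show False by simp
    qed
    then have 1: "norm (velocity t - velocity \<sigma>) \<le> C * v * v * (t - \<sigma>)"
      using same_arc[of \<sigma>] \<sigma> by auto
    have 2: "norm (velocity \<sigma> - velocity_left \<sigma>) \<le> v * vertex_angle \<sigma>"
      unfolding vertex_angle_def
      using velocity_left_props(2)[of \<sigma>] velocity_props(2)[of \<sigma>] \<sigma> v_pos by (intro norm_diff_le_vec_angle) auto
    obtain i where i: "Suc i < length ss" "ss ! i < \<sigma>" "\<sigma> \<le> ss ! Suc i"
      using arc_to_left[of \<sigma>] \<sigma> by auto
    \<comment> \<open>A time on the arc ending at \<open>\<sigma>\<close>, but not before
      \<open>s\<close>. Since \<open>\<tau> < \<sigma>\<close>, the interval from \<open>s\<close>
      to \<open>\<tau>\<close> contains fewer vertices and the induction hypothesis applies.\<close>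
    define \<tau> where "\<tau> = max s (ss ! i)"
    have \<tau>: "s \<le> \<tau>" "ss ! i \<le> \<tau>" "\<tau> < \<sigma>"
      using i \<sigma> by (auto simp: \<tau>_def)
    obtain g g' where g: "\<And>s. s \<in> {ss ! i..ss ! Suc i} \<Longrightarrow> ((\<iota> \<circ> P) has_vector_derivative g s) (at s within {ss ! i..ss ! Suc i})"
      and g': "\<And>s. s \<in> {ss ! i..ss ! Suc i} \<Longrightarrow> (g has_vector_derivative g' s) (at s within {ss ! i..ss ! Suc i})"
      and n: "\<And>s. s \<in> {ss ! i..ss ! Suc i} \<Longrightarrow> norm (g s) = v"
      and p: "\<And>s w. s \<in> {ss ! i..ss ! Suc i} \<Longrightarrow> w \<in> tangent_plane M \<iota> (P s) \<Longrightarrow> g' s \<bullet> w = 0"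
      by (rule arcD[OF i(1)]) blast
    have "norm (g \<sigma> - g \<tau>) \<le> C * v * v * (\<sigma> - \<tau>)"
      by (rule velocity_arc[OF imm C i(1) \<tau>(2) _ i(3) g g' n p]) (use \<tau> in auto)
    moreover have "velocity \<tau> = g \<tau>"
      using velocity_right_eq(2)[OF \<tau>(2) _ g] i \<tau> by auto
    moreover have "velocity_left \<sigma> = g \<sigma>"
      using velocity_left_eq(2)[OF i(2,3) g] i by auto
    ultimately have 3: "norm (velocity_left \<sigma> - velocity \<tau>) \<le> C * v * v * (\<sigma> - \<tau>)" by simp
    define A where "A = ?V \<inter> {s<..\<tau>}"
    define B where "B = ?V \<inter> {s<..t}"
    have "x \<in> B - {\<sigma>}" if "x \<in> A" for x
      using that \<tau>(3) \<sigma>(3) unfolding A_def B_def by simp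
    then have sub: "A \<subseteq> B - {\<sigma>}" by blast
    have "\<sigma> \<in> B"
      using \<sigma> by (simp add: B_def)
    then have "A \<subset> B"
      using sub by blast
    then have less_card: "card A < card B"
      by (rule psubset_card_mono[rotated]) (simp add: B_def)
    note sub = sub[unfolded A_def B_def] and less_card = less_card[unfolded A_def B_def]
    have 4: "norm (velocity \<tau> - velocity s) \<le> C * v * v * (\<tau> - s) + v * (\<Sum>\<sigma>\<in>?V \<inter> {s<..\<tau>}. vertex_angle \<sigma>)"
      by (rule less.hyps[OF less_card]) (use \<tau> \<sigma> less.prems in auto)
    have "(\<Sum>\<sigma>\<in>?V \<inter> {s<..\<tau>}. vertex_angle \<sigma>) \<le> (\<Sum>\<sigma>\<in>?V \<inter> {s<..t} - {\<sigma>}. vertex_angle \<sigma>)"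
      by (rule sum_mono2[OF _ sub]) (auto intro: vertex_angle_nonneg)
    moreover have "(\<Sum>\<sigma>\<in>?V \<inter> {s<..t}. vertex_angle \<sigma>) = vertex_angle \<sigma> + (\<Sum>\<sigma>\<in>?V \<inter> {s<..t} - {\<sigma>}. vertex_angle \<sigma>)"
      by (rule sum.remove[OF fin]) (use \<sigma> in auto)
    ultimately have "(\<Sum>\<sigma>\<in>?V \<inter> {s<..\<tau>}. vertex_angle \<sigma>) + vertex_angle \<sigma> \<le> (\<Sum>\<sigma>\<in>?V \<inter> {s<..t}. vertex_angle \<sigma>)"
      by simp
    then have 5: "v * (\<Sum>\<sigma>\<in>?V \<inter> {s<..\<tau>}. vertex_angle \<sigma>) + v * vertex_angle \<sigma> \<le> v * (\<Sum>\<sigma>\<in>?V \<inter> {s<..t}. vertex_angle \<sigma>)"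
      using v_pos by (simp flip: distrib_left)
    have "norm (velocity t - velocity s) \<le> norm (velocity t - velocity \<sigma>) + norm (velocity \<sigma> - velocity_left \<sigma>) +
        norm (velocity_left \<sigma> - velocity \<tau>) + norm (velocity \<tau> - velocity s)"
      by norm
    also have "\<dots> \<le> C * v * v * (t - \<sigma>) + C * v * v * (\<sigma> - \<tau>) + C * v * v * (\<tau> - s) + v * (\<Sum>\<sigma>\<in>?V \<inter> {s<..t}. vertex_angle \<sigma>)"
      using 1 2 3 4 5 by linarith
    also have "\<dots> = C * v * v * (t - s) + v * (\<Sum>\<sigma>\<in>?V \<inter> {s<..t}. vertex_angle \<sigma>)"
      by (simp add: algebra_simps)
    finally show ?thesis .
  qed
qed

end

lemma continuous_at_right_step:
  fixes a c :: real
  shows "continuous (at_right x) (\<lambda>x. if a \<le> x then c else 0)"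
proof (cases "a \<le> x")
  case True
  then have "\<forall>\<^sub>F y in at_right x. (if a \<le> y then c else 0) = c"
    unfolding eventually_at_right_field by (intro exI[of _ "x + 1"]) auto
  then show ?thesis
    using True by (simp add: continuous_within tendsto_eventually)
next
  case False
  then have "\<forall>\<^sub>F y in at_right x. (if a \<le> y then c else 0) = 0"
    unfolding eventually_at_right_field by (intro exI[of _ a]) auto
  then show ?thesis
    using False by (simp add: continuous_within tendsto_eventually)
qed

context constant_speed_polygon
begin

text \<open>The velocity is extended by 0 because Helly's theorem works on the whole line. Its
  majorant is the sum of a linear part \<open>A\<close> from the surface curvature, the turning
  angles \<open>B\<close> met so far, and a part \<open>J\<close> for the two jumps of the extension
  at \<open>0\<close> and \<open>l\<close>, whence the summand 2.\<close>

lemma velocity_control: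
  assumes imm: "immersed_surface M \<iota>" and "0 \<le> C"
    and C: "\<And>s u w z. s \<in> {0<..<l} \<Longrightarrow> parallel_at M \<iota> (P s) u w z \<Longrightarrow> norm z \<le> C * norm u * norm w"
    and rot: "rotation \<iota> l ss P \<le> K" and "v \<le> 1"
  defines "g \<equiv> \<lambda>s. if 0 \<le> s \<and> s < l then velocity s else 0"
  obtains W where "mono W" "\<And>x. continuous (at_right x) W" "\<And>x. \<bar>W x\<bar> \<le> C * l + K + 2"
    "\<And>s t. s \<le> t \<Longrightarrow> norm (g t - g s) \<le> W t - W s"
proof -
  let ?V = "set ss \<inter> {0<..<l}"
  define A where "A x = C * v * v * max 0 (min x l)" for x
  define B where "B x = (\<Sum>\<sigma>\<in>?V. if \<sigma> \<le> x then vertex_angle \<sigma> else 0)" for x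
  define J where "J x = (if 0 \<le> x then v else 0) + (if l \<le> x then v else 0)" for x
  define W where "W x = A x + v * B x + J x" for x
  have va: "0 \<le> vertex_angle \<sigma>" if "\<sigma> \<in> ?V" for \<sigma>
    using vertex_angle_nonneg that by auto
  have Amono: "A s \<le> A t" if "s \<le> t" for s t
    unfolding A_def using that \<open>0 \<le> C\<close> v_pos by (intro mult_left_mono) auto
  have Bmono: "B s \<le> B t" if "s \<le> t" for s t
    unfolding B_def using that va by (intro sum_mono) auto
  have Jmono: "J s \<le> J t" if "s \<le> t" for s t
    unfolding J_def using that v_pos by auto
  have mono: "mono W"
    unfolding W_def using v_pos by (intro monoI add_mono mult_left_mono Amono Bmono Jmono) auto
  have rcont: "continuous (at_right x) W" for x
    unfolding W_def[abs_def] A_def B_def J_def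
    by (intro continuous_add continuous_mult continuous_sum continuous_const continuous_at_right_step
        continuous_max continuous_min continuous_ident)
  have "0 \<le> B x \<and> B x \<le> K" for x
  proof
    show "0 \<le> B x"
      unfolding B_def using va by (intro sum_nonneg) auto
    have "B x \<le> (\<Sum>\<sigma>\<in>?V. vertex_angle \<sigma>)"
      unfolding B_def using va by (intro sum_mono) auto
    then show "B x \<le> K"
      using rot by (simp add: rotation_eq)
  qed
  moreover have "0 \<le> A x \<and> A x \<le> C * l" for x
  proof
    show "0 \<le> A x"
      using \<open>0 \<le> C\<close> v_pos by (simp add: A_def)
    have "v * v \<le> 1"
      using v_pos \<open>v \<le> 1\<close> by (simp add: mult_le_one)
    then have "C * (v * v) \<le> C * 1"
      using \<open>0 \<le> C\<close> by (rule mult_left_mono)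
    then have "(C * (v * v)) * max 0 (min x l) \<le> C * l"
      using \<open>0 \<le> C\<close> l_pos by (intro mult_mono) auto
    then show "A x \<le> C * l"
      by (simp add: A_def mult.assoc)
  qed
  moreover have "0 \<le> J x \<and> J x \<le> 2" for x
    using v_pos \<open>v \<le> 1\<close> by (simp add: J_def)
  moreover have "v * B x \<le> B x" if "0 \<le> B x" for x
    using that \<open>v \<le> 1\<close> v_pos by (simp add: mult_left_le_one_le)
  ultimately have bound: "\<bar>W x\<bar> \<le> C * l + K + 2" for x
    unfolding W_def using v_pos by (smt (verit) mult_nonneg_nonneg)
  have var: "norm (g t - g s) \<le> W t - W s" if "s \<le> t" for s t
  proof -
    have incr: "0 \<le> A t - A s" "0 \<le> v * B t - v * B s" "0 \<le> J t - J s"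
      using Amono[OF that] Bmono[OF that] Jmono[OF that] v_pos by auto
    have nv: "norm (g x) \<le> v" for x
      unfolding g_def using velocity_props(2)[of x] v_pos by auto
    consider "0 \<le> s" "t < l" | "t < 0 \<or> l \<le> s" | "s < 0" "0 \<le> t" "t < l" | "0 \<le> s" "s < l" "l \<le> t" | "s < 0" "l \<le> t"
      using that by linarith
    then show ?thesis
    proof cases
      case 1
      have "B t - B s = (\<Sum>\<sigma>\<in>?V. if \<sigma> \<in> {s<..t} then vertex_angle \<sigma> else 0)"
        unfolding B_def sum_subtractf[symmetric] using that by (intro sum.cong) auto
      also have "\<dots> = (\<Sum>\<sigma>\<in>?V \<inter> {s<..t}. vertex_angle \<sigma>)"
        by (subst sum.inter_restrict) auto
      finally have "v * B t - v * B s = v * (\<Sum>\<sigma>\<in>?V \<inter> {s<..t}. vertex_angle \<sigma>)"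
        by (simp flip: right_diff_distrib)
      moreover have "A t - A s = C * v * v * (t - s)"
        using 1 that by (simp add: A_def right_diff_distrib)
      moreover have "norm (g t - g s) \<le> C * v * v * (t - s) + v * (\<Sum>\<sigma>\<in>?V \<inter> {s<..t}. vertex_angle \<sigma>)"
        using velocity_variation[OF imm C 1(1) that 1(2)] 1 that by (simp add: g_def)
      ultimately show ?thesis
        using incr by (simp add: W_def)
    next
      case 2
      then have "g t = 0" "g s = 0"
        using that by (auto simp: g_def)
      then show ?thesis
        using incr by (simp add: W_def)
    next
      case 3
      then have "g s = 0" "J t - J s = v"
        using l_pos by (auto simp: g_def J_def)
      then show ?thesis
        using incr nv[of t] by (simp add: W_def)
    next
      case 4
      then have "g t = 0" "J t - J s = v"
        using l_pos by (auto simp: g_def J_def)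
      then show ?thesis
        using incr nv[of s] by (simp add: W_def)
    next
      case 5
      then have "g s = 0" "g t = 0"
        by (auto simp: g_def)
      then show ?thesis
        using incr by (simp add: W_def)
    qed
  qed
  show ?thesis
    using that[OF mono rcont bound var] .
qed

end

section \<open>Change of the parameter interval and the bound on rotations\<close>

lemma has_vector_derivative_rescale:
  fixes f :: "real \<Rightarrow> 'a::real_normed_vector"
  assumes "(f has_vector_derivative d) (at (k * x) within (\<lambda>x. k * x) ` S)"
  shows "((\<lambda>x. f (k * x)) has_vector_derivative k *\<^sub>R d) (at x within S)"
proof -
  have "((\<lambda>x. k * x) has_vector_derivative k) (at x within S)"
    by (auto intro!: derivative_eq_intros)
  from vector_diff_chain_within[OF this assms] show ?thesis
    by (simp add: o_def)
qed

lemma image_mult_Icc: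
  fixes k :: real
  assumes "0 < k"
  shows "(\<lambda>x. k * x) ` {p / k..q / k} = {p..q}"
proof (intro set_eqI iffI)
  fix y assume "y \<in> {p..q}"
  then have "y = k * (y / k)" "y / k \<in> {p / k..q / k}"
    using assms by (auto simp: divide_right_mono)
  then show "y \<in> (\<lambda>x. k * x) ` {p / k..q / k}" by blast
qed (use assms in \<open>auto simp: field_simps\<close>)

lemma geodesic_arc_rescale:
  assumes "0 < k" and arc: "geodesic_arc M \<iota> v \<gamma> p q"
  shows "geodesic_arc M \<iota> (k * v) (\<lambda>x. \<gamma> (k * x)) (p / k) (q / k)"
proof -
  obtain g g' where cont: "continuous_on {p..q} \<gamma>" "\<gamma> ` {p..q} \<subseteq> M"
    and g: "\<And>s. s \<in> {p..q} \<Longrightarrow> ((\<iota> \<circ> \<gamma>) has_vector_derivative g s) (at s within {p..q}) \<and>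
        (g has_vector_derivative g' s) (at s within {p..q}) \<and> norm (g s) = v \<and> (\<forall>w\<in>tangent_plane M \<iota> (\<gamma> s). g' s \<bullet> w = 0)"
    using arc unfolding geodesic_arc_def by blast
  note im = image_mult_Icc[OF \<open>0 < k\<close>, of p q]
  have inI: "k * x \<in> {p..q}" if "x \<in> {p / k..q / k}" for x
    using im that by blast
  have 1: "continuous_on {p / k..q / k} (\<lambda>x. \<gamma> (k * x))"
    by (rule continuous_on_compose2[OF cont(1)]) (use im in \<open>auto intro!: continuous_intros\<close>)
  have 2: "(\<lambda>x. \<gamma> (k * x)) ` {p / k..q / k} \<subseteq> M"
    using cont(2) inI by blast
  have 3: "((\<iota> \<circ> (\<lambda>x. \<gamma> (k * x))) has_vector_derivative k *\<^sub>R g (k * s)) (at s within {p / k..q / k}) \<and>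
      ((\<lambda>x. k *\<^sub>R g (k * x)) has_vector_derivative k *\<^sub>R k *\<^sub>R g' (k * s)) (at s within {p / k..q / k}) \<and>
      norm (k *\<^sub>R g (k * s)) = k * v \<and> (\<forall>w\<in>tangent_plane M \<iota> (\<gamma> (k * s)). (k *\<^sub>R k *\<^sub>R g' (k * s)) \<bullet> w = 0)"
    if "s \<in> {p / k..q / k}" for s
  proof (intro conjI)
    show "((\<iota> \<circ> (\<lambda>x. \<gamma> (k * x))) has_vector_derivative k *\<^sub>R g (k * s)) (at s within {p / k..q / k})"
      using has_vector_derivative_rescale[of "\<iota> \<circ> \<gamma>" "g (k * s)" k s "{p / k..q / k}"] g[OF inI[OF that]] unfolding im
      by (simp add: o_def)
    have "((\<lambda>x. g (k * x)) has_vector_derivative k *\<^sub>R g' (k * s)) (at s within {p / k..q / k})"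
      using has_vector_derivative_rescale[of g "g' (k * s)" k s "{p / k..q / k}"] g[OF inI[OF that]] unfolding im by simp
    then show "((\<lambda>x. k *\<^sub>R g (k * x)) has_vector_derivative k *\<^sub>R k *\<^sub>R g' (k * s)) (at s within {p / k..q / k})"
      by (rule bounded_linear.has_vector_derivative[OF bounded_linear_scaleR_right])
  qed (use g[OF inI[OF that]] \<open>0 < k\<close> in auto)
  show ?thesis
    unfolding geodesic_arc_def using 1 2 3
    by (intro conjI exI[of _ "\<lambda>s. k *\<^sub>R g (k * s)"] exI[of _ "\<lambda>s. k *\<^sub>R k *\<^sub>R g' (k * s)"] ballI) auto
qed

lemma chord_sum_map: "chord_sum (\<lambda>x. f (h x)) xs = chord_sum f (map h xs)"
  unfolding chord_sum_def by (rule sum.cong) auto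

lemma curve_length_rescale_le:
  assumes "0 < k"
  shows "curve_length (\<lambda>x. f (k * x)) (p / k) (q / k) \<le> curve_length f p q"
  unfolding curve_length_alt
proof (rule SUP_mono, clarify)
  fix xs :: "real list" assume xs: "sorted xs" "set xs \<subseteq> {p / k..q / k}"
  have "sorted (map (\<lambda>x. k * x) xs)"
    using xs(1) assms by (simp add: sorted_map sorted_wrt_mono_rel[of _ "(\<le>)"] mult_left_mono)
  moreover have "set (map (\<lambda>x. k * x) xs) \<subseteq> {p..q}"
    using xs(2) image_mult_Icc[OF assms, of p q] by auto
  ultimately show "\<exists>ys\<in>{xs. sorted xs \<and> set xs \<subseteq> {p..q}}. ereal (chord_sum (\<lambda>x. f (k * x)) xs) \<le> ereal (chord_sum f ys)"
    by (intro bexI[of _ "map (\<lambda>x. k * x) xs"]) (auto simp: chord_sum_map[of f "\<lambda>x. k * x"])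
qed

lemma curve_length_rescale:
  assumes "0 < k"
  shows "curve_length (\<lambda>x. f (k * x)) (p / k) (q / k) = curve_length f p q"
proof (rule antisym[OF curve_length_rescale_le[OF assms]])
  have "curve_length (\<lambda>x. (\<lambda>y. f (k * y)) (inverse k * x)) (p / k / inverse k) (q / k / inverse k) \<le>
      curve_length (\<lambda>y. f (k * y)) (p / k) (q / k)"
    by (rule curve_length_rescale_le) (use assms in simp)
  then show "curve_length f p q \<le> curve_length (\<lambda>x. f (k * x)) (p / k) (q / k)"
    using assms by (simp add: mult.assoc[symmetric])
qed

lemma vec_angle_scaleR:
  assumes "0 < k"
  shows "vec_angle (k *\<^sub>R u) (k *\<^sub>R w) = vec_angle u w"
  unfolding vec_angle_def using assms by simp

text \<open>\<open>total_curvature\<close> is defined with polygonals parameterized on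
  \<open>[0, 1]\<close>, the given ones live on \<open>[0, L]\<close>; the vertices on
  \<open>c\<close>, and with them the modulus, are unchanged.\<close>

lemma inscribed_rescale:
  assumes ins: "inscribed M \<iota> c a b L ts ss P"
  defines "ss' \<equiv> map (\<lambda>s. s / L) ss" and "P' \<equiv> \<lambda>x. P (L * x)"
  shows "inscribed M \<iota> c a b 1 ts ss' P'" and "rotation \<iota> 1 ss' P' = rotation \<iota> L ss P"
proof -
  have pol: "polygonal M \<iota> L ss P" and len: "length ts = length ss"
    using ins by (auto simp: inscribed_def)
  then obtain v where "constant_speed_polygon M \<iota> L ss P v"
    using polygonal_speed by blast
  then interpret constant_speed_polygon M \<iota> L ss P v .
  have ne: "ss \<noteq> []"
    using length_ss by auto
  have "sorted ss'"
    using sorted_ss l_pos unfolding ss'_def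
    by (simp add: sorted_map sorted_wrt_mono_rel[of _ "(\<le>)"] divide_right_mono)
  moreover have "hd ss' = 0" "last ss' = 1"
    using hd_ss last_ss l_pos ne by (auto simp: ss'_def hd_map last_map)
  moreover have "geodesic_arc M \<iota> (L * v) P' (ss' ! i) (ss' ! Suc i)" if "Suc i < length ss'" for i
    using geodesic_arc_rescale[OF l_pos arcs[of i]] that by (simp add: ss'_def P'_def)
  moreover have "0 < L * v"
    using l_pos v_pos by simp
  ultimately have "polygonal M \<iota> 1 ss' P'"
    unfolding polygonal_def using length_ss by (auto simp: ss'_def)
  moreover have "curve_length (\<iota> \<circ> P') (ss' ! i) (ss' ! Suc i) = curve_length (\<iota> \<circ> P) (ss ! i) (ss ! Suc i)"
    if "Suc i < length ss" for i
    using curve_length_rescale[OF l_pos, of "\<iota> \<circ> P"] that by (simp add: ss'_def P'_def o_def)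
  moreover have "P' (ss' ! i) = P (ss ! i)" if "i < length ss" for i
    using that l_pos by (simp add: ss'_def P'_def)
  ultimately show "inscribed M \<iota> c a b 1 ts ss' P'"
    using ins len unfolding inscribed_def by (auto simp: ss'_def)
  have set_eq: "set ss' \<inter> {0<..<1} = (\<lambda>s. s / L) ` (set ss \<inter> {0<..<L})"
    using l_pos by (auto simp: ss'_def field_simps)
  have right: "vector_derivative (\<iota> \<circ> P') (at_right (s / L)) = L *\<^sub>R velocity s"
    and left: "vector_derivative (\<iota> \<circ> P') (at_left (s / L)) = L *\<^sub>R velocity_left s" if s: "0 < s" "s < L" for s
  proof -
    have imr: "(\<lambda>x. L * x) ` {s / L<..} \<subseteq> {s<..}" and iml: "(\<lambda>x. L * x) ` {..<s / L} \<subseteq> {..<s}"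
      using l_pos by (auto simp: field_simps)
    have "((\<iota> \<circ> P) has_vector_derivative velocity s) (at (L * (s / L)) within (\<lambda>x. L * x) ` {s / L<..})"
      using has_vector_derivative_within_subset[OF velocity_props(1)[of s] imr] s l_pos by simp
    from has_vector_derivative_rescale[OF this]
    show "vector_derivative (\<iota> \<circ> P') (at_right (s / L)) = L *\<^sub>R velocity s"
      by (intro vector_derivative_within) (auto simp: P'_def o_def)
    have "((\<iota> \<circ> P) has_vector_derivative velocity_left s) (at (L * (s / L)) within (\<lambda>x. L * x) ` {..<s / L})"
      using has_vector_derivative_within_subset[OF velocity_left_props(1)[of s] iml] s l_pos by simp
    from has_vector_derivative_rescale[OF this]
    show "vector_derivative (\<iota> \<circ> P') (at_left (s / L)) = L *\<^sub>R velocity_left s"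
      by (intro vector_derivative_within) (auto simp: P'_def o_def)
  qed
  have "rotation \<iota> 1 ss' P' = (\<Sum>s\<in>set ss \<inter> {0<..<L}. vec_angle (vector_derivative (\<iota> \<circ> P') (at_left (s / L)))
      (vector_derivative (\<iota> \<circ> P') (at_right (s / L))))"
    unfolding rotation_def set_eq using l_pos by (subst sum.reindex) (auto simp: inj_on_def)
  also have "\<dots> = (\<Sum>s\<in>set ss \<inter> {0<..<L}. vertex_angle s)"
    by (intro sum.cong) (auto simp: left right vec_angle_scaleR[OF l_pos] vertex_angle_def)
  finally show "rotation \<iota> 1 ss' P' = rotation \<iota> L ss P"
    by (simp add: rotation_eq)
qed

text \<open>If the supremum were infinite for every positive \<open>\<epsilon>\<close>, it would be
  constant near 0 and its limit would be infinite as well.\<close>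

lemma rotation_bounded:
  assumes "total_curvature M \<iota> c a b < \<infinity>"
  obtains \<epsilon> K where "0 < \<epsilon>" "\<And>L ts ss P. inscribed M \<iota> c a b L ts ss P \<Longrightarrow> modulus M \<iota> c ts < ereal \<epsilon> \<Longrightarrow> rotation \<iota> L ss P \<le> K"
proof -
  define G where "G \<epsilon> = Sup {ereal (rotation \<iota> 1 ss P) | ts ss P. inscribed M \<iota> c a b 1 ts ss P \<and> modulus M \<iota> c ts < ereal \<epsilon>}" for \<epsilon>
  have "\<exists>\<epsilon>>0. G \<epsilon> < \<infinity>"
  proof (rule ccontr)
    assume "\<not> (\<exists>\<epsilon>>0. G \<epsilon> < \<infinity>)"
    then have "\<forall>\<^sub>F \<epsilon> in at_right 0. G \<epsilon> = \<infinity>"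
      unfolding eventually_at_right_field by (intro exI[of _ 1]) auto
    then have "Lim (at_right 0) G = \<infinity>"
      by (intro tendsto_Lim tendsto_eventually) auto
    then show False
      using assms unfolding total_curvature_def G_def by simp
  qed
  then obtain \<epsilon> where "0 < \<epsilon>" and G: "G \<epsilon> < \<infinity>" by blast
  obtain K where K: "G \<epsilon> \<le> ereal K"
    using G by (cases "G \<epsilon>") auto
  have "rotation \<iota> L ss P \<le> K" if ins: "inscribed M \<iota> c a b L ts ss P" and mod: "modulus M \<iota> c ts < ereal \<epsilon>" for L ts ss P
  proof -
    have "ereal (rotation \<iota> L ss P) \<le> G \<epsilon>"
      unfolding G_def inscribed_rescale(2)[OF ins, symmetric]
      using inscribed_rescale(1)[OF ins] mod by (intro Sup_upper) blast
    then have "ereal (rotation \<iota> L ss P) \<le> ereal K"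
      using K by (rule order_trans)
    then show ?thesis by simp
  qed
  then show ?thesis
    using that \<open>0 < \<epsilon>\<close> by blast
qed

subsection \<open>Convergence of inscribed polygonals\<close>

lemma (in surface_chart) immersion_tendsto_chart:
  assumes "(q \<longlongrightarrow> \<phi> x0) F" and "x0 \<in> D" and "\<forall>\<^sub>F h in F. q h \<in> M"
  shows "((\<lambda>h. \<iota> (q h)) \<longlongrightarrow> \<iota> (\<phi> x0)) F"
proof -
  have "isCont (\<iota> \<circ> \<phi>) x0"
    using has_derivative_continuous[OF has_derivative_chart[OF assms(2)]] .
  then have "((\<lambda>h. (\<iota> \<circ> \<phi>) (\<psi> (q h))) \<longlongrightarrow> (\<iota> \<circ> \<phi>) x0) F"
    by (rule isCont_tendsto_compose[OF _ eventually_in_chart(2)[OF assms]])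
  then have "((\<lambda>h. (\<iota> \<circ> \<phi>) (\<psi> (q h))) \<longlongrightarrow> \<iota> (\<phi> x0)) F"
    by simp
  then show ?thesis
    by (rule Lim_transform_eventually) (use eventually_in_chart(1)[OF assms] in \<open>auto elim!: eventually_mono\<close>)
qed

text \<open>Continuity of \<open>\<iota>\<close> along \<open>M\<close> is obtained from the charts,
  where \<open>\<iota> \<circ> \<phi>\<close> is differentiable.\<close>

lemma immersion_tendsto:
  assumes "immersed_surface M \<iota>" "p \<in> M" and "(q \<longlongrightarrow> p) F" and "\<forall>\<^sub>F h in F. q h \<in> M"
  shows "((\<lambda>h. \<iota> (q h)) \<longlongrightarrow> \<iota> p) F"
proof -
  obtain D \<phi> \<psi> x0 where "surface_chart M \<iota> D \<phi> \<psi>" and x0: "x0 \<in> D" "\<phi> x0 = p"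
    using ex_surface_chart assms(1,2) by metis
  then show ?thesis
    using surface_chart.immersion_tendsto_chart[of M \<iota> D \<phi> \<psi> q x0 F] assms by simp
qed

locale inscribed_sequence =
  fixes M :: "'m::t2_space set" and \<iota> :: "'m \<Rightarrow> 'a::euclidean_space" and c :: "real \<Rightarrow> 'm" and L :: real
    and ts ss :: "nat \<Rightarrow> real list" and P :: "nat \<Rightarrow> real \<Rightarrow> 'm" and v \<mu> :: "nat \<Rightarrow> real"
  assumes imm: "immersed_surface M \<iota>" and L_pos: "0 < L" and arc: "arc_length_curve M \<iota> c L"
    and poly: "\<And>h. inscribed_polygon M \<iota> L (ss h) (P h) (v h) c (ts h) (\<mu> h)"
    and mu: "\<mu> \<longlonglongrightarrow> 0"
begin

lemma v_bounds: "0 < v h \<and> v h \<le> 1"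
  using inscribed_polygon.v_le_1[OF poly] constant_speed_polygon.v_pos[OF inscribed_polygon.axioms(1)[OF poly]] by blast

text \<open>A fixed chord sum of \<open>c\<close> that nearly attains \<open>L\<close> is bounded by
  the length \<open>v h * L\<close> of the polygonal plus an error that vanishes with the
  modulus.\<close>

lemma speed_tendsto_1: "v \<longlonglongrightarrow> 1"
proof (rule LIMSEQ_I)
  fix e0 :: real assume "0 < e0"
  \<comment> \<open>One \<open>e\<close> is lost in the chord sum and one in the modulus term;
    together they cost \<open>e0 / 2\<close> after division by \<open>L\<close>.\<close>
  define e where "e = e0 * L / 4"
  have "0 < e"
    using \<open>0 < e0\<close> L_pos by (simp add: e_def)
  have "ereal (L - e) < curve_length (\<iota> \<circ> c) 0 L"
    using arc L_pos \<open>0 < e\<close> by (simp add: arc_length_curve_def)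
  then obtain xs where xs: "sorted xs" "set xs \<subseteq> {0..L}" and chord: "L - e < chord_sum (\<iota> \<circ> c) xs"
    unfolding curve_length_alt less_SUP_iff by auto
  have "(\<lambda>h. 2 * \<mu> h * real (length xs)) \<longlonglongrightarrow> 2 * 0 * real (length xs)"
    by (intro tendsto_mult tendsto_const mu)
  then have "\<forall>\<^sub>F h in sequentially. 2 * \<mu> h * real (length xs) < e"
    using \<open>0 < e\<close> by (intro order_tendstoD(2)) auto
  then obtain N where N: "\<And>h. h \<ge> N \<Longrightarrow> 2 * \<mu> h * real (length xs) < e"
    unfolding eventually_sequentially by blast
  have "norm (v h - 1) < e0" if "h \<ge> N" for h
  proof -
    have "L - e < v h * L + 2 * \<mu> h * real (length xs)"
      using chord inscribed_polygon.chord_sum_le_length[OF poly xs, of h] by linarith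
    then have "(1 - v h) * L < 2 * e"
      using N[OF that] by (simp add: algebra_simps)
    then have "(1 - v h) * L < (e0 / 2) * L"
      by (simp add: e_def mult.commute)
    then have "1 - v h < e0 / 2"
      using L_pos by simp
    then show ?thesis
      using v_bounds[of h] \<open>0 < e0\<close> by simp
  qed
  then show "\<exists>N. \<forall>h\<ge>N. norm (v h - 1) < e0" by blast
qed

text \<open>The conclusion is uniform for \<open>s\<close> near \<open>s0\<close>, as the later
  covering argument requires. The point \<open>P h s\<close> is joined by a short piece of the
  polygonal to a vertex \<open>c \<tau>\<close> in the trapping neighbourhood.\<close>

lemma eventually_in_neighbourhood:
  assumes s0: "s0 \<in> {0..L}" and U: "openin (top_of_set M) U" "c s0 \<in> U"
  obtains \<delta> where "0 < \<delta>" "\<forall>\<^sub>F h in sequentially. \<forall>s\<in>{0..L}. \<bar>s - s0\<bar> < \<delta> \<longrightarrow> P h s \<in> U"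
    "\<And>s. s \<in> {0..L} \<Longrightarrow> \<bar>s - s0\<bar> < \<delta> \<Longrightarrow> c s \<in> U"
proof (rule curve_trapped[OF imm U])
  fix V \<kappa>
  assume V: "openin (top_of_set M) V" "c s0 \<in> V" "0 < \<kappa>"
    and trap: "\<And>\<gamma> a (b::real). a \<le> b \<Longrightarrow> continuous_on {a..b} \<gamma> \<Longrightarrow> \<gamma> ` {a..b} \<subseteq> M \<Longrightarrow> \<gamma> a \<in> V \<Longrightarrow>
      (\<And>t. t \<in> {a..b} \<Longrightarrow> norm (\<iota> (\<gamma> t) - \<iota> (\<gamma> a)) \<le> \<kappa>) \<Longrightarrow> \<gamma> b \<in> U"
  obtain O1 where "open O1" and O1: "V \<inter> U = M \<inter> O1"
    using openin_Int[OF V(1) U(1)] openin_open by blast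
  have "c s0 \<in> O1"
    using O1 U V by blast
  moreover have "(c \<longlongrightarrow> c s0) (at s0 within {0..L})"
    using arc s0 by (simp add: arc_length_curve_def continuous_on_def)
  ultimately have "\<forall>\<^sub>F s in at s0 within {0..L}. c s \<in> O1"
    using \<open>open O1\<close> topological_tendstoD by blast
  then obtain \<delta> where "0 < \<delta>" and \<delta>: "\<And>s. s \<in> {0..L} \<Longrightarrow> s \<noteq> s0 \<Longrightarrow> dist s s0 < \<delta> \<Longrightarrow> c s \<in> O1"
    unfolding eventually_at by blast
  have cVU: "c s \<in> V \<inter> U" if "s \<in> {0..L}" "\<bar>s - s0\<bar> < \<delta>" for s
  proof -
    have "c s \<in> O1"
      using \<delta>[OF that(1)] that(2) \<open>c s0 \<in> O1\<close> by (cases "s = s0") (auto simp: dist_real_def)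
    moreover have "c s \<in> M"
      using arc that by (auto simp: arc_length_curve_def)
    ultimately show ?thesis
      using O1 by blast
  qed
  \<comment> \<open>The bound of \<open>close_vertex\<close> on the distance between the vertex
    parameter on \<open>c\<close> and \<open>s\<close> vanishes in the limit.\<close>
  have "(\<lambda>h. (1 - v h) * L + \<mu> h / v h) \<longlonglongrightarrow> (1 - 1) * L + 0 / 1"
    by (intro tendsto_add tendsto_mult tendsto_diff tendsto_divide tendsto_const speed_tendsto_1 mu) simp
  then have "\<forall>\<^sub>F h in sequentially. (1 - v h) * L + \<mu> h / v h < \<delta> / 2"
    using \<open>0 < \<delta>\<close> by (intro order_tendstoD(2)) auto
  moreover have "\<forall>\<^sub>F h in sequentially. \<mu> h < \<kappa>"
    using mu \<open>0 < \<kappa>\<close> by (rule order_tendstoD(2))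
  ultimately have ev: "\<forall>\<^sub>F h in sequentially. \<forall>s\<in>{0..L}. \<bar>s - s0\<bar> < \<delta> / 2 \<longrightarrow> P h s \<in> U"
  proof eventually_elim
    case (elim h)
    interpret inscribed_polygon M \<iota> L "ss h" "P h" "v h" c "ts h" "\<mu> h"
      by (rule poly)
    show ?case
    proof (intro ballI impI)
      fix s assume s: "s \<in> {0..L}" "\<bar>s - s0\<bar> < \<delta> / 2"
      obtain \<sigma> \<tau> where st: "0 \<le> \<sigma>" "\<sigma> \<le> s" "s - \<sigma> \<le> \<mu> h / v h" "\<tau> \<in> {0..L}"
        "\<bar>\<tau> - s\<bar> \<le> (1 - v h) * L + \<mu> h / v h" "P h \<sigma> = c \<tau>"
        using close_vertex[OF s(1)] by blast
      have "\<bar>\<tau> - s0\<bar> < \<delta>"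
        using st(5) s(2) elim(1) by linarith
      then have start: "P h \<sigma> \<in> V"
        using cVU st(4,6) by auto
      have sub: "{\<sigma>..s} \<subseteq> {0..L}"
        using st s by auto
      have "norm (\<iota> (P h t) - \<iota> (P h \<sigma>)) \<le> \<kappa>" if t: "t \<in> {\<sigma>..s}" for t
      proof -
        have "norm (\<iota> (P h t) - \<iota> (P h \<sigma>)) \<le> v h * (t - \<sigma>)"
          using t st s by (intro lipschitz_polygon) auto
        also have "\<dots> \<le> v h * (\<mu> h / v h)"
          using t st v_pos by (intro mult_left_mono) auto
        also have "\<dots> \<le> \<kappa>"
          using v_pos elim(2) by simp
        finally show ?thesis .
      qed
      moreover have "P h ` {\<sigma>..s} \<subseteq> M"
        using polygon_in_M sub by blast
      ultimately show "P h s \<in> U"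
        using trap[OF st(2) continuous_on_subset[OF continuous_on_polygon sub] _ start] by blast
    qed
  qed
  show thesis
    using that[of "\<delta> / 2"] \<open>0 < \<delta>\<close> ev cVU by auto
qed

lemma c_in_M: "s \<in> {0..L} \<Longrightarrow> c s \<in> M"
  using arc by (auto simp: arc_length_curve_def)

lemma P_in_M: "s \<in> {0..L} \<Longrightarrow> P h s \<in> M"
  by (rule constant_speed_polygon.polygon_in_M[OF inscribed_polygon.axioms(1)[OF poly]])

lemma polygon_tendsto:
  assumes "s \<in> {0..L}"
  shows "(\<lambda>h. P h s) \<longlonglongrightarrow> c s"
proof (rule topological_tendstoI)
  fix O1 assume "open O1" "c s \<in> O1"
  then have "openin (top_of_set M) (M \<inter> O1)" "c s \<in> M \<inter> O1"
    using c_in_M[OF assms] by auto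
  then obtain \<delta> where "0 < \<delta>" and \<delta>: "\<forall>\<^sub>F h in sequentially. \<forall>x\<in>{0..L}. \<bar>x - s\<bar> < \<delta> \<longrightarrow> P h x \<in> M \<inter> O1"
    by (rule eventually_in_neighbourhood[OF assms])
  show "\<forall>\<^sub>F h in sequentially. P h s \<in> O1"
    using \<delta> by eventually_elim (use assms \<open>0 < \<delta>\<close> in auto)
qed

text \<open>Finitely many of the local neighbourhoods cover the parameter interval; the sum of their
  nonnegative constants bounds each of them.\<close>

lemma uniform_curvature_bound:
  obtains C where "0 \<le> C"
    "\<forall>\<^sub>F h in sequentially. \<forall>s\<in>{0..L}. \<forall>u w z. parallel_at M \<iota> (P h s) u w z \<longrightarrow> norm z \<le> C * norm u * norm w"
proof -
  define Q where "Q s0 \<delta> C \<longleftrightarrow> 0 < \<delta> \<and> 0 \<le> C \<and> (\<forall>\<^sub>F h in sequentially. \<forall>s\<in>{0..L}. \<bar>s - s0\<bar> < \<delta> \<longrightarrow>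
      (\<forall>u w z. parallel_at M \<iota> (P h s) u w z \<longrightarrow> norm z \<le> C * norm u * norm w))" for s0 \<delta> C
  have "\<exists>\<delta> C. Q s0 \<delta> C" if s0: "s0 \<in> {0..L}" for s0
  proof -
    obtain U C where U: "openin (top_of_set M) U" "c s0 \<in> U" "0 \<le> C"
      and C: "\<And>q u w z. q \<in> U \<Longrightarrow> parallel_at M \<iota> q u w z \<Longrightarrow> norm z \<le> C * norm u * norm w"
      by (rule local_curvature_bound[OF imm c_in_M[OF s0]]) blast
    obtain \<delta> where "0 < \<delta>" and \<delta>: "\<forall>\<^sub>F h in sequentially. \<forall>s\<in>{0..L}. \<bar>s - s0\<bar> < \<delta> \<longrightarrow> P h s \<in> U"
      by (rule eventually_in_neighbourhood[OF s0 U(1,2)])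
    have "\<forall>\<^sub>F h in sequentially. \<forall>s\<in>{0..L}. \<bar>s - s0\<bar> < \<delta> \<longrightarrow>
      (\<forall>u w z. parallel_at M \<iota> (P h s) u w z \<longrightarrow> norm z \<le> C * norm u * norm w)"
      using \<delta> by eventually_elim (use C in blast)
    then have "Q s0 \<delta> C"
      unfolding Q_def using \<open>0 < \<delta>\<close> U(3) by simp
    then show ?thesis by blast
  qed
  then obtain \<delta> C where Q: "\<And>s0. s0 \<in> {0..L} \<Longrightarrow> Q s0 (\<delta> s0) (C s0)"
    by metis
  have \<delta>: "0 < \<delta> s0" and C0: "0 \<le> C s0" and C: "\<forall>\<^sub>F h in sequentially. \<forall>s\<in>{0..L}. \<bar>s - s0\<bar> < \<delta> s0 \<longrightarrow>
      (\<forall>u w z. parallel_at M \<iota> (P h s) u w z \<longrightarrow> norm z \<le> C s0 * norm u * norm w)" if "s0 \<in> {0..L}" for s0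
    using Q[OF that] unfolding Q_def by simp_all
  obtain T where T: "T \<subseteq> {0..L}" "finite T" "{0..L} \<subseteq> (\<Union>s0\<in>T. ball s0 (\<delta> s0))"
  proof (rule compactE_image[of "{0..L}" "{0..L}" "\<lambda>s0. ball s0 (\<delta> s0)"])
    show "{0..L} \<subseteq> (\<Union>s0\<in>{0..L}. ball s0 (\<delta> s0))"
      using \<delta> by force
  qed auto
  define K where "K = (\<Sum>s0\<in>T. C s0)"
  have CK: "C s0 \<le> K" if "s0 \<in> T" for s0
    unfolding K_def using that T C0 by (intro member_le_sum) auto
  have "0 \<le> K"
    unfolding K_def using T(1) C0 by (intro sum_nonneg) auto
  moreover have "\<forall>\<^sub>F h in sequentially. \<forall>s0\<in>T. \<forall>s\<in>{0..L}. \<bar>s - s0\<bar> < \<delta> s0 \<longrightarrow>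
      (\<forall>u w z. parallel_at M \<iota> (P h s) u w z \<longrightarrow> norm z \<le> C s0 * norm u * norm w)"
    using T(1) C by (intro eventually_ball_finite[OF T(2)]) auto
  then have "\<forall>\<^sub>F h in sequentially. \<forall>s\<in>{0..L}. \<forall>u w z. parallel_at M \<iota> (P h s) u w z \<longrightarrow> norm z \<le> K * norm u * norm w"
  proof eventually_elim
    case (elim h)
    show ?case
    proof (intro ballI allI impI)
      fix s u w z assume s: "s \<in> {0..L}" and p: "parallel_at M \<iota> (P h s) u w z"
      obtain s0 where s0: "s0 \<in> T" "s \<in> ball s0 (\<delta> s0)"
        using T(3) s by blast
      then have "norm z \<le> C s0 * norm u * norm w"
        using elim s p by (auto simp: dist_real_def abs_minus_commute)
      also have "\<dots> \<le> K * norm u * norm w"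
        using CK[OF s0(1)] by (intro mult_right_mono) auto
      finally show "norm z \<le> K * norm u * norm w" .
    qed
  qed
  ultimately show ?thesis
    using that by blast
qed

end

text \<open>Bisection of the interval; when two adjacent pieces are joined their constants are
  added.\<close>

lemma lipschitz_of_locally_lipschitz:
  fixes f :: "real \<Rightarrow> 'a::real_normed_vector"
  assumes "a \<le> b" and loc: "\<And>x. x \<in> {a..b} \<Longrightarrow> \<exists>\<delta>>0. \<exists>K. \<forall>s\<in>{a..b}. \<forall>t\<in>{a..b}. \<bar>s - x\<bar> < \<delta> \<longrightarrow> \<bar>t - x\<bar> < \<delta> \<longrightarrow>
      norm (f t - f s) \<le> K * \<bar>t - s\<bar>"
  obtains K where "0 \<le> K" "\<And>s t. s \<in> {a..b} \<Longrightarrow> t \<in> {a..b} \<Longrightarrow> norm (f t - f s) \<le> K * \<bar>t - s\<bar>"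
proof -
  define Q where "Q x y \<longleftrightarrow> (\<exists>K\<ge>0. \<forall>s\<in>{x..y} \<inter> {a..b}. \<forall>t\<in>{x..y} \<inter> {a..b}. s \<le> t \<longrightarrow> norm (f t - f s) \<le> K * (t - s))" for x y
  have "Q a b"
    using \<open>a \<le> b\<close>
  proof (induction rule: Bolzano)
    case (trans x m y)
    obtain K1 where K1: "0 \<le> K1" "\<And>s t. s \<in> {x..m} \<inter> {a..b} \<Longrightarrow> t \<in> {x..m} \<inter> {a..b} \<Longrightarrow> s \<le> t \<Longrightarrow> norm (f t - f s) \<le> K1 * (t - s)"
      using trans(1) unfolding Q_def by blast
    obtain K2 where K2: "0 \<le> K2" "\<And>s t. s \<in> {m..y} \<inter> {a..b} \<Longrightarrow> t \<in> {m..y} \<inter> {a..b} \<Longrightarrow> s \<le> t \<Longrightarrow> norm (f t - f s) \<le> K2 * (t - s)"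
      using trans(2) unfolding Q_def by blast
    have "norm (f t - f s) \<le> (K1 + K2) * (t - s)" if s: "s \<in> {x..y} \<inter> {a..b}" and t: "t \<in> {x..y} \<inter> {a..b}" and "s \<le> t" for s t
    proof -
      have mono: "K1 * r \<le> (K1 + K2) * r" "K2 * r \<le> (K1 + K2) * r" if "0 \<le> r" for r
        using K1(1) K2(1) that by (simp_all add: distrib_right)
      consider "t \<le> m" | "m \<le> s" | "s < m" "m < t" by linarith
      then show ?thesis
      proof cases
        case 1
        then have "norm (f t - f s) \<le> K1 * (t - s)"
          using s t \<open>s \<le> t\<close> by (intro K1(2)) auto
        then show ?thesis
          using mono(1)[of "t - s"] \<open>s \<le> t\<close> by simp
      next
        case 2
        then have "norm (f t - f s) \<le> K2 * (t - s)"
          using s t \<open>s \<le> t\<close> by (intro K2(2)) auto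
        then show ?thesis
          using mono(2)[of "t - s"] \<open>s \<le> t\<close> by simp
      next
        case 3
        have "norm (f m - f s) \<le> K1 * (m - s)"
          using 3 s t by (intro K1(2)) auto
        moreover have "norm (f t - f m) \<le> K2 * (t - m)"
          using 3 s t by (intro K2(2)) auto
        moreover have "norm (f t - f s) \<le> norm (f t - f m) + norm (f m - f s)"
          using norm_triangle_ineq[of "f t - f m" "f m - f s"] by simp
        ultimately have "norm (f t - f s) \<le> (K1 + K2) * (t - m) + (K1 + K2) * (m - s)"
          using mono(1)[of "m - s"] mono(2)[of "t - m"] 3 by linarith
        then show ?thesis
          by (simp add: algebra_simps)
      qed
    qed
    then show ?case
      unfolding Q_def using K1(1) K2(1) by (intro exI[of _ "K1 + K2"]) auto
  next
    case (local x)
    have "x \<in> {a..b}"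
      using local by simp
    from loc[OF this] obtain \<delta> K where "0 < \<delta>" and K0: "\<forall>s\<in>{a..b}. \<forall>t\<in>{a..b}. \<bar>s - x\<bar> < \<delta> \<longrightarrow> \<bar>t - x\<bar> < \<delta> \<longrightarrow>
        norm (f t - f s) \<le> K * \<bar>t - s\<bar>"
      by blast
    have K: "norm (f t - f s) \<le> K * \<bar>t - s\<bar>" if "s \<in> {a..b}" "t \<in> {a..b}" "\<bar>s - x\<bar> < \<delta>" "\<bar>t - x\<bar> < \<delta>" for s t
      using K0 that by blast
    have "Q y z" if "y \<le> x" "x \<le> z" "z - y < \<delta>" for y z
      unfolding Q_def
    proof (intro exI[of _ "\<bar>K\<bar>"] conjI ballI impI)
      fix s t assume st: "s \<in> {y..z} \<inter> {a..b}" "t \<in> {y..z} \<inter> {a..b}" "s \<le> t"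
      then have "norm (f t - f s) \<le> K * \<bar>t - s\<bar>"
        using that by (intro K) auto
      also have "\<dots> \<le> \<bar>K\<bar> * (t - s)"
        using st by (simp add: mult_right_mono)
      finally show "norm (f t - f s) \<le> \<bar>K\<bar> * (t - s)" .
    qed simp
    then show ?case
      using \<open>0 < \<delta>\<close> by blast
  qed
  then obtain K where K: "0 \<le> K" "\<And>s t. s \<in> {a..b} \<Longrightarrow> t \<in> {a..b} \<Longrightarrow> s \<le> t \<Longrightarrow> norm (f t - f s) \<le> K * (t - s)"
    unfolding Q_def by auto
  have "norm (f t - f s) \<le> K * \<bar>t - s\<bar>" if "s \<in> {a..b}" "t \<in> {a..b}" for s t
    using K(2)[of s t] K(2)[of t s] that by (cases "s \<le> t") (auto simp: norm_minus_commute)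
  then show ?thesis
    using that K(1) by blast
qed

text \<open>
  A unit tangent field \<open>w\<close> orthogonal to a Lipschitz unit tangent field \<open>y\<close> is Lipschitz: the component
  of \<open>w t - w s\<close> along \<open>y s\<close> is controlled by \<open>y\<close>, the one normal to the surface by the tilt of the
  tangent planes, and the one along \<open>w s\<close> is quadratic in \<open>w t - w s\<close>.
\<close>

lemma rotated_field_lipschitz:
  fixes M :: "'m::t2_space set" and \<iota> :: "'m \<Rightarrow> 'a::euclidean_space" and y w :: "real \<Rightarrow> 'a"
  assumes imm: "immersed_surface M \<iota>" and arc: "arc_length_curve M \<iota> c L" and "0 < L" and "0 \<le> C"
    and ylip: "\<And>s t. s \<in> {0..L} \<Longrightarrow> t \<in> {0..L} \<Longrightarrow> norm (y t - y s) \<le> C * \<bar>t - s\<bar>"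
    and yT: "\<And>s. s \<in> {0..L} \<Longrightarrow> y s \<in> tangent_plane M \<iota> (c s)" and wT: "\<And>s. s \<in> {0..L} \<Longrightarrow> w s \<in> tangent_plane M \<iota> (c s)"
    and y1: "\<And>s. s \<in> {0..L} \<Longrightarrow> norm (y s) = 1" and w1: "\<And>s. s \<in> {0..L} \<Longrightarrow> norm (w s) = 1"
    and yw: "\<And>s. s \<in> {0..L} \<Longrightarrow> y s \<bullet> w s = 0" and wcont: "continuous_on {0..L} w"
  obtains K where "0 \<le> K" "\<And>s t. s \<in> {0..L} \<Longrightarrow> t \<in> {0..L} \<Longrightarrow> norm (w t - w s) \<le> K * \<bar>t - s\<bar>"
proof (rule lipschitz_of_locally_lipschitz[of 0 L w])
  show "0 \<le> L" using \<open>0 < L\<close> by simp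
  fix s0 assume s0: "s0 \<in> {0..L}"
  have cM: "c s \<in> M" if "s \<in> {0..L}" for s
    using arc that by (auto simp: arc_length_curve_def)
  obtain U B where U: "openin (top_of_set M) U" "c s0 \<in> U" "0 \<le> B"
    and tilt: "\<And>q q' y \<nu>. q \<in> U \<Longrightarrow> q' \<in> U \<Longrightarrow> y \<in> tangent_plane M \<iota> q \<Longrightarrow> (\<And>v. v \<in> tangent_plane M \<iota> q' \<Longrightarrow> \<nu> \<bullet> v = 0) \<Longrightarrow>
      \<bar>y \<bullet> \<nu>\<bar> \<le> B * norm (\<iota> q - \<iota> q') * norm y * norm \<nu>"
    by (rule local_curvature_bound[OF imm cM[OF s0]]) blast
  obtain O1 where "open O1" and O1: "U = M \<inter> O1"
    using U(1) openin_open by blast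
  have "(c \<longlongrightarrow> c s0) (at s0 within {0..L})"
    using arc s0 by (simp add: arc_length_curve_def continuous_on_def)
  then have "\<forall>\<^sub>F s in at s0 within {0..L}. c s \<in> O1"
    using \<open>open O1\<close> O1 U(2) topological_tendstoD by blast
  moreover have "(w \<longlongrightarrow> w s0) (at s0 within {0..L})"
    using wcont s0 by (simp add: continuous_on_def)
  then have "\<forall>\<^sub>F s in at s0 within {0..L}. dist (w s) (w s0) < 1 / 2"
    by (rule tendstoD) simp
  ultimately have "\<forall>\<^sub>F s in at s0 within {0..L}. c s \<in> O1 \<and> dist (w s) (w s0) < 1 / 2"
    by (rule eventually_conj)
  then obtain \<delta> where "0 < \<delta>" and \<delta>: "\<And>s. s \<in> {0..L} \<Longrightarrow> s \<noteq> s0 \<Longrightarrow> dist s s0 < \<delta> \<Longrightarrow> c s \<in> O1 \<and> dist (w s) (w s0) < 1 / 2"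
    unfolding eventually_at by blast
  have near: "c s \<in> U \<and> dist (w s) (w s0) < 1 / 2" if "s \<in> {0..L}" "\<bar>s - s0\<bar> < \<delta>" for s
    using \<delta>[OF that(1)] that(2) U(2) O1 cM[OF that(1)] by (cases "s = s0") (auto simp: dist_real_def)
  have "norm (w t - w s) \<le> 2 * (C + B) * \<bar>t - s\<bar>"
    if s: "s \<in> {0..L}" "\<bar>s - s0\<bar> < \<delta>" and t: "t \<in> {0..L}" "\<bar>t - s0\<bar> < \<delta>" for s t
  proof -
    define d where "d = norm (w t - w s)"
    \<comment> \<open>Both values lie within \<open>1 / 2\<close> of \<open>w s0\<close>. This makes
      the quadratic term along \<open>w s\<close> at most \<open>d / 2\<close>, so that it can be
      absorbed on the left.\<close>
    have "d \<le> 1"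
      using near[OF s] near[OF t] dist_triangle2[of "w t" "w s" "w s0"] unfolding d_def by (simp add: dist_norm)
    \<comment> \<open>The component of \<open>w t\<close> normal to the surface at
      \<open>c s\<close>, since \<open>y s\<close> and \<open>w s\<close> form an orthonormal basis
      of the tangent plane there.\<close>
    define \<nu> where "\<nu> = w t - (w t \<bullet> y s) *\<^sub>R y s - (w t \<bullet> w s) *\<^sub>R w s"
    have ws: "w s \<bullet> w s = 1" "y s \<bullet> y s = 1" "w s \<bullet> y s = 0" "y s \<bullet> w s = 0" "w t \<bullet> w t = 1"
      using y1[OF s(1)] w1[OF s(1)] w1[OF t(1)] yw[OF s(1)] by (auto simp: norm_eq_1 inner_commute)
    have \<nu>perp: "\<nu> \<bullet> y s = 0" "\<nu> \<bullet> w s = 0"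
      using ws by (simp_all add: \<nu>_def inner_diff_left)
    have \<nu>T: "\<nu> \<bullet> x = 0" if "x \<in> tangent_plane M \<iota> (c s)" for x
    proof -
      have "x = (x \<bullet> y s) *\<^sub>R y s + (x \<bullet> w s) *\<^sub>R w s"
        by (rule tangent_plane_orthonormal_expand[OF imm cM[OF s(1)] yT[OF s(1)] wT[OF s(1)] y1[OF s(1)] w1[OF s(1)] yw[OF s(1)] that])
      then have "\<nu> \<bullet> x = (x \<bullet> y s) * (\<nu> \<bullet> y s) + (x \<bullet> w s) * (\<nu> \<bullet> w s)"
        by (metis inner_add_right inner_scaleR_right)
      then show ?thesis
        using \<nu>perp by simp
    qed
    have "norm \<nu> * norm \<nu> = w t \<bullet> \<nu>"
    proof -
      have "\<nu> \<bullet> \<nu> = w t \<bullet> \<nu> - (w t \<bullet> y s) * (y s \<bullet> \<nu>) - (w t \<bullet> w s) * (w s \<bullet> \<nu>)"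
        by (subst (1) \<nu>_def) (simp add: inner_diff_left)
      moreover have "y s \<bullet> \<nu> = 0" "w s \<bullet> \<nu> = 0"
        using \<nu>perp by (simp_all add: inner_commute)
      ultimately show ?thesis
        by (simp add: dot_square_norm power2_eq_square)
    qed
    also have "\<dots> \<le> B * norm (\<iota> (c t) - \<iota> (c s)) * norm (w t) * norm \<nu>"
      using tilt[OF _ _ wT[OF t(1)] \<nu>T] near[OF s] near[OF t] by (metis abs_le_D1)
    also have "\<dots> \<le> B * \<bar>t - s\<bar> * 1 * norm \<nu>"
    proof -
      have "norm (\<iota> (c t) - \<iota> (c s)) \<le> \<bar>t - s\<bar>"
        using arc_length_curve_lipschitz[OF arc, of s t] arc_length_curve_lipschitz[OF arc, of t s] s(1) t(1)
        by (cases "s \<le> t") (auto simp: norm_minus_commute)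
      then show ?thesis
        using w1[OF t(1)] U(3) by (intro mult_right_mono mult_mono) auto
    qed
    finally have \<nu>le: "norm \<nu> \<le> B * \<bar>t - s\<bar>"
      using U(3) by (cases "\<nu> = 0") auto
    have "w t \<bullet> y s = w t \<bullet> (y s - y t)"
      using yw[OF t(1)] by (simp add: inner_diff_right inner_commute)
    then have "\<bar>w t \<bullet> y s\<bar> \<le> norm (w t) * norm (y s - y t)"
      by (simp add: Cauchy_Schwarz_ineq2)
    then have yle: "\<bar>w t \<bullet> y s\<bar> \<le> C * \<bar>t - s\<bar>"
      using ylip[OF t(1) s(1)] w1[OF t(1)] by (simp add: abs_minus_commute)
    have "d * d = (w t - w s) \<bullet> (w t - w s)"
      by (simp add: d_def dot_square_norm power2_eq_square)
    also have "\<dots> = 2 - 2 * (w t \<bullet> w s)"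
      using ws by (simp add: inner_diff_left inner_diff_right inner_commute)
    finally have "d * d = 2 - 2 * (w t \<bullet> w s)" .
    moreover have "d * d \<le> d"
      using \<open>d \<le> 1\<close> by (simp add: d_def mult_left_le)
    moreover have "0 \<le> d * d" by simp
    ultimately have wle: "\<bar>w t \<bullet> w s - 1\<bar> \<le> d / 2"
      by linarith
    have "w t - w s = (w t \<bullet> y s) *\<^sub>R y s + (w t \<bullet> w s - 1) *\<^sub>R w s + \<nu>"
      by (simp add: \<nu>_def algebra_simps)
    then have "d \<le> \<bar>w t \<bullet> y s\<bar> * norm (y s) + \<bar>w t \<bullet> w s - 1\<bar> * norm (w s) + norm \<nu>"
      unfolding d_def
      using norm_triangle_ineq[of "(w t \<bullet> y s) *\<^sub>R y s + (w t \<bullet> w s - 1) *\<^sub>R w s" \<nu>]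
        norm_triangle_ineq[of "(w t \<bullet> y s) *\<^sub>R y s" "(w t \<bullet> w s - 1) *\<^sub>R w s"] by simp
    then have "d \<le> C * \<bar>t - s\<bar> + d / 2 + B * \<bar>t - s\<bar>"
      using yle wle \<nu>le y1[OF s(1)] w1[OF s(1)] by simp
    then have "d \<le> 2 * (C + B) * \<bar>t - s\<bar>"
      by (simp add: algebra_simps)
    then show ?thesis
      by (simp add: d_def)
  qed
  then show "\<exists>\<delta>>0. \<exists>K. \<forall>s\<in>{0..L}. \<forall>t\<in>{0..L}. \<bar>s - s0\<bar> < \<delta> \<longrightarrow> \<bar>t - s0\<bar> < \<delta> \<longrightarrow> norm (w t - w s) \<le> K * \<bar>t - s\<bar>"
    using \<open>0 < \<delta>\<close> by blast
qed (use that in blast)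

section \<open>Selection and identification of the limit velocity\<close>

locale curved_sequence = inscribed_sequence M \<iota> c L ts ss P v \<mu>
  for M :: "'m::t2_space set" and \<iota> :: "'m \<Rightarrow> 'a::euclidean_space" and c L ts ss P v \<mu> +
  fixes C K :: real
  assumes C_nonneg: "0 \<le> C"
    and curvature: "\<And>h s u w z. s \<in> {0..L} \<Longrightarrow> parallel_at M \<iota> (P h s) u w z \<Longrightarrow> norm z \<le> C * norm u * norm w"
    and rotation: "\<And>h. rotation \<iota> L (ss h) (P h) \<le> K"
begin

sublocale polygon: constant_speed_polygon M \<iota> L "ss h" "P h" "v h" for h
  by (rule inscribed_polygon.axioms(1)[OF poly])

definition vel :: "nat \<Rightarrow> real \<Rightarrow> 'a" where
  "vel h s = (if 0 \<le> s \<and> s < L then polygon.velocity h s else 0)"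

lemma norm_vel: "0 \<le> s \<Longrightarrow> s < L \<Longrightarrow> norm (vel h s) = v h"
  using polygon.velocity_props(2) by (simp add: vel_def)

lemma norm_vel_le: "norm (vel h s) \<le> 1"
  using norm_vel[of s h] v_bounds[of h] by (cases "0 \<le> s \<and> s < L") (auto simp: vel_def)

lemma velocity_subsequence:
  obtains r F T B where "strict_mono (r :: nat \<Rightarrow> nat)" "mono F" "\<And>x. continuous (at_right x) F" "\<And>x. \<bar>F x\<bar> \<le> B"
    "\<And>s t. s \<le> t \<Longrightarrow> norm (T t - T s) \<le> F t - F s" "\<And>x. isCont F x \<Longrightarrow> (\<lambda>n. vel (r n) x) \<longlonglongrightarrow> T x"
proof -
  \<comment> \<open>One constant must bound the velocities and their majorants at once.\<close>
  define B where "B = max 1 (C * L + K + 2)"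
  have "\<exists>W. mono W \<and> (\<forall>x. continuous (at_right x) W) \<and> (\<forall>x. \<bar>W x\<bar> \<le> B) \<and> (\<forall>s t. s \<le> t \<longrightarrow> norm (vel h t - vel h s) \<le> W t - W s)" for h
  proof (rule polygon.velocity_control[OF imm C_nonneg _ rotation])
    show "norm z \<le> C * norm u * norm w" if "s \<in> {0<..<L}" "parallel_at M \<iota> (P h s) u w z" for s u w z
      using curvature[OF _ that(2)] that(1) by auto
    show "v h \<le> 1"
      using v_bounds by blast
    fix W :: "real \<Rightarrow> real"
    assume "mono W" "\<And>x. continuous (at_right x) W" and bound: "\<And>x. \<bar>W x\<bar> \<le> C * L + K + 2"
      and "\<And>s t. s \<le> t \<Longrightarrow> norm ((if 0 \<le> t \<and> t < L then polygon.velocity h t else 0) - (if 0 \<le> s \<and> s < L then polygon.velocity h s else 0)) \<le> W t - W s"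
    moreover have "\<bar>W x\<bar> \<le> B" for x
      using bound[of x] by (simp add: B_def)
    ultimately show ?thesis
      by (intro exI[of _ W]) (simp add: vel_def)
  qed
  then obtain W where W: "\<And>h. mono (W h)" "\<And>h x. continuous (at_right x) (W h)" "\<And>h x. \<bar>W h x\<bar> \<le> B"
    "\<And>h s t. s \<le> t \<Longrightarrow> norm (vel h t - vel h s) \<le> W h t - W h s"
    by metis
  have velB: "norm (vel h x) \<le> B" for h x
    using norm_vel_le[of h x] by (simp add: B_def)
  show ?thesis
  proof (rule bounded_variation_selection[OF W(1,2,3) velB W(4)])
    fix r F T
    assume "strict_mono (r :: nat \<Rightarrow> nat)" "mono F" "\<And>x. continuous (at_right x) F" "\<And>x. \<bar>F x\<bar> \<le> 2 * B"
      "\<And>s t. s \<le> t \<Longrightarrow> norm (T t - T s) \<le> F t - F s" "\<And>x. isCont F x \<Longrightarrow> (\<lambda>n. vel (r n) x) \<longlonglongrightarrow> T x"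
    then show ?thesis
      by (rule that)
  qed
qed

end

text \<open>\<open>F\<close> dominates the variation of \<open>T\<close>, and its discontinuities
  are the only points where convergence of the velocities is not asserted.\<close>

locale velocity_limit = curved_sequence M \<iota> c L ts ss P v \<mu> C K
  for M :: "'m::t2_space set" and \<iota> :: "'m \<Rightarrow> 'a::euclidean_space" and c L ts ss P v \<mu> C K +
  fixes r :: "nat \<Rightarrow> nat" and F :: "real \<Rightarrow> real" and T :: "real \<Rightarrow> 'a" and B :: real
  assumes r: "strict_mono r" and F_mono: "mono F" and F_right: "\<And>x. continuous (at_right x) F" and F_bound: "\<And>x. \<bar>F x\<bar> \<le> B"
    and T_var: "\<And>s t. s \<le> t \<Longrightarrow> norm (T t - T s) \<le> F t - F s"
    and vel_tendsto: "\<And>x. isCont F x \<Longrightarrow> (\<lambda>n. vel (r n) x) \<longlonglongrightarrow> T x"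
begin

definition E :: "real set" where "E = {x. \<not> isCont F x}"

lemma countable_E: "countable E"
  unfolding E_def by (rule mono_ctble_discont[OF F_mono])

lemma T_right: "continuous (at_right x) T"
  by (rule continuous_variation_bound[OF T_var F_right])

lemma T_isCont: "x \<notin> E \<Longrightarrow> isCont T x"
  unfolding E_def using continuous_variation_bound[OF T_var, where x=x and S=UNIV] by simp

text \<open>Off \<open>E\<close> the norm is the limit of the speeds, which is 1; right-continuity
  carries this to the points of \<open>E\<close>.\<close>

lemma norm_T:
  assumes "0 \<le> s" "s < L"
  shows "norm (T s) = 1"
proof -
  have v1: "(\<lambda>n. v (r n)) \<longlonglongrightarrow> 1"
    using LIMSEQ_subseq_LIMSEQ[OF speed_tendsto_1 r] by (simp add: o_def)
  have *: "norm (T x) = 1" if "x \<notin> E" "0 \<le> x" "x < L" for x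
  proof -
    have "(\<lambda>n. norm (vel (r n) x)) \<longlonglongrightarrow> norm (T x)"
      using that(1) by (intro tendsto_norm vel_tendsto) (simp add: E_def)
    then have "(\<lambda>n. v (r n)) \<longlonglongrightarrow> norm (T x)"
      by (simp add: norm_vel[OF that(2,3)])
    then show ?thesis
      using v1 LIMSEQ_unique by blast
  qed
  obtain \<sigma> where \<sigma>: "\<And>k. \<sigma> k \<notin> E" "filterlim \<sigma> (at_right s) sequentially"
    using ex_sequence_from_right[OF countable_E, where s=s] by blast
  have "(\<lambda>k. norm (T (\<sigma> k))) \<longlonglongrightarrow> norm (T s)"
  proof -
    have "(T \<longlongrightarrow> T s) (at_right s)"
      using T_right[of s] by (simp add: continuous_within)
    then show ?thesis
      by (rule tendsto_norm[OF filterlim_compose[OF _ \<sigma>(2)]])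
  qed
  moreover have "\<forall>\<^sub>F k in sequentially. norm (T (\<sigma> k)) = 1"
  proof -
    have "\<forall>\<^sub>F x in at_right s. s < x \<and> x < L"
      unfolding eventually_at_right_field using assms(2) by (intro exI[of _ L]) auto
    then have "\<forall>\<^sub>F k in sequentially. s < \<sigma> k \<and> \<sigma> k < L"
      using \<sigma>(2) by (rule eventually_compose_filterlim)
    then show ?thesis
      by eventually_elim (use * \<sigma>(1) assms in auto)
  qed
  then have "(\<lambda>k. norm (T (\<sigma> k))) \<longlonglongrightarrow> 1"
    by (rule tendsto_eventually)
  ultimately show ?thesis
    using LIMSEQ_unique by blast
qed

lemma polygon_has_integral:
  assumes "s \<in> {0..L}"
  shows "(vel h has_integral (\<iota> (P h s) - \<iota> (P h 0))) {0..s}"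
proof -
  have "continuous_on {0..s} (\<iota> \<circ> P h)"
  proof (rule continuous_on_subset[of "{0..L}"])
    show "continuous_on {0..L} (\<iota> \<circ> P h)"
      unfolding continuous_on_def
    proof
      fix x assume x: "x \<in> {0..L}"
      have "(P h \<longlongrightarrow> P h x) (at x within {0..L})"
        using polygon.continuous_on_polygon x by (simp add: continuous_on_def)
      then show "((\<iota> \<circ> P h) \<longlongrightarrow> (\<iota> \<circ> P h) x) (at x within {0..L})"
        unfolding o_def using P_in_M x by (intro immersion_tendsto[OF imm]) (auto simp: eventually_at_filter)
    qed
  qed (use assms in auto)
  then have "(vel h has_integral ((\<iota> \<circ> P h) s - (\<iota> \<circ> P h) 0)) {0..s}"
  proof (rule fundamental_theorem_of_calculus_interior_strong[of "set (ss h)", rotated 3])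
    show "(\<iota> \<circ> P h has_vector_derivative vel h x) (at x)" if "x \<in> {0<..<s} - set (ss h)" for x
      using polygon.velocity_derivative[of x h] that assms by (auto simp: vel_def)
  qed (use assms in auto)
  then show ?thesis by simp
qed

text \<open>The integrals of the velocities pass to the limit by dominated convergence while the
  polygonals converge to \<open>c\<close>. This identifies \<open>T\<close> as a derivative of the
  curve.\<close>

lemma curve_has_integral:
  assumes "s \<in> {0..L}"
  shows "(T has_integral (\<iota> (c s) - \<iota> (c 0))) {0..s}"
proof -
  \<comment> \<open>Dominated convergence is used with convergence at every point, so the values on
    the null set \<open>E\<close> are replaced by 0.\<close>
  define f where "f n x = (if x \<in> E then 0 else vel (r n) x)" for n x
  define g where "g x = (if x \<in> E then 0 else T x)" for x
  have neg: "negligible E"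
    using countable_E by (simp add: negligible_iff_null_sets null_sets_completionI countable_imp_null_set_lborel)
  have fint: "(f n has_integral (\<iota> (P (r n) s) - \<iota> (P (r n) 0))) {0..s}" for n
    by (rule has_integral_spike[OF neg _ polygon_has_integral[OF assms]]) (simp add: f_def)
  have one: "(\<lambda>x. 1::real) integrable_on {0..s}"
    by (rule integrable_const_ivl)
  have fi: "f n integrable_on {0..s}" for n
    using fint by blast
  have f1: "norm (f n x) \<le> 1" if "x \<in> {0..s}" for n x
    using norm_vel_le by (simp add: f_def)
  have fg: "(\<lambda>n. f n x) \<longlonglongrightarrow> g x" if "x \<in> {0..s}" for x
    using vel_tendsto[of x] by (simp add: f_def g_def E_def)
  note dc = dominated_convergence[OF fi one f1 fg]
  have lim: "(\<lambda>n. \<iota> (P (r n) x)) \<longlonglongrightarrow> \<iota> (c x)" if "x \<in> {0..L}" for x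
    using LIMSEQ_subseq_LIMSEQ[OF polygon_tendsto[OF that] r] c_in_M[OF that] P_in_M[OF that]
    by (intro immersion_tendsto[OF imm]) (auto simp: o_def)
  have "(\<lambda>n. \<iota> (P (r n) s) - \<iota> (P (r n) 0)) \<longlonglongrightarrow> \<iota> (c s) - \<iota> (c 0)"
    using assms L_pos by (intro tendsto_diff lim) auto
  moreover have "(\<lambda>n. \<iota> (P (r n) s) - \<iota> (P (r n) 0)) \<longlonglongrightarrow> integral {0..s} g"
    using dc(2) by (simp add: integral_unique[OF fint])
  ultimately have "integral {0..s} g = \<iota> (c s) - \<iota> (c 0)"
    using LIMSEQ_unique by blast
  then have "(g has_integral (\<iota> (c s) - \<iota> (c 0))) {0..s}"
    using dc(1) by (metis integrable_integral)
  then show ?thesis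
    by (rule has_integral_spike[OF neg, rotated]) (simp add: g_def)
qed

lemma curve_increment:
  assumes "0 \<le> s" "s \<le> t" "t \<le> L"
  shows "\<iota> (c t) = \<iota> (c s) + integral {s..t} T" "T integrable_on {s..t}"
proof -
  have int: "T integrable_on {0..t}"
    using curve_has_integral[of t] assms by auto
  then have "integral {0..s} T + integral {s..t} T = integral {0..t} T"
    using assms by (intro Henstock_Kurzweil_Integration.integral_combine) auto
  then show "\<iota> (c t) = \<iota> (c s) + integral {s..t} T"
    using integral_unique[OF curve_has_integral[of s]] integral_unique[OF curve_has_integral[of t]] assms
    by (simp add: algebra_simps)
  show "T integrable_on {s..t}"
    by (rule integrable_on_subinterval[OF int]) (use assms in auto)
qed

text \<open>Right-continuity of \<open>T\<close> gives the right derivative of its integral at every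
  point, including the left end and the jumps.\<close>

lemma curve_right_derivative:
  assumes "0 \<le> s" "s < L"
  shows "((\<iota> \<circ> c) has_vector_derivative T s) (at s within {s..L})"
proof -
  have "continuous (at s within {s..L}) T"
    using T_right[of s] assms by (simp add: at_within_Icc_at_right)
  then have "((\<lambda>u. integral {s..u} T) has_vector_derivative T s) (at s within {s..L})"
    using integral_has_vector_derivative_continuous_at[of T s L s "{}"] curve_increment(2)[of s L] assms by simp
  from has_vector_derivative_add[OF has_vector_derivative_const this]
  have D: "((\<lambda>u. \<iota> (c s) + integral {s..u} T) has_vector_derivative T s) (at s within {s..L})"
    by simp
  show ?thesis
  proof (rule has_vector_derivative_transform[OF _ _ D])
    fix u assume "u \<in> {s..L}"
    then show "(\<iota> \<circ> c) u = \<iota> (c s) + integral {s..u} T"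
      unfolding o_def using assms by (intro curve_increment(1)) auto
  qed (use assms in simp)
qed

lemma curve_derivative:
  assumes "0 < s" "s < L" "s \<notin> E"
  shows "((\<iota> \<circ> c) has_vector_derivative T s) (at s)"
proof -
  have "((\<lambda>u. integral {0..u} T) has_vector_derivative T s) (at s within {0..L})"
    using integral_has_vector_derivative_continuous_at[of T 0 L s "{}"] curve_increment(2)[of 0 L] assms T_isCont[OF assms(3)]
    by (simp add: continuous_at_imp_continuous_within)
  from has_vector_derivative_add[OF has_vector_derivative_const this]
  have D: "((\<lambda>u. \<iota> (c 0) + integral {0..u} T) has_vector_derivative T s) (at s within {0..L})"
    by simp
  have "((\<iota> \<circ> c) has_vector_derivative T s) (at s within {0..L})"
  proof (rule has_vector_derivative_transform[OF _ _ D])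
    fix u assume "u \<in> {0..L}"
    then show "(\<iota> \<circ> c) u = \<iota> (c 0) + integral {0..u} T"
      unfolding o_def by (intro curve_increment(1)) auto
  qed (use assms in simp)
  then show ?thesis
    using assms by (simp add: at_within_Icc_at)
qed

text \<open>The limit in \<open>initial_tangent\<close> runs over all points of differentiability,
  some of which may lie in \<open>E\<close>; there the derivative still agrees with the right
  derivative \<open>T\<close>.\<close>

lemma tantrix_eq_at_differentiable:
  assumes "0 < s" "s < L" and "(\<iota> \<circ> c) differentiable (at s)"
  shows "tantrix \<iota> c s = T s"
proof -
  have "((\<iota> \<circ> c) has_vector_derivative tantrix \<iota> c s) (at s)"
    using assms(3) by (simp add: tantrix_def vector_derivative_works)
  then have "((\<iota> \<circ> c) has_vector_derivative tantrix \<iota> c s) (at s within {s..L})"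
    by (rule has_vector_derivative_at_within)
  moreover have "at s within {s..L} \<noteq> bot"
    using assms by (simp add: at_within_Icc_at_right)
  moreover have "((\<iota> \<circ> c) has_vector_derivative T s) (at s within {s..L})"
    using assms by (intro curve_right_derivative) auto
  ultimately show ?thesis
    by (intro vector_derivative_unique_within)
qed

lemma tantrix_eq: "0 < s \<Longrightarrow> s < L \<Longrightarrow> s \<notin> E \<Longrightarrow> tantrix \<iota> c s = T s"
  unfolding tantrix_def by (rule vector_derivative_at[OF curve_derivative])

text \<open>\<open>T\<close> is right-continuous at 0 and agrees with the tantrix wherever that is
  defined. Points outside \<open>E\<close> accumulate at 0, so the limit is taken along a nontrivial
  filter and is unique.\<close>

lemma initial_tangent_eq: "initial_tangent \<iota> c L = T 0"
proof -
  define A where "A = {s. 0 < s \<and> s < L \<and> (\<iota> \<circ> c) differentiable (at s)}"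
  have "(T \<longlongrightarrow> T 0) (at_right 0)"
    using T_right[of 0] by (simp add: continuous_within)
  then have "(T \<longlongrightarrow> T 0) (at 0 within A)"
    by (rule tendsto_within_subset) (auto simp: A_def)
  then have lim: "(tantrix \<iota> c \<longlongrightarrow> T 0) (at 0 within A)"
    by (rule Lim_transform_eventually)
       (auto simp: eventually_at_filter A_def tantrix_eq_at_differentiable)
  obtain \<sigma> where \<sigma>: "\<And>k. \<sigma> k \<notin> E" "filterlim \<sigma> (at_right 0) sequentially"
    using ex_sequence_from_right[OF countable_E, where s=0] by blast
  have "\<forall>\<^sub>F x in at_right (0::real). 0 < x \<and> x < L"
    unfolding eventually_at_right_field using L_pos by (intro exI[of _ L]) auto
  then have "\<forall>\<^sub>F k in sequentially. 0 < \<sigma> k \<and> \<sigma> k < L"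
    using \<sigma>(2) by (rule eventually_compose_filterlim)
  then have "\<forall>\<^sub>F k in sequentially. \<sigma> k \<in> A \<and> \<sigma> k \<noteq> 0"
  proof eventually_elim
    case (elim k)
    then show ?case
      using curve_derivative[of "\<sigma> k"] \<sigma>(1) by (auto simp: A_def intro: differentiableI_vector)
  qed
  then have \<sigma>A: "filterlim \<sigma> (at 0 within A) sequentially"
    using \<sigma>(2) unfolding filterlim_at by (auto elim: eventually_mono)
  have "at 0 within A \<noteq> bot"
  proof
    assume "at 0 within A = bot"
    then have "\<forall>\<^sub>F x in at 0 within A. False" by simp
    then have "\<forall>\<^sub>F k in sequentially. False"
      by (rule eventually_compose_filterlim[OF _ \<sigma>A])
    then show False by simp
  qed
  then show ?thesis
    unfolding initial_tangent_def A_def[symmetric] using lim by (rule tendsto_Lim)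
qed

lemma T_tangent:
  assumes "0 \<le> s" "s < L"
  shows "T s \<in> tangent_plane M \<iota> (c s)"
proof (rule curve_derivative_tangent[OF imm, where S="{s..L}"])
  have "continuous_on {0..L} c"
    using arc by (simp add: arc_length_curve_def)
  then show "continuous (at s within {s..L}) c"
    using assms by (meson atLeastAtMost_iff atLeastatMost_subset_iff continuous_on_eq_continuous_within continuous_on_subset less_imp_le order_refl)
  show "c ` {s..L} \<subseteq> M"
    using c_in_M assms by auto
  show "((\<iota> \<circ> c) has_vector_derivative T s) (at s within {s..L})"
    by (rule curve_right_derivative[OF assms])
qed (use assms in \<open>auto simp: at_within_Icc_at_right\<close>)

end

subsection \<open>Convergence of the parallel transports\<close>

locale transport_sequence = velocity_limit M \<iota> c L ts ss P v \<mu> C K r F T B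
  for M :: "'m::t2_space set" and \<iota> :: "'m \<Rightarrow> 'a::euclidean_space" and c L ts ss P v \<mu> C K r F T B +
  fixes X :: "nat \<Rightarrow> real \<Rightarrow> 'a"
  assumes par: "\<And>h. parallel_transport M \<iota> L (ss h) (P h) (X h)" and init: "\<And>h. X h 0 = initial_tangent \<iota> c L"
begin

text \<open>The value 0 at the vertices makes this a bounded function on the whole interval without
  affecting integrals.\<close>

definition XD :: "nat \<Rightarrow> real \<Rightarrow> 'a" where
  "XD h s = (if s \<in> {0<..<L} - set (ss h) then vector_derivative (X h) (at s) else 0)"

lemma X_continuous: "continuous_on {0..L} (X h)"
  using par by (simp add: parallel_transport_def)

lemma X_tangent: "s \<in> {0..L} \<Longrightarrow> X h s \<in> tangent_plane M \<iota> (P h s)"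
  using par by (simp add: parallel_transport_def)

lemma X_derivative:
  assumes "s \<in> {0<..<L} - set (ss h)"
  shows "(X h has_vector_derivative XD h s) (at s)"
proof -
  have "X h differentiable (at s)"
    using par[of h] assms unfolding parallel_transport_def C1_differentiable_on_eq by auto
  then show ?thesis
    using assms by (simp add: XD_def vector_derivative_works)
qed

lemma XD_normal: "s \<in> {0<..<L} - set (ss h) \<Longrightarrow> w \<in> tangent_plane M \<iota> (P h s) \<Longrightarrow> XD h s \<bullet> w = 0"
  using par[of h] unfolding parallel_transport_def XD_def by auto

lemma XD_parallel_at:
  assumes s: "s \<in> {0<..<L} - set (ss h)"
  shows "parallel_at M \<iota> (P h s) (vel h s) (X h s) (XD h s)"
  unfolding parallel_at_def
proof (rule exI[of _ "P h"], rule exI[of _ "X h"], rule exI[of _ s], rule exI[of _ "{0<..<L}"], intro conjI ballI)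
  have "continuous (at s within {0..L}) (P h)"
    using polygon.continuous_on_polygon s by (auto simp: continuous_on_eq_continuous_within)
  then show "isCont (P h) s"
    using s by (simp add: at_within_Icc_at[of 0 s L])
  show "(\<iota> \<circ> P h has_vector_derivative vel h s) (at s)"
    using polygon.velocity_derivative[of s h] s by (simp add: vel_def)
  show "P h ` {0<..<L} \<subseteq> M"
    using P_in_M by auto
qed (use s X_tangent X_derivative[OF s] XD_normal[OF s] in auto)

text \<open>The derivative of \<open>X h\<close> is normal while \<open>X h\<close> is tangent, so
  the squared norm has derivative 0 off the vertices; it starts at 1 because the initial tangent is
  \<open>T 0\<close>.\<close>

lemma norm_X:
  assumes "s \<in> {0..L}"
  shows "norm (X h s) = 1"
proof -
  have "((\<lambda>_. 0) has_integral (X h s \<bullet> X h s - X h 0 \<bullet> X h 0)) {0..s}"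
  proof (rule fundamental_theorem_of_calculus_interior_strong[of "set (ss h)"])
    show "((\<lambda>s. X h s \<bullet> X h s) has_vector_derivative 0) (at x)" if x: "x \<in> {0<..<s} - set (ss h)" for x
    proof -
      have x': "x \<in> {0<..<L} - set (ss h)"
        using x assms by auto
      have "X h x \<in> tangent_plane M \<iota> (P h x)"
        using x' by (intro X_tangent) auto
      then have "XD h x \<bullet> X h x = 0"
        by (rule XD_normal[OF x'])
      then show ?thesis
        using bounded_bilinear.has_vector_derivative[OF bounded_bilinear_inner X_derivative[OF x'] X_derivative[OF x']]
        by (simp add: inner_commute)
    qed
    show "continuous_on {0..s} (\<lambda>s. X h s \<bullet> X h s)"
      using assms by (intro continuous_on_inner continuous_on_subset[OF X_continuous]) auto
  qed (use assms in auto)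
  then have "X h s \<bullet> X h s = X h 0 \<bullet> X h 0"
    using has_integral_unique[OF has_integral_0] by force
  moreover have "norm (X h 0) = 1"
    using norm_T[of 0] L_pos by (simp add: init initial_tangent_eq)
  ultimately show ?thesis
    by (simp add: norm_eq_sqrt_inner)
qed

lemma norm_XD: "norm (XD h s) \<le> C"
proof (cases "s \<in> {0<..<L} - set (ss h)")
  case True
  have "norm (XD h s) \<le> C * norm (vel h s) * norm (X h s)"
    using True by (intro curvature[OF _ XD_parallel_at[OF True]]) auto
  also have "\<dots> \<le> C * 1 * 1"
    using True norm_vel_le[of h s] norm_X[of s h] C_nonneg by (intro mult_mono mult_left_mono) auto
  finally show ?thesis by simp
next
  case False
  have "XD h s = 0"
    unfolding XD_def using False by (rule if_not_P)
  then show ?thesis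
    using C_nonneg by simp
qed

lemma X_lipschitz:
  assumes "s \<in> {0..L}" "t \<in> {0..L}" "s \<le> t"
  shows "norm (X h t - X h s) \<le> C * (t - s)"
proof -
  have "(XD h has_integral (X h t - X h s)) {s..t}"
    by (rule fundamental_theorem_of_calculus_interior_strong[of "set (ss h)"])
       (use assms X_derivative[of _ h] in \<open>auto intro: continuous_on_subset[OF X_continuous]\<close>)
  then show ?thesis
    using has_integral_bound_real[of C "{}" "XD h" "X h t - X h s" s t] C_nonneg norm_XD assms by simp
qed

lemma XD_measurable: "XD h \<in> borel_measurable (lebesgue_on {0<..<L})"
proof -
  let ?A = "{0<..<L} - set (ss h)"
  have "continuous_on ({0..L} - set (ss h)) (\<lambda>x. vector_derivative (X h) (at x))"
    using par[of h] unfolding parallel_transport_def C1_differentiable_on_eq by blast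
  then have "continuous_on ?A (\<lambda>x. vector_derivative (X h) (at x))"
    by (rule continuous_on_subset) auto
  moreover have "?A \<in> sets borel"
    by (intro sets.Diff borel_open borel_closed) (auto intro: finite_imp_closed)
  ultimately have "(\<lambda>s. if s \<in> ?A then vector_derivative (X h) (at s) else 0) \<in> borel_measurable borel"
    by (intro borel_measurable_continuous_on_if) auto
  then have "XD h \<in> borel_measurable borel"
    by (simp add: XD_def[abs_def])
  then show ?thesis
    by (intro measurable_restrict_space1 measurable_completion) simp
qed

lemma X_weak_deriv: "has_weak_deriv 0 L (X h) (XD h)"
  by (rule has_weak_deriv_ftc[OF L_pos X_continuous _ X_derivative XD_measurable norm_XD]) auto

lemma transport_subsequence:
  obtains k Y where "strict_mono (k :: nat \<Rightarrow> nat)" "\<And>s. s \<in> {0..L} \<Longrightarrow> (\<lambda>n. X (r (k n)) s) \<longlonglongrightarrow> Y s"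
proof (rule Arzela_Ascoli[of "{0..L}" "\<lambda>n. X (r n)" 1])
  show "norm (X (r n) s) \<le> 1" if "s \<in> {0..L}" for n s
    using norm_X[OF that] by simp
  show "\<exists>d>0. \<forall>n y. y \<in> {0..L} \<and> norm (x - y) < d \<longrightarrow> norm (X (r n) x - X (r n) y) < e"
    if x: "x \<in> {0..L}" and "0 < e" for x e
  \<comment> \<open>The equi-Lipschitz constant is \<open>C\<close>; the summand 1 allows for
    \<open>C = 0\<close>.\<close>
  proof (intro exI[of _ "e / (C + 1)"] conjI allI impI)
    show "0 < e / (C + 1)"
      using \<open>0 < e\<close> C_nonneg by simp
    fix n y assume y: "y \<in> {0..L} \<and> norm (x - y) < e / (C + 1)"
    have "norm (X (r n) x - X (r n) y) \<le> C * norm (x - y)"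
      using X_lipschitz[of x y "r n"] X_lipschitz[of y x "r n"] x y by (cases "x \<le> y") (auto simp: norm_minus_commute)
    also have "\<dots> \<le> (C + 1) * norm (x - y)"
      by (simp add: mult_right_mono)
    also have "\<dots> < e"
      using y C_nonneg by (simp add: field_simps)
    finally show "norm (X (r n) x - X (r n) y) < e" .
  qed
  fix Y k assume "strict_mono (k :: nat \<Rightarrow> nat)"
    and lim: "\<And>e. 0 < e \<Longrightarrow> \<exists>N. \<forall>n x. n \<ge> N \<and> x \<in> {0..L} \<longrightarrow> norm (X (r (k n)) x - Y x) < e"
  moreover have "(\<lambda>n. X (r (k n)) s) \<longlonglongrightarrow> Y s" if "s \<in> {0..L}" for s
    using lim that by (intro LIMSEQ_I) blast
  ultimately show thesis
    using that by blast
qed auto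

end

section \<open>The limit field and strong convergence\<close>

locale transport_limit = transport_sequence M \<iota> c L ts ss P v \<mu> C K r F T B X
  for M :: "'m::t2_space set" and \<iota> :: "'m \<Rightarrow> 'a::euclidean_space" and c L ts ss P v \<mu> C K r F T B X +
  fixes Y :: "real \<Rightarrow> 'a"
  assumes Y: "\<And>s. s \<in> {0..L} \<Longrightarrow> (\<lambda>n. X (r n) s) \<longlonglongrightarrow> Y s"
begin

lemma norm_Y: "s \<in> {0..L} \<Longrightarrow> norm (Y s) = 1"
  using tendsto_norm[OF Y, of s] LIMSEQ_unique[OF _ tendsto_const] by (simp add: norm_X)

lemma polygon_subsequence_tendsto: "s \<in> {0..L} \<Longrightarrow> (\<lambda>n. P (r n) s) \<longlonglongrightarrow> c s"
  using LIMSEQ_subseq_LIMSEQ[OF polygon_tendsto r] by (simp add: o_def)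

lemma Y_tangent: "s \<in> {0..L} \<Longrightarrow> Y s \<in> tangent_plane M \<iota> (c s)"
  using tangent_plane_closed[OF imm c_in_M polygon_subsequence_tendsto _ Y] P_in_M X_tangent by simp

lemma Y_lipschitz:
  assumes "s \<in> {0..L}" "t \<in> {0..L}"
  shows "norm (Y t - Y s) \<le> C * \<bar>t - s\<bar>"
proof -
  have "norm (X h t - X h s) \<le> C * \<bar>t - s\<bar>" for h
    using X_lipschitz[of s t h] X_lipschitz[of t s h] assms by (cases "s \<le> t") (auto simp: norm_minus_commute)
  then show ?thesis
    using Lim_bounded[OF tendsto_norm[OF tendsto_diff[OF Y[OF assms(2)] Y[OF assms(1)]]], of 0] by blast
qed

lemma Y_continuous: "continuous_on {0..L} Y"
proof (rule continuous_onI)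
  fix x e :: real assume x: "x \<in> {0..L}" and "0 < e"
  show "\<exists>d>0. \<forall>x'\<in>{0..L}. dist x' x < d \<longrightarrow> dist (Y x') (Y x) \<le> e"
  proof (intro exI[of _ "e / (C + 1)"] conjI ballI impI)
    show "0 < e / (C + 1)"
      using \<open>0 < e\<close> C_nonneg by simp
    fix y assume y: "y \<in> {0..L}" "dist y x < e / (C + 1)"
    have "dist (Y y) (Y x) \<le> C * \<bar>y - x\<bar>"
      using Y_lipschitz[OF x y(1)] by (simp add: dist_norm)
    also have "\<dots> \<le> (C + 1) * \<bar>y - x\<bar>"
      by (simp add: mult_right_mono)
    also have "\<dots> \<le> e"
      using y(2) C_nonneg by (simp add: field_simps dist_real_def)
    finally show "dist (Y y) (Y x) \<le> e" .
  qed
qed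

text \<open>The weak derivative of \<open>Y\<close>; the limit exists almost everywhere, as
  \<open>XD_tendsto\<close> shows.\<close>

definition Z :: "real \<Rightarrow> 'a" where
  "Z s = lim (\<lambda>n. XD (r n) s)"

lemma AE_not_exceptional: "AE s in lebesgue_on {0<..<L}. s \<in> {0<..<L} \<and> s \<notin> E \<and> (\<forall>h. s \<notin> set (ss h))"
proof -
  let ?N = "E \<union> (\<Union>h. set (ss h))"
  have "countable ?N"
    using countable_E by (intro countable_Un countable_UN) (auto intro: countable_finite)
  then have "?N \<in> null_sets lebesgue"
    by (intro null_sets_completionI countable_imp_null_set_lborel)
  then have "AE s in lebesgue. s \<notin> ?N"
    by (rule AE_not_in)
  then show ?thesis
    by (subst AE_restrict_space_iff) (auto elim: eventually_mono)
qed

text \<open>At such a point the positions, the velocities and the transported vectors all converge,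
  with limits tangent at \<open>c s\<close>, so the values of the second fundamental form converge
  as well.\<close>

lemma XD_tendsto:
  assumes s: "s \<in> {0<..<L}" "s \<notin> E" "\<And>h. s \<notin> set (ss h)"
  shows "(\<lambda>n. XD (r n) s) \<longlonglongrightarrow> Z s"
proof -
  have "convergent (\<lambda>n. XD (r n) s)"
  proof (rule second_form_convergent[OF imm, where p="c s" and q="\<lambda>n. P (r n) s" and u="\<lambda>n. vel (r n) s"
        and w="\<lambda>n. X (r n) s" and ?u0.0="T s" and ?w0.0="Y s"])
    show "c s \<in> M" "(\<lambda>n. P (r n) s) \<longlonglongrightarrow> c s" "(\<lambda>n. X (r n) s) \<longlonglongrightarrow> Y s" "Y s \<in> tangent_plane M \<iota> (c s)"
      "\<forall>\<^sub>F n in sequentially. P (r n) s \<in> M"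
      using s c_in_M polygon_subsequence_tendsto Y Y_tangent P_in_M by auto
    show "(\<lambda>n. vel (r n) s) \<longlonglongrightarrow> T s"
      using s(2) by (intro vel_tendsto) (simp add: E_def)
    show "T s \<in> tangent_plane M \<iota> (c s)"
      using s(1) by (intro T_tangent) auto
    show "\<forall>\<^sub>F n in sequentially. parallel_at M \<iota> (P (r n) s) (vel (r n) s) (X (r n) s) (XD (r n) s)"
      using s by (intro always_eventually allI XD_parallel_at) auto
  qed
  then show ?thesis
    unfolding Z_def by (simp add: convergent_LIMSEQ_iff)
qed

lemma XD_tendsto_AE: "AE s in lebesgue_on {0<..<L}. (\<lambda>n. XD (r n) s) \<longlonglongrightarrow> Z s"
  using AE_not_exceptional by eventually_elim (use XD_tendsto in blast)

lemma X_tendsto_AE: "AE s in lebesgue_on {0<..<L}. (\<lambda>n. X (r n) s) \<longlonglongrightarrow> Y s"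
  using Y by (intro AE_I2) auto

lemma Z_measurable: "Z \<in> borel_measurable (lebesgue_on {0<..<L})"
  unfolding Z_def[abs_def] by (rule borel_measurable_lim_metric[OF XD_measurable])

lemma Y_measurable: "Y \<in> borel_measurable (lebesgue_on {0<..<L})"
  by (intro continuous_imp_measurable_on_sets_lebesgue continuous_on_subset[OF Y_continuous]) auto

lemma Y_weak_deriv: "has_weak_deriv 0 L Y Z"
proof (rule has_weak_deriv_limit[OF L_pos X_weak_deriv[of "r _"] _ _ X_tendsto_AE XD_tendsto_AE Y_measurable Z_measurable])
  show "norm (X (r n) s) \<le> 1 + C" "norm (XD (r n) s) \<le> 1 + C" if "s \<in> {0<..<L}" for n s
    using norm_X[of s "r n"] norm_XD[of "r n" s] C_nonneg that by auto
qed

text \<open>Functions and derivatives converge almost everywhere and are bounded by 1 and by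
  \<open>C\<close>; dominated convergence then gives convergence in mean of both.\<close>

lemma X_strong_convergence: "(\<lambda>n. W11_norm 0 L (\<lambda>s. X (r n) s - Y s)) \<longlonglongrightarrow> 0"
proof -
  let ?M = "lebesgue_on {0<..<L}"
  interpret finite_measure ?M
    by (rule finite_measure_lebesgue_on) (simp add: lmeasurable_open)
  have conv: "(\<lambda>n. LINT s|?M. norm (q n s - Q s)) \<longlonglongrightarrow> 0"
    if Q: "Q \<in> borel_measurable ?M" and q: "\<And>n. q n \<in> borel_measurable ?M" and lim: "AE s in ?M. (\<lambda>n. q n s) \<longlonglongrightarrow> Q s"
      and bound: "\<And>n s. s \<in> {0<..<L} \<Longrightarrow> norm (q n s) \<le> D" for q :: "nat \<Rightarrow> real \<Rightarrow> 'a" and Q D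
  proof -
    have "AE s in ?M. s \<in> {0<..<L}"
      by (rule AE_I2) simp
    with lim have QD: "AE s in ?M. (\<lambda>n. q n s) \<longlonglongrightarrow> Q s \<and> norm (Q s) \<le> D \<and> (\<forall>n. norm (q n s) \<le> D)"
    proof eventually_elim
      case (elim s)
      have "norm (Q s) \<le> D"
        using Lim_bounded[OF tendsto_norm[OF elim(1)], of 0 D] bound[OF elim(2)] by blast
      then show ?case
        using elim bound by blast
    qed
    have "(\<lambda>n. LINT s|?M. norm (q n s - Q s)) \<longlonglongrightarrow> (LINT s|?M. (0::real))"
    proof (rule integral_dominated_convergence[where w="\<lambda>s. 2 * D"])
      show "(\<lambda>s. norm (q n s - Q s)) \<in> borel_measurable ?M" for n
        by (rule measurable_compose[OF borel_measurable_diff[OF q Q] borel_measurable_norm])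
      show "AE s in ?M. (\<lambda>n. norm (q n s - Q s)) \<longlonglongrightarrow> 0"
        using QD
      proof eventually_elim
        case (elim s)
        have "(\<lambda>n. norm (q n s - Q s)) \<longlonglongrightarrow> norm (Q s - Q s)"
          using elim by (intro tendsto_norm tendsto_diff tendsto_const) blast
        then show ?case by simp
      qed
      show "AE s in ?M. norm (norm (q n s - Q s)) \<le> 2 * D" for n
        using QD
      proof eventually_elim
        case (elim s)
        have "norm (q n s) \<le> D" "norm (Q s) \<le> D"
          using elim by auto
        then show ?case
          using norm_triangle_ineq4[of "q n s" "Q s"] by simp
      qed
    qed auto
    then show ?thesis by simp
  qed
  have XM: "X h \<in> borel_measurable ?M" for h
    by (intro continuous_imp_measurable_on_sets_lebesgue continuous_on_subset[OF X_continuous]) auto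
  have "(\<lambda>n. LINT s|?M. norm (X (r n) s - Y s)) \<longlonglongrightarrow> 0"
    by (rule conv[OF Y_measurable XM X_tendsto_AE, of 1]) (simp add: norm_X)
  moreover have "(\<lambda>n. LINT s|?M. norm (XD (r n) s - Z s)) \<longlonglongrightarrow> 0"
    by (rule conv[OF Z_measurable XD_measurable XD_tendsto_AE norm_XD])
  ultimately have "(\<lambda>n. (LINT s|?M. norm (X (r n) s - Y s)) + (LINT s|?M. norm (XD (r n) s - Z s))) \<longlonglongrightarrow> 0 + 0"
    by (rule tendsto_add)
  then show ?thesis
    using W11_norm_eq[OF L_pos has_weak_deriv_diff[OF L_pos X_weak_deriv Y_weak_deriv]] by simp
qed

lemma X_in_W11: "X h \<in> W11 0 L"
  unfolding W11_def using X_weak_deriv by blast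

lemma Y_in_W11: "Y \<in> W11 0 L"
  unfolding W11_def using Y_weak_deriv by blast

end

section \<open>The angle between the limit field and the tantrix\<close>

locale framed_transport = transport_limit M \<iota> c L ts ss P v \<mu> C K r F T B X Y
  for M :: "'m::t2_space set" and \<iota> :: "'m \<Rightarrow> 'a::euclidean_space" and c L ts ss P v \<mu> C K r F T B X Y +
  fixes e1 e2 :: "real \<Rightarrow> 'a"
  assumes frame: "oriented_frame M \<iota> c L e1 e2"
begin

lemma frameD:
  assumes "s \<in> {0..L}"
  shows "e1 s \<in> tangent_plane M \<iota> (c s)" "e2 s \<in> tangent_plane M \<iota> (c s)" "e1 s \<bullet> e1 s = 1" "e2 s \<bullet> e2 s = 1"
    "e1 s \<bullet> e2 s = 0" "e2 s \<bullet> e1 s = 0" "norm (e1 s) = 1" "norm (e2 s) = 1"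
  using frame assms unfolding oriented_frame_def by (auto simp: norm_eq_1 inner_commute)

text \<open>The quarter turn of the tangent plane in the orientation of the frame; a normal
  component of \<open>x\<close> is discarded.\<close>

definition turn :: "real \<Rightarrow> 'a \<Rightarrow> 'a" where
  "turn s x = (x \<bullet> e1 s) *\<^sub>R e2 s - (x \<bullet> e2 s) *\<^sub>R e1 s"

lemma conormal_eq: "conormal \<iota> c e1 e2 s = turn s (tantrix \<iota> c s)"
  unfolding conormal_def turn_def ..

lemma turn_inner: "turn s x \<bullet> y = (x \<bullet> e1 s) * (y \<bullet> e2 s) - (x \<bullet> e2 s) * (y \<bullet> e1 s)"
  by (simp add: turn_def inner_diff_left inner_diff_right inner_commute[of _ y])

lemma inner_expand:
  assumes "s \<in> {0..L}" "x \<in> tangent_plane M \<iota> (c s)"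
  shows "x \<bullet> y = (x \<bullet> e1 s) * (y \<bullet> e1 s) + (x \<bullet> e2 s) * (y \<bullet> e2 s)"
proof -
  have "x = (x \<bullet> e1 s) *\<^sub>R e1 s + (x \<bullet> e2 s) *\<^sub>R e2 s"
    using frameD[OF assms(1)] assms(2) by (intro tangent_plane_orthonormal_expand[OF imm c_in_M[OF assms(1)]])
  then have "x \<bullet> y = ((x \<bullet> e1 s) *\<^sub>R e1 s + (x \<bullet> e2 s) *\<^sub>R e2 s) \<bullet> y" by simp
  then show ?thesis
    by (simp only: inner_add_left inner_scaleR_left inner_commute[of "e1 s" y] inner_commute[of "e2 s" y])
qed

lemma turn_props:
  assumes s: "s \<in> {0..L}" and x: "x \<in> tangent_plane M \<iota> (c s)" "norm x = 1"
  shows "turn s x \<in> tangent_plane M \<iota> (c s)" "norm (turn s x) = 1" "x \<bullet> turn s x = 0"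
proof -
  show "turn s x \<in> tangent_plane M \<iota> (c s)"
    unfolding turn_def using subspace_tangent_plane[OF imm c_in_M[OF s]] frameD[OF s]
    by (intro subspace_diff subspace_scale)
  have "(x \<bullet> e1 s) * (x \<bullet> e1 s) + (x \<bullet> e2 s) * (x \<bullet> e2 s) = 1"
    using inner_expand[OF s x(1), of x] x(2) by (simp add: norm_eq_1)
  then have "turn s x \<bullet> turn s x = 1"
    unfolding turn_inner using frameD[OF s] by (simp add: turn_def inner_diff_left)
  then show "norm (turn s x) = 1"
    by (simp add: norm_eq_1)
  show "x \<bullet> turn s x = 0"
    using turn_inner[of s x x] by (simp add: inner_commute)
qed

lemma turn_Y_continuous: "continuous_on {0..L} (\<lambda>s. turn s (Y s))"
  unfolding turn_def using frame unfolding oriented_frame_def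
  by (intro continuous_on_diff continuous_on_scaleR continuous_on_inner Y_continuous) auto

text \<open>The two products are the coordinates of the unit vector \<open>T s\<close> in the
  orthonormal frame \<open>Y s\<close>, \<open>turn s (Y s)\<close>. The frame is Lipschitz and
  \<open>T\<close> has its variation dominated by \<open>F\<close>, so the coordinates have
  variation dominated by \<open>V\<close>.\<close>

lemma angle_function:
  obtains \<Theta> where "\<Theta> \<in> BV 0 L"
    "\<And>s. s \<in> {0<..<L} \<Longrightarrow> Y s \<bullet> T s = cos (\<Theta> s) \<and> turn s (Y s) \<bullet> T s = sin (\<Theta> s)"
proof -
  obtain D where "0 \<le> D" and D: "\<And>s t. s \<in> {0..L} \<Longrightarrow> t \<in> {0..L} \<Longrightarrow> norm (turn t (Y t) - turn s (Y s)) \<le> D * \<bar>t - s\<bar>"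
    using rotated_field_lipschitz[OF imm arc L_pos C_nonneg Y_lipschitz Y_tangent turn_props(1)[OF _ Y_tangent norm_Y]
        norm_Y turn_props(2)[OF _ Y_tangent norm_Y] turn_props(3)[OF _ Y_tangent norm_Y] turn_Y_continuous]
    by auto
  \<comment> \<open>Truncation to \<open>[0, L]\<close> keeps the linear part bounded on the whole
    line.\<close>
  define V where "V s = (C + D) * max 0 (min s L) + F s" for s
  have V_mono: "mono V"
    unfolding V_def using C_nonneg \<open>0 \<le> D\<close> F_mono
    by (intro monoI add_mono mult_left_mono) (auto simp: mono_def)
  have var: "\<bar>q t \<bullet> T t - q s \<bullet> T s\<bar> \<le> V t - V s"
    if st: "s \<in> {0<..<L}" "t \<in> {0<..<L}" "s \<le> t" and q: "norm (q s) = 1" "norm (q t - q s) \<le> (C + D) * (t - s)"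
    for q :: "real \<Rightarrow> 'a" and s t
  proof -
    have "q t \<bullet> T t - q s \<bullet> T s = (q t - q s) \<bullet> T t + q s \<bullet> (T t - T s)"
      by (simp add: inner_diff_left inner_diff_right)
    then have "\<bar>q t \<bullet> T t - q s \<bullet> T s\<bar> \<le> \<bar>(q t - q s) \<bullet> T t\<bar> + \<bar>q s \<bullet> (T t - T s)\<bar>"
      by simp
    also have "\<dots> \<le> norm (q t - q s) * norm (T t) + norm (q s) * norm (T t - T s)"
      by (intro add_mono Cauchy_Schwarz_ineq2)
    also have "\<dots> \<le> (C + D) * (t - s) + (F t - F s)"
      using norm_T[of t] st q T_var[OF st(3)] by simp
    also have "\<dots> = V t - V s"
      using st by (simp add: V_def algebra_simps)
    finally show ?thesis .
  qed
  have lipY: "norm (Y t - Y s) \<le> (C + D) * (t - s)" "norm (turn t (Y t) - turn s (Y s)) \<le> (C + D) * (t - s)"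
    if "s \<in> {0<..<L}" "t \<in> {0<..<L}" "s \<le> t" for s t
  proof -
    have "C * (t - s) \<le> (C + D) * (t - s)" "D * (t - s) \<le> (C + D) * (t - s)"
      using C_nonneg \<open>0 \<le> D\<close> that by (auto intro: mult_right_mono)
    moreover have "norm (Y t - Y s) \<le> C * (t - s)" "norm (turn t (Y t) - turn s (Y s)) \<le> D * (t - s)"
      using Y_lipschitz[of s t] D[of s t] that by auto
    ultimately show "norm (Y t - Y s) \<le> (C + D) * (t - s)" "norm (turn t (Y t) - turn s (Y s)) \<le> (C + D) * (t - s)"
      by linarith+
  qed
  have unit: "norm (Y s) = 1" "norm (turn s (Y s)) = 1" if "s \<in> {0<..<L}" for s
    using norm_Y[of s] turn_props(2)[of s "Y s"] Y_tangent[of s] that by auto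
  have circle: "(Y s \<bullet> T s)\<^sup>2 + (turn s (Y s) \<bullet> T s)\<^sup>2 = 1" if s: "s \<in> {0<..<L}" for s
  proof -
    have s': "s \<in> {0..L}" using s by auto
    note t = turn_props[OF s' Y_tangent[OF s'] norm_Y[OF s']]
    have TT: "T s \<in> tangent_plane M \<iota> (c s)" "norm (T s) = 1"
      using T_tangent[of s] norm_T[of s] s by auto
    have "T s = (T s \<bullet> Y s) *\<^sub>R Y s + (T s \<bullet> turn s (Y s)) *\<^sub>R turn s (Y s)"
      by (rule tangent_plane_orthonormal_expand[OF imm c_in_M[OF s'] Y_tangent[OF s'] t(1) norm_Y[OF s'] t(2,3) TT(1)])
    then have "T s \<bullet> T s = ((T s \<bullet> Y s) *\<^sub>R Y s + (T s \<bullet> turn s (Y s)) *\<^sub>R turn s (Y s)) \<bullet> T s"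
      by simp
    also have "\<dots> = (Y s \<bullet> T s)\<^sup>2 + (turn s (Y s) \<bullet> T s)\<^sup>2"
      by (simp add: inner_add_left inner_add_right power2_eq_square inner_commute)
    finally show ?thesis
      using TT(2) by (simp add: norm_eq_1)
  qed
  have varY: "\<bar>Y t \<bullet> T t - Y s \<bullet> T s\<bar> \<le> V t - V s" if "s \<in> {0<..<L}" "t \<in> {0<..<L}" "s \<le> t" for s t
    by (rule var[OF that unit(1)[OF that(1)] lipY(1)[OF that]])
  have varT: "\<bar>turn t (Y t) \<bullet> T t - turn s (Y s) \<bullet> T s\<bar> \<le> V t - V s" if "s \<in> {0<..<L}" "t \<in> {0<..<L}" "s \<le> t" for s t
    by (rule var[of s t "\<lambda>s. turn s (Y s)", OF that unit(2)[OF that(1)] lipY(2)[OF that]])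
  show ?thesis
  proof (rule circle_lifting[OF V_mono circle varY varT])
    fix \<Theta>
    assume \<Theta>: "\<And>s. s \<in> {0<..<L} \<Longrightarrow> Y s \<bullet> T s = cos (\<Theta> s) \<and> turn s (Y s) \<bullet> T s = sin (\<Theta> s)"
      and \<Theta>var: "\<And>s t. s \<in> {0<..<L} \<Longrightarrow> t \<in> {0<..<L} \<Longrightarrow> s \<le> t \<Longrightarrow> \<bar>\<Theta> t - \<Theta> s\<bar> \<le>
        (4 * V t + 16 * real_of_int \<lfloor>4 * V t\<rfloor>) - (4 * V s + 16 * real_of_int \<lfloor>4 * V s\<rfloor>)"
    define U where "U s = 4 * V s + 16 * real_of_int \<lfloor>4 * V s\<rfloor>" for s
    have "\<Theta> \<in> BV 0 L"
    proof (rule BV_of_variation_bound[OF L_pos])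
      show "mono U"
        unfolding U_def using V_mono by (auto simp: mono_def intro!: monoI add_mono floor_mono)
      \<comment> \<open>With \<open>V\<close> between \<open>- Q\<close> and \<open>Q\<close>, the
        floor of \<open>4 * V\<close> exceeds \<open>4 * Q\<close> in absolute value by at most 1,
        so the bound is \<open>4 * Q + 16 * (4 * Q + 1)\<close>.\<close>
      show "\<bar>U s\<bar> \<le> 68 * ((C + D) * L + B) + 16" for s
      proof -
        have "0 \<le> (C + D) * max 0 (min s L)" "(C + D) * max 0 (min s L) \<le> (C + D) * L"
          using C_nonneg \<open>0 \<le> D\<close> L_pos by (auto intro!: mult_left_mono)
        moreover define Q where "Q = (C + D) * L + B"
        ultimately have VQ: "- Q \<le> V s" "V s \<le> Q"
          using F_bound[of s] unfolding V_def by (auto simp: abs_le_iff)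
        define k where "k = real_of_int \<lfloor>4 * V s\<rfloor>"
        have "k \<le> 4 * V s" "4 * V s < k + 1"
          unfolding k_def by linarith+
        then show ?thesis
          unfolding U_def abs_le_iff Q_def[symmetric] k_def[symmetric] using VQ by (intro conjI) linarith+
      qed
      show "\<bar>\<Theta> t - \<Theta> s\<bar> \<le> U t - U s" if "0 < s" "s \<le> t" "t < L" for s t
        unfolding U_def using that by (intro \<Theta>var) auto
    qed
    then show ?thesis
      using that \<Theta> by blast
  qed
qed

text \<open>The roles are exchanged: \<open>Y s\<close> is expanded in the frame of the tantrix and
  its quarter turn. Skew-symmetry of \<open>turn\<close> changes the sign of the sine.\<close>

lemma angle_representation:
  assumes s: "s \<in> {0<..<L}" "s \<notin> E" and \<Theta>: "Y s \<bullet> T s = cos \<theta>" "turn s (Y s) \<bullet> T s = sin \<theta>"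
  shows "Y s = cos \<theta> *\<^sub>R tantrix \<iota> c s - sin \<theta> *\<^sub>R conormal \<iota> c e1 e2 s"
proof -
  have s': "s \<in> {0..L}" using s by auto
  have t: "tantrix \<iota> c s = T s"
    using s by (intro tantrix_eq) auto
  have TT: "T s \<in> tangent_plane M \<iota> (c s)" "norm (T s) = 1"
    using T_tangent[of s] norm_T[of s] s by auto
  note tp = turn_props[OF s' TT]
  have "Y s = (Y s \<bullet> T s) *\<^sub>R T s + (Y s \<bullet> turn s (T s)) *\<^sub>R turn s (T s)"
    by (rule tangent_plane_orthonormal_expand[OF imm c_in_M[OF s'] TT(1) tp(1) TT(2) tp(2,3) Y_tangent[OF s']])
  moreover have "Y s \<bullet> turn s (T s) = - (turn s (Y s) \<bullet> T s)"
    using turn_inner[of s "T s" "Y s"] turn_inner[of s "Y s" "T s"] by (simp add: inner_commute)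
  ultimately show ?thesis
    unfolding conormal_eq t using \<Theta> by simp
qed

lemma framed_limit:
  obtains \<Theta> where "\<Theta> \<in> BV 0 L"
    "AE s in lebesgue_on {0<..<L}. Y s = cos (\<Theta> s) *\<^sub>R tantrix \<iota> c s - sin (\<Theta> s) *\<^sub>R conormal \<iota> c e1 e2 s"
proof -
  obtain \<Theta> where "\<Theta> \<in> BV 0 L" and \<Theta>: "\<And>s. s \<in> {0<..<L} \<Longrightarrow> Y s \<bullet> T s = cos (\<Theta> s) \<and> turn s (Y s) \<bullet> T s = sin (\<Theta> s)"
    using angle_function by blast
  moreover have "AE s in lebesgue_on {0<..<L}. Y s = cos (\<Theta> s) *\<^sub>R tantrix \<iota> c s - sin (\<Theta> s) *\<^sub>R conormal \<iota> c e1 e2 s"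
    using AE_not_exceptional
  proof eventually_elim
    case (elim s)
    then show ?case
      using \<Theta>[of s] by (intro angle_representation) auto
  qed
  ultimately show ?thesis
    using that by blast
qed

end

section \<open>Extraction of the subsequence\<close>

theorem theorem1p1:
  fixes M :: "'m::t2_space set"
    and \<iota> :: "'m \<Rightarrow> real^'n"
    and c :: "real \<Rightarrow> 'm"
    and L :: real
    and e1 e2 :: "real \<Rightarrow> real^'n"
    and ts ss :: "nat \<Rightarrow> real list"
    and P :: "nat \<Rightarrow> real \<Rightarrow> 'm"
    and X :: "nat \<Rightarrow> real \<Rightarrow> real^'n"
  assumes "3 \<le> CARD('n)"
    and "compact M" and "immersed_surface M \<iota>"
    and "0 < L" and "arc_length_curve M \<iota> c L"
    and "total_curvature M \<iota> c 0 L < \<infinity>"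
    and "oriented_frame M \<iota> c L e1 e2"
    and "\<And>h. inscribed M \<iota> c 0 L L (ts h) (ss h) (P h)"
    and "\<And>h. hd (ts h) = 0" and "\<And>h. last (ts h) = L"
    and "(\<lambda>h. modulus M \<iota> c (ts h)) \<longlonglongrightarrow> 0"
    and "\<And>h. parallel_transport M \<iota> L (ss h) (P h) (X h)"
    and "\<And>h. X h 0 = initial_tangent \<iota> c L"
  shows "\<exists>r Y \<Theta>. strict_mono (r :: nat \<Rightarrow> nat) \<and>
           (\<forall>k. X (r k) \<in> W11 0 L) \<and> Y \<in> W11 0 L \<and>
           (\<lambda>k. W11_norm 0 L (\<lambda>s. X (r k) s - Y s)) \<longlonglongrightarrow> 0 \<and>
           \<Theta> \<in> BV 0 L \<and>
           (AE s in lebesgue_on {0<..<L}.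
              Y s = cos (\<Theta> s) *\<^sub>R tantrix \<iota> c s - sin (\<Theta> s) *\<^sub>R conormal \<iota> c e1 e2 s)"
proof -
  have "\<exists>v. constant_speed_polygon M \<iota> L (ss h) (P h) v" for h
    using polygonal_speed[of M \<iota> L "ss h" "P h"] assms(8)[of h] unfolding inscribed_def by metis
  then obtain v where v: "\<And>h. constant_speed_polygon M \<iota> L (ss h) (P h) (v h)"
    by metis
  \<comment> \<open>The modulus is an extended real; as it tends to 0 it is eventually finite, and
    from then on \<open>\<mu> h\<close> is its exact value.\<close>
  define \<mu> where "\<mu> h = real_of_ereal (modulus M \<iota> c (ts h))" for h
  have \<mu>: "\<mu> \<longlonglongrightarrow> 0"
    using lim_real_of_ereal[of "\<lambda>h. modulus M \<iota> c (ts h)" 0 sequentially] assms(11)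
    unfolding \<mu>_def by (simp add: zero_ereal_def)
  obtain \<epsilon> K where "0 < \<epsilon>" and K: "\<And>l ts ss P. inscribed M \<iota> c 0 L l ts ss P \<Longrightarrow> modulus M \<iota> c ts < ereal \<epsilon> \<Longrightarrow> rotation \<iota> l ss P \<le> K"
    using rotation_bounded[OF assms(6)] by blast
  have "\<forall>\<^sub>F h in sequentially. - 1 < modulus M \<iota> c (ts h)"
    by (rule order_tendstoD(1)[OF assms(11)]) simp
  moreover have "\<forall>\<^sub>F h in sequentially. modulus M \<iota> c (ts h) < ereal \<epsilon>"
    by (rule order_tendstoD(2)[OF assms(11)]) (use \<open>0 < \<epsilon>\<close> in simp)
  ultimately have "\<forall>\<^sub>F h in sequentially. modulus M \<iota> c (ts h) \<le> ereal (\<mu> h) \<and> modulus M \<iota> c (ts h) < ereal \<epsilon>"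
  proof eventually_elim
    case (elim h)
    then show ?case
      unfolding \<mu>_def by (cases "modulus M \<iota> c (ts h)") auto
  qed
  then obtain N1 where N1: "\<And>h. h \<ge> N1 \<Longrightarrow> modulus M \<iota> c (ts h) \<le> ereal (\<mu> h)" "\<And>h. h \<ge> N1 \<Longrightarrow> modulus M \<iota> c (ts h) < ereal \<epsilon>"
    unfolding eventually_sequentially by blast
  \<comment> \<open>The locales ask for their bounds at every index, so the first terms are
    discarded by a shift; the shift is left variable because a larger one is needed for the
    curvature bound.\<close>
  have seq: "inscribed_sequence M \<iota> c L (\<lambda>h. ts (h + n)) (\<lambda>h. ss (h + n)) (\<lambda>h. P (h + n)) (\<lambda>h. v (h + n)) (\<lambda>h. \<mu> (h + n))"
    if "n \<ge> N1" for n
    by (intro inscribed_sequence.intro inscribed_polygon.intro inscribed_polygon_axioms.intro v assms N1 LIMSEQ_ignore_initial_segment[OF \<mu>])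
       (use that in simp)
  obtain C where "0 \<le> C" and C: "\<forall>\<^sub>F h in sequentially. \<forall>s\<in>{0..L}. \<forall>u w z. parallel_at M \<iota> (P (h + N1) s) u w z \<longrightarrow> norm z \<le> C * norm u * norm w"
    using inscribed_sequence.uniform_curvature_bound[OF seq[of N1]] by blast
  then obtain N2 where N2: "\<And>h s u w z. h \<ge> N2 \<Longrightarrow> s \<in> {0..L} \<Longrightarrow> parallel_at M \<iota> (P (h + N1) s) u w z \<Longrightarrow> norm z \<le> C * norm u * norm w"
    unfolding eventually_sequentially by blast
  \<comment> \<open>The bound \<open>C\<close> holds from \<open>N2\<close> on for the sequence that
    is already shifted by \<open>N1\<close>.\<close>
  define N where "N = N2 + N1"
  have curved: "curved_sequence M \<iota> c L (\<lambda>h. ts (h + N)) (\<lambda>h. ss (h + N)) (\<lambda>h. P (h + N)) (\<lambda>h. v (h + N)) (\<lambda>h. \<mu> (h + N)) C K"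
  proof (intro curved_sequence.intro curved_sequence_axioms.intro seq \<open>0 \<le> C\<close>)
    show "N1 \<le> N"
      by (simp add: N_def)
    show "norm z \<le> C * norm u * norm w" if "s \<in> {0..L}" "parallel_at M \<iota> (P (h + N) s) u w z" for h s u w z
      using N2[of "h + N2" s u w z] that by (simp add: N_def add.assoc)
    show "rotation \<iota> L (ss (h + N)) (P (h + N)) \<le> K" for h
      by (rule K[OF assms(8) N1(2)]) (simp add: N_def)
  qed
  interpret cs: curved_sequence M \<iota> c L "\<lambda>h. ts (h + N)" "\<lambda>h. ss (h + N)" "\<lambda>h. P (h + N)" "\<lambda>h. v (h + N)" "\<lambda>h. \<mu> (h + N)" C K
    by (rule curved)
  obtain r F T B where r: "strict_mono (r :: nat \<Rightarrow> nat)" and F: "mono F" "\<And>x. continuous (at_right x) F" "\<And>x. \<bar>F x\<bar> \<le> B"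
    "\<And>s t. s \<le> t \<Longrightarrow> norm (T t - T s) \<le> F t - F s" and lim: "\<And>x. isCont F x \<Longrightarrow> (\<lambda>n. cs.vel (r n) x) \<longlonglongrightarrow> T x"
    using cs.velocity_subsequence by metis
  \<comment> \<open>Stated for any subsequence \<open>r'\<close> because it serves twice: for
    \<open>r\<close>, where the transports are shown to have a convergent subsequence, and for the
    refinement of \<open>r\<close> along which they converge.\<close>
  have ts: "transport_sequence M \<iota> c L (\<lambda>h. ts (h + N)) (\<lambda>h. ss (h + N)) (\<lambda>h. P (h + N)) (\<lambda>h. v (h + N)) (\<lambda>h. \<mu> (h + N)) C K r' F T B (\<lambda>h. X (h + N))"
    if "strict_mono r'" "\<And>x. isCont F x \<Longrightarrow> (\<lambda>n. cs.vel (r' n) x) \<longlonglongrightarrow> T x" for r'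
    by (intro transport_sequence.intro velocity_limit.intro velocity_limit_axioms.intro transport_sequence_axioms.intro curved F assms that)
  interpret t: transport_sequence M \<iota> c L "\<lambda>h. ts (h + N)" "\<lambda>h. ss (h + N)" "\<lambda>h. P (h + N)" "\<lambda>h. v (h + N)" "\<lambda>h. \<mu> (h + N)" C K r F T B "\<lambda>h. X (h + N)"
    by (rule ts[OF r lim])
  obtain k Y where k: "strict_mono (k :: nat \<Rightarrow> nat)" and Y: "\<And>s. s \<in> {0..L} \<Longrightarrow> (\<lambda>n. X (r (k n) + N) s) \<longlonglongrightarrow> Y s"
    using t.transport_subsequence by metis
  have rk: "strict_mono (\<lambda>n. r (k n))"
    using strict_mono_o[OF r k] by (simp add: o_def)
  have limk: "(\<lambda>n. cs.vel (r (k n)) x) \<longlonglongrightarrow> T x" if "isCont F x" for x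
    using LIMSEQ_subseq_LIMSEQ[OF lim[OF that] k] by (simp add: o_def)
  interpret f: framed_transport M \<iota> c L "\<lambda>h. ts (h + N)" "\<lambda>h. ss (h + N)" "\<lambda>h. P (h + N)" "\<lambda>h. v (h + N)" "\<lambda>h. \<mu> (h + N)" C K
      "\<lambda>n. r (k n)" F T B "\<lambda>h. X (h + N)" Y e1 e2
    by (intro framed_transport.intro transport_limit.intro transport_limit_axioms.intro framed_transport_axioms.intro ts rk limk Y assms)
  obtain \<Theta> where \<Theta>: "\<Theta> \<in> BV 0 L"
    "AE s in lebesgue_on {0<..<L}. Y s = cos (\<Theta> s) *\<^sub>R tantrix \<iota> c s - sin (\<Theta> s) *\<^sub>R conormal \<iota> c e1 e2 s"
    using f.framed_limit by blast
  \<comment> \<open>The discarded terms reappear as a shift of the index in the original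
    sequence.\<close>
  have "strict_mono (\<lambda>n. r (k n) + N)"
    using rk by (simp add: strict_mono_def)
  then show ?thesis
    using f.X_in_W11 f.Y_in_W11 f.X_strong_convergence \<Theta>
    by (intro exI[of _ "\<lambda>n. r (k n) + N"] exI[of _ Y] exI[of _ \<Theta>]) simp
qed

end
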